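(* Let $(\omega,\psi_\pm)$ be an $\mathrm{SU}(3)$-structure on a 6-manifold $M^6$, let $f$ be a non-vanishing smooth function on $M^6$, let $\alpha,\beta\in\mathbb R$ with $\alpha^2+\beta^2=1$, and suppose that the warped $\mathrm{G}_2$-structure $\varphi=f\,\omega\wedge ds+(\alpha\psi_+-\beta\psi_-)$ on $M^6\times_f S^1$ is coclosed, i.e. $d_7(\ast_7\varphi)=0$. Then $$\begin{aligned}\Delta_7\ast_7\varphi={}&\tfrac32(\alpha\pi_0-\beta\sigma_0)\big[(\alpha\pi_0-\beta\sigma_0)\omega^2+\pi_1\wedge(\alpha\psi_+-\beta\psi_-)-(\alpha\pi_2-\beta\sigma_2)\wedge\omega\big]+d_6\ast_6(\pi_1\wedge\omega)\\&-d_6(\ast_6\nu_3)+\tfrac32d_6(\alpha\pi_0-\beta\sigma_0)\wedge(\alpha\psi_+-\beta\psi_-)\\&+f\Big[2d_6(\alpha\pi_0-\beta\sigma_0)\wedge\omega+(\alpha\pi_0-\beta\sigma_0)\big(-2\pi_1\wedge\omega-3\sigma_0\psi_++3\pi_0\psi_-+2\nu_3\big)+d_6(\alpha\pi_2-\beta\sigma_2)\\&\quad-\pi_1\wedge\ast_6\big(\pi_1\wedge(\alpha\psi_+-\beta\psi_-)\big)+d_6\ast_6\big(\pi_1\wedge(\alpha\psi_+-\beta\psi_-)\big)-\pi_1\wedge(\alpha\pi_2-\beta\sigma_2)\Big]\wedge ds,\end{aligned}$$ where $\alpha\sigma_i+\beta\pi_i=0$ for $i=0,2$. Moreover, if $f$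 is constant, then $$\begin{aligned}\Delta_7\ast_7\varphi={}&\tfrac32(\alpha\pi_0-\beta\sigma_0)\big((\alpha\pi_0-\beta\sigma_0)\omega^2-(\alpha\pi_2-\beta\sigma_2)\wedge\omega\big)-d_6(\ast_6\nu_3)+\tfrac32d_6(\alpha\pi_0-\beta\sigma_0)\wedge(\alpha\psi_+-\beta\psi_-)\\&+f\Big[2d_6(\alpha\pi_0-\beta\sigma_0)\wedge\omega+(\alpha\pi_0-\beta\sigma_0)\big(-3\sigma_0\psi_++3\pi_0\psi_-+2\nu_3\big)+d_6(\alpha\pi_2-\beta\sigma_2)\Big]\wedge ds.\end{aligned}$$
   Context: $\mathrm{SU}(3)$-structures. An $\mathrm{SU}(3)$-structure on a 6-manifold $M^6$ is a triple $(\omega,\psi_+,\psi_-)$ of a 2-form and two 3-forms such that locally there is a coframe $\{e^1,\dots,e^6\}$ (an adapted basis) with $\omega=e^{12}+e^{34}+e^{56}$, $\psi_+=e^{135}-e^{146}-e^{236}-e^{245}$, $\psi_-=-e^{246}+e^{235}+e^{145}+e^{136}$, where $e^{ij}=e^i\wedge e^j$, etc. The induced metric $g_{\omega,\psi_\pm}$ is the one for which adapted bases are orthonormal, the volume form is $vol_6=\frac1{3!}\omega^3=e^{123456}$, and $\ast_6$ is the corresponding Hodge star. $d_6$ denotes the exterior derivative on $M^6$. Put $\Omega^2_8(M^6)=\{\sigma\in\Omega^2(M^6):\sigma\wedge\psi_+=0,\ \ast_6\sigma=-\sigma\wedge\omega\}$ and $\Omega^3_{12}(M^6)=\{\gamma\in\Omega^3(M^6):\gamma\wedge\omega=0,\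 \gamma\wedge\psi_\pm=0\}$. The torsion forms are the functions $\sigma_0,\pi_0$, 1-forms $\pi_1,\nu_1$, 2-forms $\pi_2,\sigma_2\in\Omega^2_8(M^6)$ and 3-form $\nu_3\in\Omega^3_{12}(M^6)$ determined by $$d\omega=-\tfrac32\sigma_0\psi_++\tfrac32\pi_0\psi_-+\nu_1\wedge\omega+\nu_3,\quad d\psi_+=\pi_0\omega^2+\pi_1\wedge\psi_+-\pi_2\wedge\omega,\quad d\psi_-=\sigma_0\omega^2+\pi_1\wedge\psi_--\sigma_2\wedge\omega.$$ Warped $\mathrm{G}_2$-structures. $s$ is the coordinate on $S^1$. The 3-form $\varphi=f\,\omega\wedge ds+(\alpha\psi_+-\beta\psi_-)$ on $M^6\times S^1$ is a $\mathrm{G}_2$-structure with metric $g_\varphi=g_{\omega,\psi_\pm}+f^2ds^2$ and volume form $vol_7=f\,vol_6\wedge ds$; $\ast_7$ is the corresponding Hodge star. One has $\ast_7\varphi=\frac12\omega^2+f(\alpha\psi_-+\beta\psi_+)\wedge ds$. $M^6\times_f S^1$ denotes $M^6\times S^1$ with this warped metric. $d_7$ is the exterior derivative on $M^6\times S^1$ and $\Delta_7$ the Hodge Laplacian of $g_\varphi$, with sign convention $\Delta_7=d_7d_7^*+d_7^*d_7$; thus $\Delta_7=\ast_7d_7\ast_7d_7-d_7\ast_7d_7\ast_7$ on 3-forms, and $\Delta_7\ast_7=\ast_7\Delta_7$. *)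

theory Defs
  imports "HOL-Analysis.Analysis" "HOL-Library.Function_Algebras"
begin

section \<open>Smooth manifolds\<close>

primrec Ck_on :: "nat \<Rightarrow> ('e::real_normed_vector \<Rightarrow> 'b::real_normed_vector) \<Rightarrow> 'e set \<Rightarrow> bool" where
  "Ck_on 0 f S \<longleftrightarrow> continuous_on S f"
| "Ck_on (Suc n) f S \<longleftrightarrow> f differentiable_on S \<and>
     (\<forall>v. Ck_on n (\<lambda>x. frechet_derivative f (at x) v) S)"

text \<open>Only used for open \<open>S\<close>.\<close>

definition smooth_on :: "'e::real_normed_vector set \<Rightarrow> ('e \<Rightarrow> 'b::real_normed_vector) \<Rightarrow> bool" where
  "smooth_on S f \<longleftrightarrow> (\<forall>n. Ck_on n f S)"

text \<open>
  The atlas is an indexed family of local parametrisations: \<open>par M i\<close> maps the open subset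
  \<open>cdom M i\<close> of the model space \<open>'e\<close> homeomorphically onto an open subset of the manifold, i.e. it
  is the inverse of a coordinate chart. The dimension of the manifold is that of \<open>'e\<close>.
\<close>

record ('a, 'i, 'e) mfd =
  mtop :: "'a topology"
  idx :: "'i set"
  cdom :: "'i \<Rightarrow> 'e set"
  par :: "'i \<Rightarrow> 'e \<Rightarrow> 'a"

definition overlap :: "('a, 'i, 'e) mfd \<Rightarrow> 'i \<Rightarrow> 'i \<Rightarrow> 'e set" where
  "overlap M i j = {x \<in> cdom M i. par M i x \<in> par M j ` cdom M j}"

definition transition :: "('a, 'i, 'e) mfd \<Rightarrow> 'i \<Rightarrow> 'i \<Rightarrow> 'e \<Rightarrow> 'e" where
  "transition M i j = inv_into (cdom M j) (par M j) \<circ> par M i"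

definition smooth_manifold :: "('a, 'i, 'e::euclidean_space) mfd \<Rightarrow> bool" where
  "smooth_manifold M \<longleftrightarrow>
     Hausdorff_space (mtop M) \<and> second_countable (mtop M) \<and>
     (\<forall>i\<in>idx M. open (cdom M i) \<and> openin (mtop M) (par M i ` cdom M i) \<and>
        homeomorphic_map (top_of_set (cdom M i)) (subtopology (mtop M) (par M i ` cdom M i)) (par M i)) \<and>
     (\<Union>i\<in>idx M. par M i ` cdom M i) = topspace (mtop M) \<and>
     (\<forall>i\<in>idx M. \<forall>j\<in>idx M. smooth_on (overlap M i j) (transition M i j))"

definition smooth_fun :: "('a, 'i, 'e::euclidean_space) mfd \<Rightarrow> ('a \<Rightarrow> real) \<Rightarrow> bool" where
  "smooth_fun M f \<longleftrightarrow> (\<forall>i\<in>idx M. smooth_on (cdom M i) (f \<circ> par M i))"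

definition prod_mfd :: "('a, 'i, 'e) mfd \<Rightarrow> ('b, 'j, 'f) mfd \<Rightarrow> ('a \<times> 'b, 'i \<times> 'j, 'e \<times> 'f) mfd"
    (infixr "\<times>\<^sub>m" 80) where
  "M \<times>\<^sub>m N = \<lparr>mtop = prod_topology (mtop M) (mtop N), idx = idx M \<times> idx N,
     cdom = (\<lambda>(i, j). cdom M i \<times> cdom N j), par = (\<lambda>(i, j). map_prod (par M i) (par N j))\<rparr>"

text \<open>The unit circle; the local coordinate in every parametrisation is the angle \<open>s\<close>.\<close>

definition circle :: "(complex, real, real) mfd" where
  "circle = \<lparr>mtop = top_of_set (sphere 0 1), idx = UNIV,
     cdom = (\<lambda>t. {t<..<t + 2 * pi}), par = (\<lambda>_. cis)\<rparr>"

section \<open>Exterior algebra of a vector space\<close>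

text \<open>
  An element of the exterior algebra of the dual space is a function on lists of vectors; its
  homogeneous component of degree \<open>k\<close> is its restriction to lists of length \<open>k\<close>. With this
  convention the wedge product needs no degree arguments.
\<close>

type_synonym 'e alt = "'e list \<Rightarrow> real"

definition alternating :: "'e::real_vector alt \<Rightarrow> bool" where
  "alternating a \<longleftrightarrow> (\<forall>us vs. linear (\<lambda>v. a (us @ v # vs))) \<and>
     (\<forall>us vs ws v. a (us @ v # vs @ v # ws) = 0)"

definition alt_form :: "nat \<Rightarrow> 'e::real_vector alt \<Rightarrow> bool" where
  "alt_form k a \<longleftrightarrow> alternating a \<and> (\<forall>vs. length vs \<noteq> k \<longrightarrow> a vs = 0)"

text \<open>Sign of the shuffle that moves the positions in \<open>J\<close> to the front.\<close>

definition shuffle_sign :: "nat \<Rightarrow> nat set \<Rightarrow> real" where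
  "shuffle_sign n J = (-1) ^ card {(i, j). i \<in> J \<and> j \<in> {..<n} - J \<and> j < i}"

text \<open>
  Determinant convention: \<open>(a \<and> b) [u, v] = a [u] * b [v] - a [v] * b [u]\<close> for covectors \<open>a\<close>, \<open>b\<close>.
  If \<open>a\<close> has degree \<open>k\<close>, only the summands with \<open>card J = k\<close> contribute.
\<close>

definition alt_wedge :: "'e alt \<Rightarrow> 'e alt \<Rightarrow> 'e alt" (infixl "\<and>\<^sub>p" 70) where
  "a \<and>\<^sub>p b = (\<lambda>vs. \<Sum>J\<in>Pow {..<length vs}.
     shuffle_sign (length vs) J * a (nths vs J) * b (nths vs (- J)))"

definition orthonormal_basis :: "('e::euclidean_space \<Rightarrow> 'e \<Rightarrow> real) \<Rightarrow> 'e list \<Rightarrow> bool" where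
  "orthonormal_basis g b \<longleftrightarrow> length b = DIM('e) \<and>
     (\<forall>i<DIM('e). \<forall>j<DIM('e). g (b ! i) (b ! j) = (if i = j then 1 else 0))"

text \<open>
  The inner product that \<open>g\<close> induces on the exterior algebra, for which the increasing wedge
  products of an orthonormal coframe are orthonormal; it does not depend on the basis \<open>b\<close>.
\<close>

definition alt_inner :: "('e::euclidean_space \<Rightarrow> 'e \<Rightarrow> real) \<Rightarrow> 'e alt \<Rightarrow> 'e alt \<Rightarrow> real" where
  "alt_inner g a c = (let b = (SOME b. orthonormal_basis g b) in
     \<Sum>J\<in>Pow {..<DIM('e)}. a (nths b J) * c (nths b J))"

text \<open>
  The Hodge star of \<open>a\<close>: \<open>c \<and> *a = g(c, a) vol\<close> for all \<open>c\<close>. For mixed \<open>c\<close> this is an equality of top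
  degree components; for \<open>a\<close> of degree \<open>k\<close> it is the usual condition on \<open>c\<close> of degree \<open>k\<close>, together with
  \<open>*a\<close> having no component of degree other than \<open>n - k\<close>.
\<close>

definition alt_star :: "('e::euclidean_space \<Rightarrow> 'e \<Rightarrow> real) \<Rightarrow> 'e alt \<Rightarrow> 'e alt \<Rightarrow> 'e alt" where
  "alt_star g vol a = (THE s. alternating s \<and>
     (\<forall>c. alternating c \<longrightarrow>
        (\<forall>vs. length vs = DIM('e) \<longrightarrow> (c \<and>\<^sub>p s) vs = alt_inner g c a * vol vs)))"

section \<open>Differential forms\<close>

text \<open>
  A differential form is given by its expressions \<open>\<eta> i\<close> in the local parametrisations, which have to
  match under the transition maps. Values outside the coordinate domains are irrelevant, so
  equality of forms is expressed by \<open>form_eq\<close>. Sums, differences and the zero form are pointwise.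
\<close>

type_synonym ('i, 'e) form = "'i \<Rightarrow> 'e \<Rightarrow> 'e alt"
type_synonym ('i, 'e) metric = "'i \<Rightarrow> 'e \<Rightarrow> 'e \<Rightarrow> 'e \<Rightarrow> real"

definition diff_form :: "('a, 'i, 'e::euclidean_space) mfd \<Rightarrow> nat \<Rightarrow> ('i, 'e) form \<Rightarrow> bool" where
  "diff_form M k \<eta> \<longleftrightarrow>
     (\<forall>i\<in>idx M. \<forall>x\<in>cdom M i. alt_form k (\<eta> i x)) \<and>
     (\<forall>i\<in>idx M. \<forall>vs. smooth_on (cdom M i) (\<lambda>x. \<eta> i x vs)) \<and>
     (\<forall>i\<in>idx M. \<forall>j\<in>idx M. \<forall>x\<in>overlap M i j. \<forall>vs.
        \<eta> i x vs = \<eta> j (transition M i j x) (map (frechet_derivative (transition M i j) (at x)) vs))"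

definition form_eq :: "('a, 'i, 'e) mfd \<Rightarrow> ('i, 'e) form \<Rightarrow> ('i, 'e) form \<Rightarrow> bool" where
  "form_eq M \<eta> \<theta> \<longleftrightarrow> (\<forall>i\<in>idx M. \<forall>x\<in>cdom M i. \<eta> i x = \<theta> i x)"

text \<open>A function regarded as a 0-form.\<close>

definition fn :: "('a, 'i, 'e) mfd \<Rightarrow> ('a \<Rightarrow> real) \<Rightarrow> ('i, 'e) form" where
  "fn M f = (\<lambda>i x vs. if vs = [] then f (par M i x) else 0)"

definition form_scale :: "real \<Rightarrow> ('i, 'e) form \<Rightarrow> ('i, 'e) form" (infixr "*\<^sub>f" 75) where
  "c *\<^sub>f \<eta> = (\<lambda>i x vs. c * \<eta> i x vs)"

definition wedge :: "('i, 'e) form \<Rightarrow> ('i, 'e) form \<Rightarrow> ('i, 'e) form" (infixl "\<and>\<^sub>f" 70) where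
  "\<eta> \<and>\<^sub>f \<theta> = (\<lambda>i x. \<eta> i x \<and>\<^sub>p \<theta> i x)"

text \<open>
  \<open>(d\<eta>)(v\<^sub>0, \<dots>, v\<^sub>k) = \<Sum>\<^sub>m (-1)\<^sup>m D\<^bsub>v\<^sub>m\<^esub> \<eta>(v\<^sub>0, \<dots>, v\<^bsub>m-1\<^esub>, v\<^bsub>m+1\<^esub>, \<dots>, v\<^sub>k)\<close> for constant vectors in the model space.
\<close>

definition ext_d :: "('i, 'e::real_normed_vector) form \<Rightarrow> ('i, 'e) form" where
  "ext_d \<eta> = (\<lambda>i x vs. \<Sum>m<length vs. (-1) ^ m *
     frechet_derivative (\<lambda>y. \<eta> i y (take m vs @ drop (Suc m) vs)) (at x) (vs ! m))"

definition hodge :: "('i, 'e::euclidean_space) metric \<Rightarrow> ('i, 'e) form \<Rightarrow> ('i, 'e) form \<Rightarrow> ('i, 'e) form" where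
  "hodge g vol \<eta> = (\<lambda>i x. alt_star (g i x) (vol i x) (\<eta> i x))"

definition codiff :: "('i, 'e::euclidean_space) metric \<Rightarrow> ('i, 'e) form \<Rightarrow> nat \<Rightarrow> ('i, 'e) form \<Rightarrow> ('i, 'e) form" where
  "codiff g vol k \<eta> = ((-1) ^ (DIM('e) * (k + 1) + 1)) *\<^sub>f hodge g vol (ext_d (hodge g vol \<eta>))"

text \<open>The Hodge Laplacian \<open>d d\<^sup>* + d\<^sup>* d\<close> on \<open>k\<close>-forms.\<close>

definition laplacian :: "('i, 'e::euclidean_space) metric \<Rightarrow> ('i, 'e) form \<Rightarrow> nat \<Rightarrow> ('i, 'e) form \<Rightarrow> ('i, 'e) form" where
  "laplacian g vol k \<eta> = ext_d (codiff g vol k \<eta>) + codiff g vol (Suc k) (ext_d \<eta>)"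

text \<open>
  Pullback along the projection \<open>M \<times> S\<^sup>1 \<rightarrow> M\<close>, and the form \<open>ds\<close> on \<open>M \<times> S\<^sup>1\<close>, in product
  parametrisations.
\<close>

definition pr :: "('i, 'e) form \<Rightarrow> ('i \<times> real, 'e \<times> real) form" where
  "pr \<eta> = (\<lambda>(i, j) (x, t) vs. \<eta> i x (map fst vs))"

definition ds :: "('i \<times> real, 'e \<times> real) form" where
  "ds = (\<lambda>(i, j) (x, t) vs. case vs of [v] \<Rightarrow> snd v | _ \<Rightarrow> 0)"

section \<open>SU(3)-structures on 6-manifolds\<close>

definition coframe6 :: "(nat \<Rightarrow> 'e::euclidean_space alt) \<Rightarrow> bool" where
  "coframe6 e \<longleftrightarrow> (\<forall>k\<in>{1..6}. alt_form 1 (e k)) \<and>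
     (\<forall>c. (\<forall>v. (\<Sum>k=1..6. c k * e k [v]) = 0) \<longrightarrow> (\<forall>k\<in>{1..6::nat}. c k = 0))"

definition adapted :: "(nat \<Rightarrow> 'e::euclidean_space alt) \<Rightarrow> 'e alt \<Rightarrow> 'e alt \<Rightarrow> 'e alt \<Rightarrow> bool" where
  "adapted e w p m \<longleftrightarrow> coframe6 e \<and>
     w = e 1 \<and>\<^sub>p e 2 + e 3 \<and>\<^sub>p e 4 + e 5 \<and>\<^sub>p e 6 \<and>
     p = e 1 \<and>\<^sub>p e 3 \<and>\<^sub>p e 5 - e 1 \<and>\<^sub>p e 4 \<and>\<^sub>p e 6 - e 2 \<and>\<^sub>p e 3 \<and>\<^sub>p e 6 - e 2 \<and>\<^sub>p e 4 \<and>\<^sub>p e 5 \<and>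
     m = - (e 2 \<and>\<^sub>p e 4 \<and>\<^sub>p e 6) + e 2 \<and>\<^sub>p e 3 \<and>\<^sub>p e 5 + e 1 \<and>\<^sub>p e 4 \<and>\<^sub>p e 5 + e 1 \<and>\<^sub>p e 3 \<and>\<^sub>p e 6"

definition su3_structure ::
  "('a, 'i, 'e::euclidean_space) mfd \<Rightarrow> ('i, 'e) form \<Rightarrow> ('i, 'e) form \<Rightarrow> ('i, 'e) form \<Rightarrow> bool" where
  "su3_structure M \<omega> \<psi>p \<psi>m \<longleftrightarrow>
     diff_form M 2 \<omega> \<and> diff_form M 3 \<psi>p \<and> diff_form M 3 \<psi>m \<and>
     (\<forall>i\<in>idx M. \<forall>x\<in>cdom M i. \<exists>W e. open W \<and> x \<in> W \<and> W \<subseteq> cdom M i \<and>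
        (\<forall>k\<in>{1..6}. \<forall>vs. smooth_on W (\<lambda>y. e k y vs)) \<and>
        (\<forall>y\<in>W. adapted (\<lambda>k. e k y) (\<omega> i y) (\<psi>p i y) (\<psi>m i y)))"

text \<open>
  The metric for which adapted bases are orthonormal: \<open>g = \<Sum>\<^sub>k e\<^sup>k \<otimes> e\<^sup>k\<close> for every adapted coframe.
\<close>

definition su3_metric :: "('i, 'e::euclidean_space) form \<Rightarrow> ('i, 'e) form \<Rightarrow> ('i, 'e) form \<Rightarrow> ('i, 'e) metric" where
  "su3_metric \<omega> \<psi>p \<psi>m = (\<lambda>i x. THE g. \<forall>e. adapted e (\<omega> i x) (\<psi>p i x) (\<psi>m i x) \<longrightarrow>
     g = (\<lambda>u v. \<Sum>k=1..6. e k [u] * e k [v]))"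

definition su3_vol :: "('i, 'e) form \<Rightarrow> ('i, 'e) form" where
  "su3_vol \<omega> = (1 / fact 3) *\<^sub>f (\<omega> \<and>\<^sub>f \<omega> \<and>\<^sub>f \<omega>)"

definition su3_star ::
  "('i, 'e::euclidean_space) form \<Rightarrow> ('i, 'e) form \<Rightarrow> ('i, 'e) form \<Rightarrow> ('i, 'e) form \<Rightarrow> ('i, 'e) form" where
  "su3_star \<omega> \<psi>p \<psi>m = hodge (su3_metric \<omega> \<psi>p \<psi>m) (su3_vol \<omega>)"

definition Omega2_8 ::
  "('a, 'i, 'e::euclidean_space) mfd \<Rightarrow> ('i, 'e) form \<Rightarrow> ('i, 'e) form \<Rightarrow> ('i, 'e) form \<Rightarrow> ('i, 'e) form set" where
  "Omega2_8 M \<omega> \<psi>p \<psi>m = {\<sigma>. diff_form M 2 \<sigma> \<and> form_eq M (\<sigma> \<and>\<^sub>f \<psi>p) 0 \<and>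
     form_eq M (su3_star \<omega> \<psi>p \<psi>m \<sigma>) (- (\<sigma> \<and>\<^sub>f \<omega>))}"

definition Omega3_12 ::
  "('a, 'i, 'e::euclidean_space) mfd \<Rightarrow> ('i, 'e) form \<Rightarrow> ('i, 'e) form \<Rightarrow> ('i, 'e) form \<Rightarrow> ('i, 'e) form set" where
  "Omega3_12 M \<omega> \<psi>p \<psi>m = {\<gamma>. diff_form M 3 \<gamma> \<and> form_eq M (\<gamma> \<and>\<^sub>f \<omega>) 0 \<and>
     form_eq M (\<gamma> \<and>\<^sub>f \<psi>p) 0 \<and> form_eq M (\<gamma> \<and>\<^sub>f \<psi>m) 0}"

definition su3_torsion ::
  "('a, 'i, 'e::euclidean_space) mfd \<Rightarrow> ('i, 'e) form \<Rightarrow> ('i, 'e) form \<Rightarrow> ('i, 'e) form \<Rightarrow>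
   ('a \<Rightarrow> real) \<Rightarrow> ('a \<Rightarrow> real) \<Rightarrow> ('i, 'e) form \<Rightarrow> ('i, 'e) form \<Rightarrow>
   ('i, 'e) form \<Rightarrow> ('i, 'e) form \<Rightarrow> ('i, 'e) form \<Rightarrow> bool" where
  "su3_torsion M \<omega> \<psi>p \<psi>m \<sigma>0 \<pi>0 \<pi>1 \<nu>1 \<pi>2 \<sigma>2 \<nu>3 \<longleftrightarrow>
     smooth_fun M \<sigma>0 \<and> smooth_fun M \<pi>0 \<and> diff_form M 1 \<pi>1 \<and> diff_form M 1 \<nu>1 \<and>
     \<pi>2 \<in> Omega2_8 M \<omega> \<psi>p \<psi>m \<and> \<sigma>2 \<in> Omega2_8 M \<omega> \<psi>p \<psi>m \<and> \<nu>3 \<in> Omega3_12 M \<omega> \<psi>p \<psi>m \<and>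
     form_eq M (ext_d \<omega>)
       (- ((3/2) *\<^sub>f (fn M \<sigma>0 \<and>\<^sub>f \<psi>p)) + (3/2) *\<^sub>f (fn M \<pi>0 \<and>\<^sub>f \<psi>m) + \<nu>1 \<and>\<^sub>f \<omega> + \<nu>3) \<and>
     form_eq M (ext_d \<psi>p) (fn M \<pi>0 \<and>\<^sub>f (\<omega> \<and>\<^sub>f \<omega>) + \<pi>1 \<and>\<^sub>f \<psi>p - \<pi>2 \<and>\<^sub>f \<omega>) \<and>
     form_eq M (ext_d \<psi>m) (fn M \<sigma>0 \<and>\<^sub>f (\<omega> \<and>\<^sub>f \<omega>) + \<pi>1 \<and>\<^sub>f \<psi>m - \<sigma>2 \<and>\<^sub>f \<omega>)"

section \<open>Warped \<open>G\<^sub>2\<close>-structures on \<open>M \<times> S\<^sup>1\<close>\<close>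

definition warped_phi ::
  "('a, 'i, 'e::euclidean_space) mfd \<Rightarrow> ('a \<Rightarrow> real) \<Rightarrow> real \<Rightarrow> real \<Rightarrow>
   ('i, 'e) form \<Rightarrow> ('i, 'e) form \<Rightarrow> ('i, 'e) form \<Rightarrow> ('i \<times> real, 'e \<times> real) form" where
  "warped_phi M f \<alpha> \<beta> \<omega> \<psi>p \<psi>m = pr (fn M f \<and>\<^sub>f \<omega>) \<and>\<^sub>f ds + pr (\<alpha> *\<^sub>f \<psi>p - \<beta> *\<^sub>f \<psi>m)"

text \<open>\<open>g + f\<^sup>2 ds\<^sup>2\<close>; the volume form below is the opposite of the product orientation where \<open>f < 0\<close>.\<close>

definition warped_metric ::
  "('a, 'i, 'e) mfd \<Rightarrow> ('a \<Rightarrow> real) \<Rightarrow> ('i, 'e) metric \<Rightarrow> ('i \<times> real, 'e \<times> real) metric" where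
  "warped_metric M f g = (\<lambda>(i, j) (x, t) (u, a) (v, b). g i x u v + (f (par M i x))\<^sup>2 * a * b)"

definition warped_vol ::
  "('a, 'i, 'e) mfd \<Rightarrow> ('a \<Rightarrow> real) \<Rightarrow> ('i, 'e) form \<Rightarrow> ('i \<times> real, 'e \<times> real) form" where
  "warped_vol M f vol = pr (fn M f \<and>\<^sub>f vol) \<and>\<^sub>f ds"

end

(*
  Coclosedness of the warped structure splits into a part without ds and a part with ds. The first
  gives omega /\ d omega = 0, hence nu1 = 0; the second is a relation between 4-forms on M whose
  terms lie in different irreducible SU(3)-components, so that alpha sigma_i + beta pi_i = 0 for
  i = 0, 2 and df = - f pi1. As *phi is closed, its Laplacian is d * d phi (on a 7-manifold ** = 1),
  and these relations turn * d phi into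
    *(pi1 /\ omega) + 3/2 tau0 rho - *nu3 + f (2 tau0 omega + *(pi1 /\ rho) + tau2) /\ ds,
  where tau_i = alpha pi_i - beta sigma_i and rho = alpha psi+ - beta psi-; differentiating gives the
  formula. If f is constant, then pi1 = 0.
*)

theory Submission
  imports Defs
begin

section \<open>Exterior algebra on lists of vectors\<close>

text \<open>The metric, the inner product of forms and the Hodge star are given by descriptions and
  choices, so they must be evaluated before anything can be computed or differentiated. The
  evaluation goes along a frame listed together with its dual coframe: peeling off one pair turns
  wedge product, inner product and star into recursions free of degrees and shuffles. Two facts make
  the values independent of the frame. Multiplication by a covector is adjoint to contraction with
  its metric dual, and the product of omega with the contractions of psi+ by u and w is 2 g(u, w)
  times the volume form. The formula contains derivatives of stars. They exist because a smooth
  adapted coframe has a dual frame that is differentiable, by Cramer's rule. The coefficient 3/2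
  tau0 of rho arises as follows: alpha sigma0 + beta pi0 = 0 and alpha^2 + beta^2 = 1 mean (pi0,
  sigma0) = tau0 (alpha, - beta), so that the psi part of d omega is 3/2 tau0 times the star of
  rho.\<close>

definition contract :: "'e \<Rightarrow> 'e alt \<Rightarrow> 'e alt" where
  "contract v a = (\<lambda>vs. a (v # vs))"

text \<open>The main involution of the exterior algebra: the sign with which a contraction passes
  \<open>a\<close>, written without a degree so that the rules below also hold for forms of mixed
  degree.\<close>

definition grade :: "'e alt \<Rightarrow> 'e alt" where
  "grade a = (\<lambda>vs. (-1) ^ length vs * a vs)"

definition scale :: "real \<Rightarrow> 'e alt \<Rightarrow> 'e alt" (infixr "*\<^sub>p" 75) where
  "c *\<^sub>p a = (\<lambda>vs. c * a vs)"

definition unit_alt :: "'e alt" where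
  "unit_alt = (\<lambda>vs. if vs = [] then 1 else 0)"

definition of_degree :: "nat \<Rightarrow> 'e alt \<Rightarrow> bool" where
  "of_degree k a \<longleftrightarrow> (\<forall>vs. length vs \<noteq> k \<longrightarrow> a vs = 0)"

lemma alt_form_iff: "alt_form k a \<longleftrightarrow> alternating a \<and> of_degree k a"
  by (simp add: alt_form_def of_degree_def)

text \<open>The sum defining the wedge product will be split by whether the head of the argument
  list, position 0, goes to the first factor.\<close>

lemma sum_Pow_lessThan_Suc:
  "(\<Sum>J\<in>Pow {..<Suc n}. F J) =
    (\<Sum>J\<in>Pow {..<n}. F (insert 0 (Suc ` J))) + (\<Sum>J\<in>Pow {..<n}. F (Suc ` J))"
  for F :: "nat set \<Rightarrow> real"
proof -
  have eq: "Pow {..<Suc n} = (\<lambda>J. insert 0 (Suc ` J)) ` Pow {..<n} \<union> image Suc ` Pow {..<n}"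
    unfolding lessThan_Suc_eq_insert_0 Pow_insert image_Pow_surj[OF refl, symmetric] image_image
    by (rule Un_commute)
  have "inj_on (\<lambda>J. insert 0 (Suc ` J)) (Pow {..<n})"
    by (rule inj_onI) (metis Diff_insert_absorb imageE inj_Suc inj_image_eq_iff nat.distinct(1))
  moreover have "inj_on (image Suc) (Pow {..<n})"
    by (simp add: inj_on_image)
  moreover have "(\<lambda>J. insert 0 (Suc ` J)) ` Pow {..<n} \<inter> image Suc ` Pow {..<n} = {}"
    by auto
  ultimately show ?thesis
    unfolding eq by (subst sum.union_disjoint) (auto simp: sum.reindex)
qed

text \<open>Position 0 precedes all others. Inside the chosen set it creates no inversion; outside,
  it forms one inversion with every element of the set.\<close>

lemma shuffle_sign_shift:
  assumes "J \<subseteq> {..<n}"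
  shows "shuffle_sign (Suc n) (insert 0 (Suc ` J)) = shuffle_sign n J"
    and "shuffle_sign (Suc n) (Suc ` J) = (-1) ^ card J * shuffle_sign n J"
proof -
  let ?P = "{(i, j). i \<in> J \<and> j \<in> {..<n} - J \<and> j < i}"
  have fin: "finite J" using assms finite_subset by blast
  have finP: "finite ?P"
    by (rule finite_subset[of _ "J \<times> {..<n}"]) (use fin in auto)
  have 1: "{(i, j). i \<in> insert 0 (Suc ` J) \<and> j \<in> {..<Suc n} - insert 0 (Suc ` J) \<and> j < i}
      = map_prod Suc Suc ` ?P"
  proof (intro equalityI subsetI)
    fix z assume "z \<in> {(i, j). i \<in> insert 0 (Suc ` J) \<and> j \<in> {..<Suc n} - insert 0 (Suc ` J) \<and> j < i}"
    then obtain i j where z: "z = (Suc i, j)" "i \<in> J" "j < Suc n" "j \<noteq> 0" "j \<notin> Suc ` J" "j < Suc i"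
      by auto
    then obtain j' where "j = Suc j'" by (metis not0_implies_Suc)
    with z show "z \<in> map_prod Suc Suc ` ?P" by (auto intro!: image_eqI[of _ _ "(i, j')"])
  qed auto
  show "shuffle_sign (Suc n) (insert 0 (Suc ` J)) = shuffle_sign n J"
    unfolding shuffle_sign_def 1 by (subst card_image) (auto simp: inj_on_def)
  have 2: "{(i, j). i \<in> Suc ` J \<and> j \<in> {..<Suc n} - Suc ` J \<and> j < i}
      = map_prod Suc Suc ` ?P \<union> (\<lambda>i. (Suc i, 0)) ` J"
  proof (intro equalityI subsetI)
    fix z assume "z \<in> {(i, j). i \<in> Suc ` J \<and> j \<in> {..<Suc n} - Suc ` J \<and> j < i}"
    then obtain i j where z: "z = (Suc i, j)" "i \<in> J" "j < Suc n" "j \<notin> Suc ` J" "j < Suc i"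
      by auto
    show "z \<in> map_prod Suc Suc ` ?P \<union> (\<lambda>i. (Suc i, 0)) ` J"
    proof (cases j)
      case (Suc j')
      with z show ?thesis by (auto intro!: image_eqI[of _ _ "(i, j')"])
    qed (use z in auto)
  qed auto
  have "card {(i, j). i \<in> Suc ` J \<and> j \<in> {..<Suc n} - Suc ` J \<and> j < i} = card ?P + card J"
    unfolding 2
    by (subst card_Un_disjoint) (use fin finP in \<open>auto simp: card_image inj_on_def\<close>)
  then show "shuffle_sign (Suc n) (Suc ` J) = (-1) ^ card J * shuffle_sign n J"
    unfolding shuffle_sign_def by (simp add: power_add)
qed

lemma wedge_Nil [simp]: "(a \<and>\<^sub>p b) [] = a [] * b []"
  by (simp add: alt_wedge_def shuffle_sign_def)

text \<open>Contraction is an antiderivation. As it removes the head of the argument list, this is a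
  recursion for the wedge product that makes no reference to shuffles.\<close>

lemma wedge_Cons:
  "(a \<and>\<^sub>p b) (v # vs) = (contract v a \<and>\<^sub>p b) vs + (grade a \<and>\<^sub>p contract v b) vs"
proof -
  have 1: "nths (v # vs) (insert 0 (Suc ` J)) = v # nths vs J"
          "nths (v # vs) (- insert 0 (Suc ` J)) = nths vs (- J)"
          "nths (v # vs) (Suc ` J) = nths vs J"
          "nths (v # vs) (- Suc ` J) = v # nths vs (- J)" for J
    by (auto simp: nths_Cons image_iff intro: arg_cong[of _ _ "nths vs"])
  \<comment> \<open>\<open>a\<close> receives \<open>card J\<close> arguments, so the sign of the
    shifted shuffle is the one contained in \<open>grade a\<close>.\<close>
  have 2: "card J = length (nths vs J)" if "J \<subseteq> {..<length vs}" for J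
    using that unfolding length_nths by (intro arg_cong[of _ _ card]) auto
  show ?thesis
    unfolding alt_wedge_def list.size(4) add_0_right One_nat_def add_Suc_right
      sum_Pow_lessThan_Suc 1
    by (intro arg_cong2[of _ _ _ _ "(+)"] sum.cong refl)
       (auto simp: shuffle_sign_shift contract_def grade_def 2)
qed

lemma contract_wedge:
  "contract v (a \<and>\<^sub>p b) = contract v a \<and>\<^sub>p b + grade a \<and>\<^sub>p contract v b"
  by (rule ext) (simp add: contract_def[of v "a \<and>\<^sub>p b"] wedge_Cons)

lemma contract_linear [simp]:
  "contract v (a + b) = contract v a + contract v b"
  "contract v (a - b) = contract v a - contract v b"
  "contract v (- a) = - contract v a"
  "contract v (c *\<^sub>p a) = c *\<^sub>p contract v a"
  "contract v 0 = 0"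
  by (auto simp: contract_def scale_def)

lemma grade_linear [simp]:
  "grade (a + b) = grade a + grade b"
  "grade (a - b) = grade a - grade b"
  "grade (- a) = - grade a"
  "grade (c *\<^sub>p a) = c *\<^sub>p grade a"
  "grade 0 = 0"
  by (auto simp: grade_def scale_def algebra_simps)

lemma grade_grade [simp]: "grade (grade a) = a"
  by (auto simp: grade_def mult.assoc[symmetric] power_mult_distrib[symmetric])

lemma contract_grade [simp]: "contract v (grade a) = - grade (contract v a)"
  by (auto simp: contract_def grade_def)

lemma contract_unit [simp]: "contract v unit_alt = 0"
  by (auto simp: contract_def unit_alt_def)

lemma grade_unit [simp]: "grade unit_alt = unit_alt"
  by (auto simp: grade_def unit_alt_def)

lemma wedge_add_left: "(a + b) \<and>\<^sub>p c = a \<and>\<^sub>p c + b \<and>\<^sub>p c"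
  by (auto simp: alt_wedge_def algebra_simps sum.distrib)

lemma wedge_add_right: "a \<and>\<^sub>p (b + c) = a \<and>\<^sub>p b + a \<and>\<^sub>p c"
  by (auto simp: alt_wedge_def algebra_simps sum.distrib)

lemma wedge_scale_left: "(k *\<^sub>p a) \<and>\<^sub>p c = k *\<^sub>p (a \<and>\<^sub>p c)"
  by (auto simp: alt_wedge_def scale_def sum_distrib_left mult_ac)

lemma wedge_scale_right: "a \<and>\<^sub>p (k *\<^sub>p c) = k *\<^sub>p (a \<and>\<^sub>p c)"
  by (auto simp: alt_wedge_def scale_def sum_distrib_left mult_ac)

lemma wedge_zero [simp]: "0 \<and>\<^sub>p a = 0" "a \<and>\<^sub>p 0 = 0"
  by (auto simp: alt_wedge_def)

lemma wedge_minus_left: "(- a) \<and>\<^sub>p c = - (a \<and>\<^sub>p c)"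
  by (auto simp: alt_wedge_def sum_negf)

lemma wedge_minus_right: "a \<and>\<^sub>p (- c) = - (a \<and>\<^sub>p c)"
  by (auto simp: alt_wedge_def sum_negf)

lemma wedge_diff_left: "(a - b) \<and>\<^sub>p c = a \<and>\<^sub>p c - b \<and>\<^sub>p c"
  by (simp only: diff_conv_add_uminus wedge_add_left wedge_minus_left)

lemma wedge_diff_right: "a \<and>\<^sub>p (b - c) = a \<and>\<^sub>p b - a \<and>\<^sub>p c"
  by (simp only: diff_conv_add_uminus wedge_add_right wedge_minus_right)

lemmas wedge_linear = wedge_add_left wedge_add_right wedge_scale_left wedge_scale_right
  wedge_minus_left wedge_minus_right wedge_diff_left wedge_diff_right

lemma scale_simps [simp]:
  "1 *\<^sub>p a = a" "0 *\<^sub>p a = 0" "c *\<^sub>p 0 = 0" "c *\<^sub>p d *\<^sub>p a = (c * d) *\<^sub>p a"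
  "c *\<^sub>p (- a) = - (c *\<^sub>p a)" "(- c) *\<^sub>p a = - (c *\<^sub>p a)"
  by (auto simp: scale_def)

lemma scale_distrib:
  "c *\<^sub>p (a + b) = c *\<^sub>p a + c *\<^sub>p b" "c *\<^sub>p (a - b) = c *\<^sub>p a - c *\<^sub>p b"
  "(c + d) *\<^sub>p a = c *\<^sub>p a + d *\<^sub>p a" "(c - d) *\<^sub>p a = c *\<^sub>p a - d *\<^sub>p a"
  by (auto simp: scale_def algebra_simps)

lemma grade_wedge [simp]: "grade (a \<and>\<^sub>p b) = grade a \<and>\<^sub>p grade b"
proof
  fix vs show "grade (a \<and>\<^sub>p b) vs = (grade a \<and>\<^sub>p grade b) vs"
  proof (induction vs arbitrary: a b)
    case Nil
    show ?case by (simp add: grade_def)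
  next
    case (Cons v vs)
    have "grade (a \<and>\<^sub>p b) (v # vs) = - grade (contract v (a \<and>\<^sub>p b)) vs"
      by (simp add: grade_def contract_def)
    also have "\<dots> = (grade a \<and>\<^sub>p grade b) (v # vs)"
      by (simp add: contract_wedge Cons wedge_Cons wedge_minus_left wedge_minus_right)
    finally show ?case .
  qed
qed

text \<open>Contraction is an antiderivation for both bracketings, so they obey the same recursion
  in the argument list and agree on the empty list. No shuffles are composed.\<close>

lemma wedge_assoc: "(a \<and>\<^sub>p b) \<and>\<^sub>p c = a \<and>\<^sub>p (b \<and>\<^sub>p c)"
proof
  fix vs show "((a \<and>\<^sub>p b) \<and>\<^sub>p c) vs = (a \<and>\<^sub>p (b \<and>\<^sub>p c)) vs"
    by (induction vs arbitrary: a b c)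
       (simp_all add: wedge_Cons contract_wedge wedge_linear)
qed

lemma wedge_unit [simp]: "unit_alt \<and>\<^sub>p a = a" "a \<and>\<^sub>p unit_alt = a"
proof -
  have "(unit_alt \<and>\<^sub>p a) vs = a vs" for vs
    by (induction vs arbitrary: a) (simp_all add: wedge_Cons, simp_all add: contract_def unit_alt_def)
  then show "unit_alt \<and>\<^sub>p a = a" by blast
  have "(a \<and>\<^sub>p unit_alt) vs = a vs" for vs
    by (induction vs arbitrary: a) (simp_all add: wedge_Cons, simp_all add: contract_def unit_alt_def)
  then show "a \<and>\<^sub>p unit_alt = a" by blast
qed

section \<open>Homogeneous forms and graded commutativity\<close>

lemma of_degree_contract: "of_degree (Suc k) a \<Longrightarrow> of_degree k (contract v a)"
  by (simp add: of_degree_def contract_def)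

lemma contract_of_degree_0: "of_degree 0 a \<Longrightarrow> contract v a = 0"
  by (auto simp: of_degree_def contract_def)

lemma grade_of_degree: "of_degree k a \<Longrightarrow> grade a = (-1) ^ k *\<^sub>p a"
  by (rule ext) (auto simp: of_degree_def grade_def scale_def)

lemma contract_of_degree_1: "of_degree 1 a \<Longrightarrow> contract v a = a [v] *\<^sub>p unit_alt"
  by (rule ext) (auto simp: of_degree_def contract_def scale_def unit_alt_def)

lemma of_degree_linear:
  "of_degree k a \<Longrightarrow> of_degree k b \<Longrightarrow> of_degree k (a + b)"
  "of_degree k a \<Longrightarrow> of_degree k b \<Longrightarrow> of_degree k (a - b)"
  "of_degree k a \<Longrightarrow> of_degree k (- a)"
  "of_degree k a \<Longrightarrow> of_degree k (c *\<^sub>p a)"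
  "of_degree k a \<Longrightarrow> of_degree k (grade a)"
  "of_degree k 0"
  "of_degree 0 unit_alt"
  by (auto simp: of_degree_def scale_def grade_def unit_alt_def)

lemma of_degree_wedge:
  assumes "of_degree k a" "of_degree l b"
  shows "of_degree (k + l) (a \<and>\<^sub>p b)"
  unfolding of_degree_def
proof (intro allI impI)
  fix vs :: "'a list"
  assume "length vs \<noteq> k + l"
  then show "(a \<and>\<^sub>p b) vs = 0"
    using assms
  proof (induction vs arbitrary: a b k l)
    case Nil
    then show ?case by (auto simp: of_degree_def)
  next
    case (Cons v vs)
    have "(contract v a \<and>\<^sub>p b) vs = 0"
    proof (cases k)
      case 0
      then show ?thesis using Cons.prems contract_of_degree_0 by fastforce
    next
      case (Suc k')
      then show ?thesis using Cons of_degree_contract by fastforce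
    qed
    moreover have "(grade a \<and>\<^sub>p contract v b) vs = 0"
    proof (cases l)
      case 0
      then show ?thesis using Cons.prems contract_of_degree_0[of b v] by simp
    next
      case (Suc l')
      then show ?thesis
        using Cons.IH[of k l' "grade a" "contract v b"] Cons.prems of_degree_contract[of l' b v]
        by (simp add: of_degree_linear)
    qed
    ultimately show ?case by (simp add: wedge_Cons)
  qed
qed

lemma wedge_commute:
  assumes "of_degree k a" "of_degree l b"
  shows "a \<and>\<^sub>p b = (-1) ^ (k * l) *\<^sub>p (b \<and>\<^sub>p a)"
proof
  fix vs show "(a \<and>\<^sub>p b) vs = ((-1) ^ (k * l) *\<^sub>p (b \<and>\<^sub>p a)) vs"
    using assms
  proof (induction vs arbitrary: a b k l)
    case Nil
    then show ?case by (cases "k = 0") (simp_all add: of_degree_def scale_def)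
  next
    case (Cons v vs)
    have 1: "(contract v a \<and>\<^sub>p b) vs = (-1) ^ (k * l + l) * (b \<and>\<^sub>p contract v a) vs"
    proof (cases k)
      case 0
      then show ?thesis using Cons.prems contract_of_degree_0[of a v] by simp
    next
      case (Suc k')
      \<comment> \<open>The two exponents differ by \<open>2 * l\<close>.\<close>
      have "even (k' * l) = even (Suc k' * l + l)" by (cases "even l"; cases "even k'"; simp)
      then have "(-1 :: real) ^ (k' * l) = (-1) ^ (Suc k' * l + l)"
        by (metis neg_one_even_power neg_one_odd_power)
      moreover have "(contract v a \<and>\<^sub>p b) vs = ((-1) ^ (k' * l) *\<^sub>p (b \<and>\<^sub>p contract v a)) vs"
        using Cons.prems Suc by (intro Cons.IH of_degree_contract) simp_all
      ultimately show ?thesis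
        using Suc by (simp only: scale_def)
    qed
    have 2: "(grade a \<and>\<^sub>p contract v b) vs = (-1) ^ (k * l) * (contract v b \<and>\<^sub>p a) vs"
    proof (cases l)
      case 0
      then show ?thesis using Cons.prems contract_of_degree_0[of b v] by simp
    next
      case (Suc l')
      have "(a \<and>\<^sub>p contract v b) vs = ((-1) ^ (k * l') *\<^sub>p (contract v b \<and>\<^sub>p a)) vs"
        using Cons.prems Suc by (intro Cons.IH of_degree_contract) simp_all
      moreover have "(grade a \<and>\<^sub>p contract v b) vs = (-1) ^ k * (a \<and>\<^sub>p contract v b) vs"
        by (simp only: grade_of_degree[OF Cons.prems(1)] wedge_scale_left) (simp add: scale_def)
      ultimately show ?thesis
        using Suc by (simp add: scale_def power_add)
    qed
    have 3: "(grade b \<and>\<^sub>p contract v a) vs = (-1) ^ l * (b \<and>\<^sub>p contract v a) vs"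
      by (simp only: grade_of_degree[OF Cons.prems(2)] wedge_scale_left) (simp add: scale_def)
    show ?case
      by (simp add: wedge_Cons 1 2 3 scale_def algebra_simps power_add)
  qed
qed

section \<open>Alternating functions on lists of vectors\<close>

lemma alternating_simps:
  assumes "alternating a"
  shows "a (us @ (x + y) # vs) = a (us @ x # vs) + a (us @ y # vs)"
    and "a (us @ (c *\<^sub>R x) # vs) = c * a (us @ x # vs)"
    and "a (us @ x # vs @ x # ws) = 0"
    and "a (us @ 0 # vs) = 0"
proof -
  have lin: "linear (\<lambda>v. a (us @ v # vs))" using assms by (simp add: alternating_def)
  show "a (us @ (x + y) # vs) = a (us @ x # vs) + a (us @ y # vs)"
    and "a (us @ (c *\<^sub>R x) # vs) = c * a (us @ x # vs)" and "a (us @ 0 # vs) = 0"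
    using linear_add[OF lin] linear_cmul[OF lin] linear_0[OF lin] by simp_all
  show "a (us @ x # vs @ x # ws) = 0" using assms by (simp add: alternating_def)
qed

lemma alternating_swap:
  assumes "alternating a"
  shows "a (us @ y # x # vs) = - a (us @ x # y # vs)"
proof -
  have "0 = a (us @ (x + y) # (x + y) # vs)"
    using alternating_simps(3)[OF assms, of us _ "[]"] by simp
  also have "\<dots> = a (us @ x # (x + y) # vs) + a (us @ y # (x + y) # vs)"
    by (rule alternating_simps(1)[OF assms])
  also have "\<dots> = a (us @ x # y # vs) + a (us @ y # x # vs)"
    using alternating_simps(1)[OF assms, of "us @ [_]"] alternating_simps(3)[OF assms, of us _ "[]"]
    by simp
  finally show ?thesis by simp
qed

lemma alternating_move_front:
  assumes "alternating a"
  shows "a (us @ vs @ x # ws) = (-1) ^ length vs * a (us @ x # vs @ ws)"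
proof (induction vs arbitrary: us)
  case (Cons v vs)
  have "a (us @ (v # vs) @ x # ws) = a ((us @ [v]) @ vs @ x # ws)" by simp
  also have "\<dots> = (-1) ^ length vs * a (us @ v # x # vs @ ws)" by (subst Cons) simp
  also have "a (us @ v # x # vs @ ws) = - a (us @ x # v # vs @ ws)"
    by (rule alternating_swap[OF assms])
  finally show ?case by simp
qed simp

text \<open>Polarising the adjacent case gives antisymmetry under swaps of neighbours, which bring
  two equal vectors together. For the wedge product the adjacent case is the one that its recursion
  at the head of the list can reach.\<close>

lemma alternatingI_adjacent:
  assumes lin: "\<And>us vs. linear (\<lambda>v. a (us @ v # vs))"
    and adj: "\<And>us v ws. a (us @ v # v # ws) = 0"
  shows "alternating a"
  unfolding alternating_def
proof (intro conjI allI)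
  have swap: "a (us @ y # x # vs) = - a (us @ x # y # vs)" for us x y vs
  proof -
    have "0 = a (us @ (x + y) # (x + y) # vs)" using adj by simp
    also have "\<dots> = a (us @ x # (x + y) # vs) + a (us @ y # (x + y) # vs)"
      by (rule linear_add[OF lin])
    also have "\<dots> = a (us @ x # y # vs) + a (us @ y # x # vs)"
      using linear_add[OF lin, of "us @ [_]"] adj by simp
    finally show ?thesis by simp
  qed
  show "a (us @ v # vs @ v # ws) = 0" for us vs ws v
  proof (induction vs arbitrary: us)
    case (Cons x vs)
    have "a (us @ v # (x # vs) @ v # ws) = - a ((us @ [x]) @ v # vs @ v # ws)"
      using swap[of us v x] by simp
    then show ?case by (simp only: Cons)
  qed (simp add: adj)
qed (rule lin)

lemma alternating_contract: "alternating a \<Longrightarrow> alternating (contract v a)"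
  unfolding alternating_def contract_def append_Cons[symmetric] by blast

lemma contract_contract: "alternating a \<Longrightarrow> contract v (contract v a) = 0"
  using alternating_simps(3)[of a "[]" v "[]"] by (auto simp: contract_def)

lemma contract_swap: "alternating a \<Longrightarrow> contract u (contract v a) = - contract v (contract u a)"
  using alternating_swap[of a "[]" v u] by (auto simp: contract_def)

lemma contract_add_scale:
  assumes "alternating a"
  shows "contract (x + y) a = contract x a + contract y a"
    and "contract (c *\<^sub>R x) a = c *\<^sub>p contract x a" and "contract 0 a = 0"
  using alternating_simps(1,2,4)[OF assms, of "[]"] by (auto simp: contract_def scale_def)

lemma alternating_linear_space:
  "alternating a \<Longrightarrow> alternating b \<Longrightarrow> alternating (a + b)"
  "alternating a \<Longrightarrow> alternating b \<Longrightarrow> alternating (a - b)"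
  "alternating a \<Longrightarrow> alternating (- a)"
  "alternating a \<Longrightarrow> alternating (c *\<^sub>p a)"
  "alternating a \<Longrightarrow> alternating (grade a)"
proof -
  have *: "linear (\<lambda>v. c * f v)" if "linear f" for c and f :: "'a \<Rightarrow> real"
    using linear_compose_scale_right[OF that, of c] by simp
  show "alternating a \<Longrightarrow> alternating b \<Longrightarrow> alternating (a + b)"
    "alternating a \<Longrightarrow> alternating b \<Longrightarrow> alternating (a - b)"
    "alternating a \<Longrightarrow> alternating (- a)"
    "alternating a \<Longrightarrow> alternating (c *\<^sub>p a)"
    "alternating a \<Longrightarrow> alternating (grade a)"
    unfolding alternating_def scale_def grade_def
    by (simp_all add: linear_compose_add linear_compose_sub linear_compose_neg *)
qed

lemma alternating_const [simp]: "alternating 0" "alternating unit_alt"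
  by (auto simp: alternating_def unit_alt_def zero_fun_def linearI)

lemma linear_wedge:
  assumes "alternating a" "alternating b"
  shows "linear (\<lambda>v. (a \<and>\<^sub>p b) (us @ v # vs))"
  using assms
proof (induction us arbitrary: a b)
  case Nil
  have "linear (\<lambda>v. (contract v a \<and>\<^sub>p c) vs)" "linear (\<lambda>v. (c \<and>\<^sub>p contract v b) vs)" for c
    using Nil by (auto intro!: linearI simp: contract_add_scale wedge_linear, auto simp: scale_def)
  then show ?case by (simp add: wedge_Cons linear_compose_add)
next
  case (Cons u us)
  then show ?case
    by (simp add: wedge_Cons alternating_contract alternating_linear_space linear_compose_add)
qed

text \<open>Contracting \<open>a \<and>\<^sub>p b\<close> twice with the same \<open>v\<close>
  leaves two mixed terms, which cancel because \<open>contract v\<close> and \<open>grade\<close>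
  anticommute. Vectors in front of the repeated pair are absorbed by contractions.\<close>

lemma alternating_wedge:
  assumes "alternating a" "alternating b"
  shows "alternating (a \<and>\<^sub>p b)"
proof (rule alternatingI_adjacent)
  show "(a \<and>\<^sub>p b) (us @ v # v # ws) = 0" for us v ws
    using assms
  proof (induction us arbitrary: a b)
    case Nil
    then show ?case
      by (simp add: wedge_Cons contract_contract wedge_linear)
  next
    case (Cons u us)
    then show ?case by (simp add: wedge_Cons alternating_contract alternating_linear_space)
  qed
qed (rule linear_wedge[OF assms])

lemma alt_form_wedge:
  "alt_form k a \<Longrightarrow> alt_form l b \<Longrightarrow> alt_form (k + l) (a \<and>\<^sub>p b)"
  by (simp add: alt_form_iff alternating_wedge of_degree_wedge)

section \<open>Dual bases and the Hodge star\<close>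

lemma contract_covector_wedge:
  assumes "of_degree 1 e"
  shows "contract v (e \<and>\<^sub>p a) = e [v] *\<^sub>p a - e \<and>\<^sub>p contract v a"
  using assms by (simp add: contract_wedge contract_of_degree_1 grade_of_degree wedge_linear)

text \<open>Contraction with a vector in the kernel of \<open>e\<close> acts only on the other
  factors, so \<open>e\<close> survives until the argument list is empty, where it gives 0. This
  discards the summands of the recursions along a frame that carry the wrong covector.\<close>

lemma wedge_annihilator:
  assumes "of_degree 1 e" "\<forall>w\<in>set vs. e [w] = 0"
  shows "(a \<and>\<^sub>p (e \<and>\<^sub>p b)) vs = 0"
  using assms(2)
proof (induction vs arbitrary: a b)
  case Nil
  then show ?case using assms(1) by (simp add: of_degree_def)
next
  case (Cons v vs)
  then show ?case
    by (simp add: wedge_Cons contract_covector_wedge[OF assms(1)] wedge_diff_right wedge_minus_right)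
qed

lemma wedge_annihilator':
  assumes "of_degree 1 e" "\<forall>w\<in>set vs. e [w] = 0"
  shows "(e \<and>\<^sub>p b) vs = 0"
  using wedge_annihilator[OF assms, of unit_alt] by simp

text \<open>A frame is kept as a list with its dual covectors and need not span: the tail of such a
  list is again one, as recursion along a frame requires. The order of the list carries the
  orientation.\<close>

definition dual_pairs :: "('e::real_vector \<times> 'e alt) list \<Rightarrow> bool" where
  "dual_pairs ps \<longleftrightarrow> (\<forall>i<length ps. alt_form 1 (snd (ps ! i))) \<and>
     (\<forall>i<length ps. \<forall>j<length ps. snd (ps ! i) [fst (ps ! j)] = (if i = j then 1 else 0))"

lemma dual_pairs_Nil [simp]: "dual_pairs []"
  by (simp add: dual_pairs_def)

lemma dual_pairs_Cons:
  "dual_pairs ((v, e) # ps) \<longleftrightarrow> alt_form 1 e \<and> e [v] = 1 \<and>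
     (\<forall>w\<in>set (map fst ps). e [w] = 0) \<and> (\<forall>f\<in>set (map snd ps). f [v] = 0) \<and> dual_pairs ps"
  unfolding dual_pairs_def by (auto simp: All_less_Suc2 all_set_conv_all_nth)

lemma dual_pairs_alt_form: "dual_pairs ps \<Longrightarrow> e \<in> set (map snd ps) \<Longrightarrow> alt_form 1 e"
  unfolding dual_pairs_def by (fastforce simp: in_set_conv_nth)

lemma dual_pairs_Cons_iff:
  assumes "dual_pairs ((v, e) # ps)"
  shows "alternating e" "of_degree 1 e" "e [v] = 1" "\<forall>w\<in>set (map fst ps). e [w] = 0"
    "\<forall>f\<in>set (map snd ps). of_degree 1 f \<and> alternating f \<and> f [v] = 0" "dual_pairs ps"
  using assms dual_pairs_alt_form[of ps] by (auto simp: dual_pairs_Cons alt_form_iff)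

lemma covector_linear: "alt_form 1 e \<Longrightarrow> linear (\<lambda>v. e [v])"
  using alternating_simps(1,2)[of e "[]"] by (intro linearI) (auto simp: alt_form_def)

text \<open>The covector paired with the head kills the span of the tail, but not the head.\<close>

lemma dual_pairs_independent:
  assumes "dual_pairs ps"
  shows "independent (set (map fst ps)) \<and> distinct (map fst ps)"
  using assms
proof (induction ps)
  case (Cons p ps)
  obtain v e where p: "p = (v, e)" by (cases p)
  note D = dual_pairs_Cons_iff[OF Cons.prems[unfolded p]]
  have "linear (\<lambda>v. e [v])" using D by (auto simp: alt_form_iff intro: covector_linear)
  then have "x \<in> span (set (map fst ps)) \<Longrightarrow> e [x] = 0" for x
    using linear_eq_0_on_span[of "\<lambda>v. e [v]"] D(4) by blast
  then have "v \<notin> span (set (map fst ps))" using D(3) by force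
  moreover from this have "v \<notin> set (map fst ps)" using span_base by blast
  ultimately show ?case using Cons.IH D(6) by (simp add: p independent_insert)
qed (simp add: independent_empty)

lemma dual_pairs_span:
  fixes ps :: "('e::euclidean_space \<times> 'e alt) list"
  assumes "dual_pairs ps" "length ps = DIM('e)"
  shows "span (set (map fst ps)) = UNIV"
proof -
  have "card (set (map fst ps)) = DIM('e)"
    using dual_pairs_independent[OF assms(1)] distinct_card assms(2) by fastforce
  then show ?thesis
    using card_ge_dim_independent[of "set (map fst ps)" UNIV] dual_pairs_independent[OF assms(1)]
    by (auto simp: dim_UNIV)
qed

section \<open>Alternating functions are determined by their values on a frame\<close>

lemma in_subseqs_Cons: "(\<forall>xs\<in>set (subseqs (v # b)). P xs) \<longleftrightarrow>
    (\<forall>xs\<in>set (subseqs b). P (v # xs)) \<and> (\<forall>xs\<in>set (subseqs b). P xs)"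
  by (auto simp: Let_def)

lemma set_subseqs_subset: "xs \<in> set (subseqs b) \<Longrightarrow> set xs \<subseteq> set b"
  by (induction b arbitrary: xs) (auto simp: Let_def, blast+)

lemma length_subseqs_le: "xs \<in> set (subseqs b) \<Longrightarrow> length xs \<le> length b"
  by (induction b arbitrary: xs) (auto simp: Let_def le_SucI)

lemma length_subseqs_eq: "xs \<in> set (subseqs b) \<Longrightarrow> length xs = length b \<Longrightarrow> xs = b"
  by (induction b arbitrary: xs) (auto simp: Let_def dest: length_subseqs_le)

text \<open>Each argument is split into a multiple of the head \<open>v\<close> and a vector in the
  span of the tail. Terms without \<open>v\<close> are covered by induction. A \<open>v\<close> that
  occurs is moved to the front, and the induction hypothesis is applied to
  \<open>contract v a\<close>, where any further \<open>v\<close> gives 0.\<close>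

lemma alternating_vanish:
  assumes "alternating a" "\<forall>xs\<in>set (subseqs b). a xs = 0" "set vs \<subseteq> span (set b)"
  shows "a vs = 0"
  using assms
proof (induction b arbitrary: a vs)
  case Nil
  show ?case
  proof (cases vs)
    case (Cons x xs)
    then show ?thesis using Nil alternating_simps(4)[of a "[]"] by simp
  qed (use Nil in simp)
next
  case (Cons v b)
  have comp: "\<exists>k y. x = k *\<^sub>R v + y \<and> y \<in> span (set b)" if x: "x \<in> span (set (v # b))" for x
  proof -
    obtain k where "x - k *\<^sub>R v \<in> span (set b)" using x span_breakdown_eq[of x v "set b"] by auto
    then show ?thesis by (intro exI[of _ k] exI[of _ "x - k *\<^sub>R v"]) simp
  qed
  \<comment> \<open>The expansion runs from left to right: the arguments in \<open>ys\<close> have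
    already lost their component along \<open>v\<close>, those in \<open>ws\<close> not yet.\<close>
  have step: "c (ys @ ws) = 0"
    if "alternating c" "\<And>us. set us \<subseteq> span (set b) \<Longrightarrow> c us = 0"
      and "\<And>us ws. set us \<subseteq> span (set b) \<Longrightarrow> set ws \<subseteq> span (set (v # b)) \<Longrightarrow> c (us @ v # ws) = 0"
      and "set ys \<subseteq> span (set b)" "set ws \<subseteq> span (set (v # b))" for c ys ws
    using that(4,5)
  proof (induction ws arbitrary: ys)
    case Nil
    then show ?case using that(2) by simp
  next
    case (Cons x xs)
    have "x \<in> span (set (v # b))" using Cons.prems(2) by auto
    then obtain k y where x: "x = k *\<^sub>R v + y" "y \<in> span (set b)" using comp by blast
    have "c (ys @ x # xs) = k * c (ys @ v # xs) + c ((ys @ [y]) @ xs)"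
      by (simp add: x alternating_simps[OF that(1)])
    also have "c (ys @ v # xs) = 0" using that(3) Cons.prems by simp
    also have "c ((ys @ [y]) @ xs) = 0" using Cons x(2) by (intro Cons.IH) auto
    finally have "c (ys @ x # xs) = k * 0 + 0" .
    then show ?case by simp
  qed
  let ?a = "contract v a"
  note alt = alternating_contract[OF Cons.prems(1), of v]
  have front: "?a (us @ ws) = 0"
    if "set us \<subseteq> span (set b)" "set ws \<subseteq> span (set (v # b))" for us ws
  proof (rule step[OF alt _ _ that])
    show "?a us = 0" if "set us \<subseteq> span (set b)" for us
      using Cons.IH[OF alt _ that] Cons.prems(2) by (simp only: in_subseqs_Cons) (simp add: contract_def)
    show "?a (us @ v # ws) = 0" for us ws
      using alternating_simps(3)[OF Cons.prems(1), of "[]"] by (simp add: contract_def)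
  qed
  have "a ([] @ vs) = 0"
  proof (rule step[OF Cons.prems(1)])
    show "a us = 0" if "set us \<subseteq> span (set b)" for us
      using Cons.IH[OF Cons.prems(1) _ that] Cons.prems(2) unfolding in_subseqs_Cons by blast
    show "a (us @ v # ws) = 0"
      if "set us \<subseteq> span (set b)" "set ws \<subseteq> span (set (v # b))" for us ws
      using front[OF that] alternating_move_front[OF Cons.prems(1), of "[]" us v ws]
      by (simp add: contract_def)
  qed (use Cons.prems in auto)
  then show ?case by simp
qed

lemma alternating_eqI:
  fixes ps :: "('e::euclidean_space \<times> 'e alt) list"
  assumes "dual_pairs ps" "length ps = DIM('e)" "alternating a" "alternating b"
    and "\<And>xs. xs \<in> set (subseqs (map fst ps)) \<Longrightarrow> a xs = b xs"
  shows "a = b"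
proof
  fix vs
  have "(a - b) vs = 0"
    by (rule alternating_vanish[of "a - b" "map fst ps"])
       (use assms dual_pairs_span[OF assms(1,2)] in \<open>auto simp: alternating_linear_space\<close>)
  then show "a vs = b vs" by simp
qed

lemma top_degree_eqI:
  fixes ps :: "('e::euclidean_space \<times> 'e alt) list"
  assumes "dual_pairs ps" "length ps = DIM('e)" "alternating a" "alternating b"
    and "a (map fst ps) = b (map fst ps)" "length vs = DIM('e)"
  shows "a vs = b vs"
proof -
  \<comment> \<open>\<open>a\<close> and \<open>b\<close> may have components of lower degree. Once
    these are cut off, the only sublist of the frame that counts is the frame itself.\<close>
  define d where "d = (\<lambda>vs. if length vs = DIM('e) then a vs - b vs else 0)"
  have "alternating (a - b)" using assms alternating_linear_space by blast
  then have "alternating d"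
    unfolding d_def alternating_def by (auto simp: linear_iff)
  moreover have "d xs = 0" if "xs \<in> set (subseqs (map fst ps))" for xs
    using length_subseqs_eq[OF that] assms by (auto simp: d_def)
  ultimately have "d vs = 0"
    using alternating_vanish[of d "map fst ps" vs] dual_pairs_span[OF assms(1,2)] by auto
  then show ?thesis using assms(6) by (simp add: d_def)
qed

text \<open>The sum of a(v_J) e^J over all subsets J of the frame, organised by whether the pair at
  the head takes part.\<close>

fun expand_along :: "('e \<times> 'e alt) list \<Rightarrow> 'e alt \<Rightarrow> 'e alt" where
  "expand_along [] a = a [] *\<^sub>p unit_alt"
| "expand_along ((v, e) # ps) a = expand_along ps a + e \<and>\<^sub>p expand_along ps (contract v a)"

fun star_along :: "('e \<times> 'e alt) list \<Rightarrow> 'e alt \<Rightarrow> 'e alt" where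
  "star_along [] a = a [] *\<^sub>p unit_alt"
| "star_along ((v, e) # ps) a = star_along ps (contract v a) + e \<and>\<^sub>p star_along ps (grade a)"

fun inner_along :: "'e list \<Rightarrow> 'e alt \<Rightarrow> 'e alt \<Rightarrow> real" where
  "inner_along [] a c = a [] * c []"
| "inner_along (v # b) a c = inner_along b a c + inner_along b (contract v a) (contract v c)"

lemma along_Cons [simp]:
  "expand_along ((v, e) # ps) a = expand_along ps a + e \<and>\<^sub>p expand_along ps (contract v a)"
  "star_along ((v, e) # ps) a = star_along ps (contract v a) + e \<and>\<^sub>p star_along ps (grade a)"
  by (simp_all add: fun_eq_iff)

declare expand_along.simps(2) [simp del] star_along.simps(2) [simp del]

lemma alternating_expand_along:
  "\<forall>e\<in>set (map snd ps). alternating e \<Longrightarrow> alternating (expand_along ps a)"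
  by (induction ps a rule: expand_along.induct)
     (simp_all add: alternating_linear_space alternating_wedge)

lemma alternating_star_along:
  "\<forall>e\<in>set (map snd ps). alternating e \<Longrightarrow> alternating (star_along ps a)"
  by (induction ps a rule: star_along.induct)
     (simp_all add: alternating_linear_space alternating_wedge)

lemma contract_expand_along:
  "\<forall>e\<in>set (map snd ps). of_degree 1 e \<and> e [v] = 0 \<Longrightarrow> contract v (expand_along ps a) = 0"
  by (induction ps a rule: expand_along.induct) (auto simp: contract_covector_wedge)

lemma contract_star_along:
  "\<forall>e\<in>set (map snd ps). of_degree 1 e \<and> e [v] = 0 \<Longrightarrow> contract v (star_along ps a) = 0"
  by (induction ps a rule: star_along.induct) (auto simp: contract_covector_wedge)

lemma expand_along_subseqs:
  assumes "dual_pairs ps" "xs \<in> set (subseqs (map fst ps))"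
  shows "expand_along ps a xs = a xs"
  using assms
proof (induction ps a arbitrary: xs rule: expand_along.induct)
  case (1 a)
  then show ?case by (simp add: scale_def unit_alt_def)
next
  case (2 v e ps a)
  note D = dual_pairs_Cons_iff[OF "2.prems"(1)]
  have "xs \<in> set (subseqs (map fst ps)) \<or> (\<exists>ys\<in>set (subseqs (map fst ps)). xs = v # ys)"
    using "2.prems"(2) by (auto simp: Let_def)
  then show ?case
  proof
    assume xs: "xs \<in> set (subseqs (map fst ps))"
    then have "(e \<and>\<^sub>p expand_along ps (contract v a)) xs = 0"
      using wedge_annihilator'[OF D(2)] D(4) set_subseqs_subset by blast
    then show ?thesis using "2.IH"(1)[OF D(6) xs] by simp
  next
    assume "\<exists>ys\<in>set (subseqs (map fst ps)). xs = v # ys"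
    then obtain ys where ys: "ys \<in> set (subseqs (map fst ps))" "xs = v # ys" by blast
    have "expand_along ((v, e) # ps) a xs = contract v (expand_along ((v, e) # ps) a) ys"
      by (simp only: ys(2) contract_def)
    also have "\<dots> = expand_along ps (contract v a) ys"
      using D by (simp add: contract_covector_wedge contract_expand_along)
    also have "\<dots> = a xs" using "2.IH"(2)[OF D(6) ys(1)] by (simp add: ys(2) contract_def)
    finally show ?thesis .
  qed
qed

lemma expand_along_eq:
  fixes ps :: "('e::euclidean_space \<times> 'e alt) list"
  assumes "dual_pairs ps" "length ps = DIM('e)" "alternating a"
  shows "expand_along ps a = a"
  using assms dual_pairs_alt_form[OF assms(1)]
  by (intro alternating_eqI[OF assms(1,2)])
     (auto simp: expand_along_subseqs alt_form_iff intro!: alternating_expand_along)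

lemma expand_along_minus: "expand_along ps (- a) = - expand_along ps a"
proof -
  have "expand_along ps (c *\<^sub>p a) = c *\<^sub>p expand_along ps a" for c
    by (induction ps arbitrary: a) (auto simp: scale_distrib wedge_linear, simp add: scale_def)
  moreover have "- x = (-1) *\<^sub>p x" for x :: "'a alt" by (simp add: scale_def fun_eq_iff)
  ultimately show ?thesis by metis
qed

lemma star_along_linear:
  "star_along ps (a + b) = star_along ps a + star_along ps b"
  "star_along ps (c *\<^sub>p a) = c *\<^sub>p star_along ps a"
  "star_along ps (- a) = - star_along ps a"
  "star_along ps (a - b) = star_along ps a - star_along ps b"
  "star_along ps 0 = 0"
proof -
  show 1: "star_along ps (a + b) = star_along ps a + star_along ps b" for a b
    by (induction ps arbitrary: a b) (auto simp: scale_distrib wedge_linear)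
  show 2: "star_along ps (c *\<^sub>p a) = c *\<^sub>p star_along ps a" for c a
    by (induction ps arbitrary: a) (auto simp: scale_distrib wedge_linear, simp add: scale_def)
  show 3: "star_along ps (- a) = - star_along ps a" for a
  proof -
    have "- x = (-1) *\<^sub>p x" for x :: "'a alt" by (simp add: scale_def fun_eq_iff)
    then show ?thesis using 2 by metis
  qed
  show "star_along ps (a - b) = star_along ps a - star_along ps b"
    using 1[of a "- b"] by (simp add: 3)
  show "star_along ps 0 = 0"
    using 2[of 0 0] by simp
qed

text \<open>The recursion evaluates \<open>a\<close> only on sublists of the frame.\<close>

lemma star_along_cong:
  assumes "\<And>xs. xs \<in> set (subseqs (map fst ps)) \<Longrightarrow> a xs = b xs"
  shows "star_along ps a = star_along ps b"
  using assms
proof (induction ps arbitrary: a b)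
  case (Cons p ps)
  obtain v e where p: "p = (v, e)" by (cases p)
  have "star_along ps (contract v a) = star_along ps (contract v b)"
    using Cons.prems by (intro Cons.IH) (auto simp: p Let_def contract_def)
  moreover have "star_along ps (grade a) = star_along ps (grade b)"
    using Cons.prems by (intro Cons.IH) (auto simp: p Let_def grade_def)
  ultimately show ?case by (simp add: p)
qed simp

lemma star_along_annihilator:
  assumes "of_degree 1 e" "\<forall>w\<in>set (map fst ps). e [w] = 0"
  shows "star_along ps (e \<and>\<^sub>p a) = 0"
proof -
  have "(e \<and>\<^sub>p a) xs = 0" if "xs \<in> set (subseqs (map fst ps))" for xs
    using wedge_annihilator'[OF assms(1)] assms(2) set_subseqs_subset[OF that] by blast
  then have "star_along ps (e \<and>\<^sub>p a) = star_along ps 0"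
    by (intro star_along_cong) simp
  then show ?thesis by (simp add: star_along_linear)
qed

text \<open>The star exchanges the degrees k and n - k, where n is the length of the frame.\<close>

lemma star_along_grade:
  "star_along ps (grade a) = (-1) ^ length ps *\<^sub>p grade (star_along ps a)"
  if "\<forall>e\<in>set (map snd ps). of_degree 1 e"
  using that
proof (induction ps arbitrary: a)
  case (Cons p ps)
  obtain v e where p: "p = (v, e)" by (cases p)
  have "grade e = - e" using Cons.prems grade_of_degree[of 1 e] by (simp add: p scale_def fun_eq_iff)
  moreover have "star_along ps (grade x) = (-1) ^ length ps *\<^sub>p grade (star_along ps x)" for x
    using Cons by simp
  ultimately show ?case
    unfolding p along_Cons contract_grade star_along_linear grade_linear grade_wedge grade_grade
    by (cases "even (length ps)") (simp_all add: wedge_linear)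
qed (simp add: scale_def unit_alt_def grade_def fun_eq_iff)

text \<open>The recursions of \<open>star_along\<close> and \<open>inner_along\<close> match term by term, which is the defining
  property of the Hodge star.\<close>

lemma wedge_star_along:
  assumes "dual_pairs ps"
  shows "(c \<and>\<^sub>p star_along ps a) (map fst ps) = inner_along (map fst ps) c a"
  using assms
proof (induction ps arbitrary: a c)
  case (Cons p ps)
  obtain v e where p: "p = (v, e)" by (cases p)
  note D = dual_pairs_Cons_iff[OF Cons.prems[unfolded p]]
  have 1: "contract v (star_along ((v, e) # ps) a) = star_along ps (grade a)"
    using D by (simp add: contract_covector_wedge contract_star_along)
  have 2: "(contract v c \<and>\<^sub>p (e \<and>\<^sub>p star_along ps (grade a))) (map fst ps) = 0"
    using wedge_annihilator[OF D(2)] D(4) by blast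
  \<comment> \<open>Only products of two values on the same list occur, so the two signs
    cancel.\<close>
  have 3: "inner_along b (grade x) (grade y) = inner_along b x y" for b :: "'a list" and x y
  proof (induction b arbitrary: x y)
    case (Cons w b)
    have "inner_along b (- x) (- y) = inner_along b x y" for x y
      by (induction b arbitrary: x y) auto
    then show ?case using Cons by simp
  qed (simp add: grade_def)
  have "(c \<and>\<^sub>p star_along (p # ps) a) (map fst (p # ps)) =
      (contract v c \<and>\<^sub>p star_along ((v, e) # ps) a) (map fst ps) +
      (grade c \<and>\<^sub>p contract v (star_along ((v, e) # ps) a)) (map fst ps)"
    by (simp only: p list.map fst_conv wedge_Cons)
  also have "\<dots> = inner_along (map fst (p # ps)) c a"
    using D(6) unfolding 1
    by (simp add: wedge_linear 2 Cons.IH 3 p)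
  finally show ?case .
qed (simp add: scale_def unit_alt_def)

lemma wedge_zero_subseqs:
  assumes "\<forall>xs\<in>set (subseqs b). s xs = 0"
  shows "(c \<and>\<^sub>p s) b = 0"
  using assms
proof (induction b arbitrary: c s)
  case (Cons v b)
  then have "\<forall>xs\<in>set (subseqs b). contract v s xs = 0" "\<forall>xs\<in>set (subseqs b). s xs = 0"
    by (simp_all only: in_subseqs_Cons) (simp_all add: contract_def)
  with Cons.IH show ?case by (simp add: wedge_Cons)
qed simp

text \<open>Testing with \<open>e \<and>\<^sub>p c\<close> shows that \<open>s\<close> vanishes on
  sublists without the head \<open>v\<close>. Once this is known, testing with \<open>c\<close>
  isolates \<open>contract v s\<close>, that is, the sublists with \<open>v\<close>. This gives the
  uniqueness of the Hodge star.\<close>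

lemma wedge_nondegenerate:
  assumes "dual_pairs ps" "\<And>c. alternating c \<Longrightarrow> (c \<and>\<^sub>p s) (map fst ps) = 0"
  shows "\<forall>xs\<in>set (subseqs (map fst ps)). s xs = 0"
  using assms
proof (induction ps arbitrary: s)
  case Nil
  then show ?case using Nil(2)[of unit_alt] by simp
next
  case (Cons p ps)
  obtain v e where p: "p = (v, e)" by (cases p)
  note D = dual_pairs_Cons_iff[OF Cons.prems(1)[unfolded p]]
  have 1: "\<forall>xs\<in>set (subseqs (map fst ps)). s xs = 0"
  proof (rule Cons.IH[OF D(6)])
    fix c :: "'a alt" assume "alternating c"
    then have "((e \<and>\<^sub>p c) \<and>\<^sub>p s) (v # map fst ps) = 0"
      using Cons.prems(2) D(1) by (auto simp: p alternating_wedge)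
    moreover have "(e \<and>\<^sub>p contract v (c \<and>\<^sub>p s)) (map fst ps) = 0"
      using wedge_annihilator'[OF D(2)] D(4) by blast
    ultimately show "(c \<and>\<^sub>p s) (map fst ps) = 0"
      using D fun_cong[OF contract_covector_wedge[OF D(2), of v "c \<and>\<^sub>p s"], of "map fst ps"]
      by (simp add: wedge_assoc) (simp add: contract_def)
  qed
  have 2: "\<forall>xs\<in>set (subseqs (map fst ps)). contract v s xs = 0"
  proof (rule Cons.IH[OF D(6)])
    fix c :: "'a alt" assume "alternating c"
    then have "(grade c \<and>\<^sub>p s) (v # map fst ps) = 0"
      using Cons.prems(2)[of "grade c"] by (auto simp: p alternating_linear_space)
    then show "(c \<and>\<^sub>p contract v s) (map fst ps) = 0"
      using wedge_zero_subseqs[OF 1] by (simp add: wedge_Cons)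
  qed
  show ?case using 1 2 by (simp only: p list.map fst_conv in_subseqs_Cons) (simp add: contract_def)
qed

section \<open>The inner product of forms does not depend on the orthonormal basis\<close>

lemma inner_along_linear:
  "inner_along b (x + y) c = inner_along b x c + inner_along b y c"
  "inner_along b (k *\<^sub>p x) c = k * inner_along b x c"
  "inner_along b (- x) c = - inner_along b x c"
  "inner_along b c (x + y) = inner_along b c x + inner_along b c y"
  "inner_along b c (k *\<^sub>p x) = k * inner_along b c x"
  "inner_along b c (- x) = - inner_along b c x"
  "inner_along b (x - y) c = inner_along b x c - inner_along b y c"
  by (induction b arbitrary: x y c) (auto simp: algebra_simps, auto simp: scale_def)

text \<open>Multiplication by a covector is adjoint to contraction with its metric dual; this makes the
  inner product on the exterior algebra independent of the orthonormal basis.\<close>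

lemma inner_along_wedge:
  assumes "of_degree 1 e" "alternating c"
  shows "inner_along b (e \<and>\<^sub>p a) c = inner_along b a (contract (\<Sum>w\<leftarrow>b. e [w] *\<^sub>R w) c)"
  using assms(2)
proof (induction b arbitrary: a c)
  case Nil
  then show ?case using assms(1) by (simp add: of_degree_def contract_add_scale)
next
  case (Cons v b)
  let ?u = "\<Sum>w\<leftarrow>b. e [w] *\<^sub>R w"
  have 1: "contract (\<Sum>w\<leftarrow>v # b. e [w] *\<^sub>R w) c = e [v] *\<^sub>p contract v c + contract ?u c"
    using Cons.prems by (simp add: contract_add_scale)
  have 2: "contract v (contract (\<Sum>w\<leftarrow>v # b. e [w] *\<^sub>R w) c) = - contract ?u (contract v c)"
    unfolding 1 contract_linear contract_swap[OF Cons.prems, of v ?u]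
    using Cons.prems by (simp add: contract_contract)
  show ?case
    unfolding inner_along.simps contract_covector_wedge[OF assms(1)] 2 unfolding 1
    using Cons.IH[OF Cons.prems] Cons.IH[OF alternating_contract[OF Cons.prems]]
    by (simp add: inner_along_linear)
qed

lemma inner_along_unit: "inner_along b unit_alt c = c []"
proof (induction b arbitrary: c)
  case (Cons v b)
  have "inner_along b 0 c = 0" for c :: "'a alt"
    by (induction b arbitrary: c) auto
  then show ?case using Cons by simp
qed (simp add: unit_alt_def)

lemma sum_Pow_nths:
  "(\<Sum>J\<in>Pow {..<length b}. a (nths b J) * c (nths b J)) = inner_along b a c"
proof (induction b arbitrary: a c)
  case (Cons v b)
  have "nths (v # b) (insert 0 (Suc ` J)) = v # nths b J" "nths (v # b) (Suc ` J) = nths b J" for J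
    by (auto simp: nths_Cons image_iff intro: arg_cong[of _ _ "nths b"])
  then show ?case
    using Cons[of a c] Cons[of "contract v a" "contract v c"]
    by (simp only: list.size(4) add_0_right One_nat_def add_Suc_right sum_Pow_lessThan_Suc)
       (simp add: contract_def)
qed simp

text \<open>The covector \<open>v \<mapsto> x \<bullet> v\<close> is a combination of the coframe,
  so it vanishes at \<open>x\<close> as well, and \<open>x \<bullet> x = 0\<close>.\<close>

lemma dual_pairs_separate:
  fixes ps :: "('e::euclidean_space \<times> 'e alt) list"
  assumes "dual_pairs ps" "length ps = DIM('e)" "\<forall>e\<in>set (map snd ps). e [x] = 0"
  shows "x = 0"
proof -
  define a where "a = (\<lambda>vs. case vs of [v] \<Rightarrow> x \<bullet> v | _ \<Rightarrow> 0)"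
  have a: "a (us @ v # vs) = (if us = [] \<and> vs = [] then x \<bullet> v else 0)" for us v vs
    by (cases us; cases vs) (auto simp: a_def split: list.split)
  have "alternating a"
    unfolding alternating_def
  proof (intro conjI allI)
    show "linear (\<lambda>v. a (us @ v # vs))" for us vs
      by (auto simp: a inner_right_distrib linearI)
  qed (simp add: a)
  then have "a [x] = expand_along ps a [x]" using expand_along_eq[OF assms(1,2)] by simp
  also have "\<dots> = contract x (expand_along ps a) []" by (simp add: contract_def)
  also have "\<dots> = 0"
    using dual_pairs_alt_form[OF assms(1)] assms(3) by (subst contract_expand_along) (auto simp: alt_form_iff)
  finally show ?thesis using a[of "[]" x "[]"] by simp
qed

definition coframe_metric :: "('e::real_vector \<times> 'e alt) list \<Rightarrow> 'e \<Rightarrow> 'e \<Rightarrow> real" where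
  "coframe_metric ps u v = (\<Sum>e\<leftarrow>map snd ps. e [u] * e [v])"

lemma linear_coframe_metric:
  assumes "dual_pairs ps"
  shows "linear (coframe_metric ps u)" "linear (\<lambda>u. coframe_metric ps u v)"
proof -
  have "\<forall>e\<in>set (map snd ps). linear (\<lambda>v. e [v])"
    using dual_pairs_alt_form[OF assms] covector_linear by blast
  then have lin: "linear (\<lambda>v. \<Sum>e\<leftarrow>map snd ps. e [u] * e [v])"
    for u
  proof (induction ps)
    case (Cons p ps)
    then have "linear (\<lambda>v. snd p [u] * snd p [v])"
      using linear_compose_scale_right[of "\<lambda>v. snd p [v]" "snd p [u]"] by simp
    then show ?case using Cons by (simp add: linear_compose_add)
  qed (simp add: linearI)
  show "linear (coframe_metric ps u)" unfolding coframe_metric_def by (rule lin)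
  show "linear (\<lambda>u. coframe_metric ps u v)"
    using lin[of v] unfolding coframe_metric_def by (simp add: mult.commute)
qed

lemma coframe_metric_vector:
  assumes "dual_pairs ps" "(v, e) \<in> set ps"
  shows "coframe_metric ps v u = e [u]"
  using assms
proof (induction ps)
  case (Cons p ps)
  obtain w f where p: "p = (w, f)" by (cases p)
  note D = dual_pairs_Cons_iff[OF Cons.prems(1)[unfolded p]]
  show ?case
  proof (cases "(v, e) = p")
    case True
    have "coframe_metric ps v u = 0"
      using D(5) True unfolding coframe_metric_def by (induction ps) (auto simp: p)
    then show ?thesis using True D(3) by (simp add: coframe_metric_def p)
  next
    case False
    then have "(v, e) \<in> set ps" using Cons.prems by simp
    then show ?thesis using Cons.IH D by (force simp: coframe_metric_def p)
  qed
qed simp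

text \<open>The dual coframe consists of the metric duals of the members of \<open>b\<close>;
  orthonormality is the duality condition for them.\<close>

lemma orthonormal_dual_pairs:
  fixes ps :: "('e::euclidean_space \<times> 'e alt) list"
  assumes "dual_pairs ps" "orthonormal_basis (coframe_metric ps) b"
  shows "\<exists>qs. dual_pairs qs \<and> map fst qs = b"
proof -
  define cov where "cov w = (\<lambda>vs. case vs of [v] \<Rightarrow> coframe_metric ps w v | _ \<Rightarrow> 0)" for w
  have c: "cov w (us @ v # vs) = (if us = [] \<and> vs = [] then coframe_metric ps w v else 0)" for w us v vs
    by (cases us; cases vs) (auto simp: cov_def split: list.split)
  have "alternating (cov w)" for w
    unfolding alternating_def
  proof (intro conjI allI)
    show "linear (\<lambda>v. cov w (us @ v # vs))" for us vs
      using linear_coframe_metric(1)[OF assms(1), of w] by (auto simp: c linear_iff)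
  qed (simp add: c)
  then have "alt_form 1 (cov w)" for w
    by (auto simp: alt_form_def cov_def split: list.split)
  then have "dual_pairs (map (\<lambda>w. (w, cov w)) b)"
    using assms(2) by (simp add: dual_pairs_def orthonormal_basis_def cov_def)
  moreover have "map fst (map (\<lambda>w. (w, cov w)) b) = b" by (simp add: comp_def)
  ultimately show ?thesis by blast
qed

lemma orthonormal_self:
  fixes ps :: "('e::euclidean_space \<times> 'e alt) list"
  assumes "dual_pairs ps" "length ps = DIM('e)"
  shows "orthonormal_basis (coframe_metric ps) (map fst ps)"
  unfolding orthonormal_basis_def
proof (intro conjI allI impI)
  fix i j assume "i < DIM('e)" "j < DIM('e)"
  then show "coframe_metric ps (map fst ps ! i) (map fst ps ! j) = (if i = j then 1 else 0)"
    using coframe_metric_vector[OF assms(1), of "fst (ps ! i)" "snd (ps ! i)"] assms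
    by (simp add: dual_pairs_def)
qed (use assms in simp)

text \<open>The sum is the metric dual of \<open>e\<close> computed in the basis \<open>b\<close>,
  while \<open>v\<close> is the one read off from the frame. Their difference is orthogonal to
  \<open>b\<close>, hence to every vector, so every covector of the frame vanishes on it.\<close>

lemma orthonormal_riesz:
  fixes ps :: "('e::euclidean_space \<times> 'e alt) list"
  assumes "dual_pairs ps" "length ps = DIM('e)" "orthonormal_basis (coframe_metric ps) b"
    and "(v, e) \<in> set ps"
  shows "(\<Sum>w\<leftarrow>b. e [w] *\<^sub>R w) = v"
proof -
  let ?g = "coframe_metric ps" and ?u = "\<Sum>w\<leftarrow>b. e [w] *\<^sub>R w"
  obtain qs where qs: "dual_pairs qs" "map fst qs = b"
    using orthonormal_dual_pairs assms by blast
  then have span: "span (set b) = UNIV"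
    using dual_pairs_span[OF qs(1)] assms(3) by (auto simp: orthonormal_basis_def)
  have lin: "linear (?g x)" "linear (\<lambda>x. ?g x y)" for x y
    using linear_coframe_metric[OF assms(1)] by auto
  have len: "length b = DIM('e)" using assms(3) by (simp add: orthonormal_basis_def)
  have b: "?g ?u (b ! j) = ?g v (b ! j)" if "j < DIM('e)" for j
  proof -
    have "?g (\<Sum>w\<leftarrow>c. e [w] *\<^sub>R w) y = (\<Sum>w\<leftarrow>c. e [w] * ?g w y)" for c y
      by (induction c)
         (use linear_0[OF lin(2)] linear_add[OF lin(2)] linear_cmul[OF lin(2)] in auto)
    then have "?g ?u (b ! j) = (\<Sum>w\<leftarrow>b. e [w] * ?g w (b ! j))" .
    also have "\<dots> = (\<Sum>i<DIM('e). e [b ! i] * ?g (b ! i) (b ! j))"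
      using sum_list_sum_nth[of "map (\<lambda>w. e [w] * ?g w (b ! j)) b"] len
      by (simp add: atLeast0LessThan)
    also have "\<dots> = (\<Sum>i<DIM('e). if i = j then e [b ! j] else 0)"
      using assms(3) that by (intro sum.cong) (auto simp: orthonormal_basis_def)
    also have "\<dots> = ?g v (b ! j)"
      using that coframe_metric_vector[OF assms(1,4)] by simp
    finally show ?thesis .
  qed
  have zero: "?g (?u - v) y = 0" for y
  proof (rule linear_eq_0_on_span[OF lin(1)])
    show "?g (?u - v) x = 0" if "x \<in> set b" for x
      using b that len linear_diff[OF lin(2)] by (auto simp: in_set_conv_nth)
  qed (use span in auto)
  have "?u - v = 0"
  proof (rule dual_pairs_separate[OF assms(1,2)], intro ballI)
    fix f assume "f \<in> set (map snd ps)"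
    then obtain w where "(w, f) \<in> set ps" by auto
    then show "f [?u - v] = 0"
      using coframe_metric_vector[OF assms(1), of w f "?u - v"] zero[of w]
      by (simp add: coframe_metric_def mult.commute)
  qed
  then show ?thesis by simp
qed

text \<open>Once \<open>a\<close> is expanded along the frame, adjointness turns each covector
  factor into contraction with the paired frame vector, whatever \<open>b\<close> is. What remains
  no longer refers to \<open>b\<close>.\<close>

lemma inner_along_orthonormal:
  fixes ps :: "('e::euclidean_space \<times> 'e alt) list"
  assumes ps: "dual_pairs ps" "length ps = DIM('e)" and b: "orthonormal_basis (coframe_metric ps) b"
    and a: "alternating a" and c: "alternating c"
  shows "inner_along b a c = inner_along (map fst ps) a c"
proof -
  have "inner_along b (expand_along qs a) c = inner_along (map fst qs) a c"
    if "set qs \<subseteq> set ps" for qs a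
    using that c
  proof (induction qs a arbitrary: c rule: expand_along.induct)
    case (1 a)
    then show ?case by (simp add: inner_along_linear inner_along_unit)
  next
    case (2 v e qs a)
    have "of_degree 1 e" using dual_pairs_alt_form[OF ps(1), of e] 2(3) by (force simp: alt_form_iff)
    moreover have "(\<Sum>w\<leftarrow>b. e [w] *\<^sub>R w) = v" using orthonormal_riesz[OF ps b] 2(3) by simp
    ultimately show ?case
      using 2 unfolding along_Cons inner_along_linear
      by (simp add: inner_along_wedge alternating_contract)
  qed
  from this[of ps a] show ?thesis using expand_along_eq[OF ps a] by simp
qed

lemma alt_inner_eq:
  fixes ps :: "('e::euclidean_space \<times> 'e alt) list"
  assumes ps: "dual_pairs ps" "length ps = DIM('e)" and a: "alternating a" and c: "alternating c"
  shows "alt_inner (coframe_metric ps) a c = inner_along (map fst ps) a c"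
proof -
  define b where "b = (SOME b. orthonormal_basis (coframe_metric ps) b)"
  have b: "orthonormal_basis (coframe_metric ps) b"
    unfolding b_def using orthonormal_self[OF ps] by (rule someI)
  have "length b = DIM('e)" using b by (simp add: orthonormal_basis_def)
  then show ?thesis
    unfolding alt_inner_def b_def[symmetric] Let_def
    using sum_Pow_nths[where b = b and a = a and c = c] inner_along_orthonormal[OF ps b a c] by simp
qed

text \<open>This evaluates the definite description of the star. Existence: a top degree component
  is determined by its value on the frame, where the two recursions agree. Uniqueness: the wedge
  pairing is nondegenerate. The condition on \<open>vol\<close> says that the frame is positively
  oriented and of unit volume.\<close>

theorem alt_star_eq:
  fixes ps :: "('e::euclidean_space \<times> 'e alt) list"
  assumes ps: "dual_pairs ps" "length ps = DIM('e)"
    and vol: "alternating vol" "vol (map fst ps) = 1" and a: "alternating a"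
  shows "alt_star (coframe_metric ps) vol a = star_along ps a"
  unfolding alt_star_def
proof (rule the_equality)
  have alt: "alternating (star_along ps a)"
    using dual_pairs_alt_form[OF ps(1)] by (intro alternating_star_along) (simp add: alt_form_iff)
  moreover have "(c \<and>\<^sub>p star_along ps a) vs = alt_inner (coframe_metric ps) c a * vol vs"
    if c: "alternating c" and vs: "length vs = DIM('e)" for c vs
  proof -
    have "(c \<and>\<^sub>p star_along ps a) vs = (inner_along (map fst ps) c a *\<^sub>p vol) vs"
      by (rule top_degree_eqI[OF ps _ _ _ vs])
         (simp_all add: alt c vol alternating_wedge alternating_linear_space,
          simp add: scale_def vol wedge_star_along[OF ps(1)])
    then show ?thesis using alt_inner_eq[OF ps c a] by (simp add: scale_def)
  qed
  ultimately show *: "alternating (star_along ps a) \<and> (\<forall>c. alternating c \<longrightarrow> (\<forall>vs. length vs = DIM('e) \<longrightarrow>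
      (c \<and>\<^sub>p star_along ps a) vs = alt_inner (coframe_metric ps) c a * vol vs))"
    by blast
  fix s assume s: "alternating s \<and> (\<forall>c. alternating c \<longrightarrow> (\<forall>vs. length vs = DIM('e) \<longrightarrow>
      (c \<and>\<^sub>p s) vs = alt_inner (coframe_metric ps) c a * vol vs))"
  have "\<forall>xs\<in>set (subseqs (map fst ps)). (s - star_along ps a) xs = 0"
    using s * ps(2)
    by (intro wedge_nondegenerate[OF ps(1), of "s - star_along ps a"]) (auto simp: wedge_diff_right)
  then show "s = star_along ps a"
    using s alt by (intro alternating_eqI[OF ps]) auto
qed

text \<open>The sign is (-1)^(k (n - k)), which depends on the degree k only if the dimension n is
  even.\<close>

lemma star_along_star_along:
  assumes "dual_pairs ps"
  shows "star_along ps (star_along ps a) = expand_along ps (if even (length ps) then grade a else a)"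
  using assms
proof (induction ps arbitrary: a)
  case Nil
  then show ?case by (simp add: scale_def unit_alt_def grade_def)
next
  case (Cons p ps)
  obtain v e where p: "p = (v, e)" by (cases p)
  note D = dual_pairs_Cons_iff[OF Cons.prems[unfolded p]]
  have deg: "\<forall>e\<in>set (map snd ps). of_degree 1 e" using D by blast
  have 1: "contract v (star_along (p # ps) a) = star_along ps (grade a)"
    using D by (simp add: p contract_covector_wedge contract_star_along)
  have e: "grade e = - e" using grade_of_degree[OF D(2)] by (simp add: scale_def fun_eq_iff)
  have 2: "star_along ps (grade (star_along (p # ps) a)) = star_along ps (grade (star_along ps (contract v a)))"
    using star_along_annihilator[OF D(2,4)] by (simp add: p star_along_linear e wedge_linear)
  have 3: "grade (star_along ps x) = (-1) ^ length ps *\<^sub>p star_along ps (grade x)" for x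
    using star_along_grade[OF deg, of x] by (simp flip: power_mult_distrib)
  have "star_along (p # ps) (star_along (p # ps) a) =
      star_along ps (star_along ps (grade a)) + e \<and>\<^sub>p star_along ps (grade (star_along (p # ps) a))"
    using 1 by (simp add: p)
  also have "\<dots> = expand_along (p # ps) (if even (length (p # ps)) then grade a else a)"
    unfolding 2 3
    using Cons.IH[OF D(6)] by (simp add: p star_along_linear expand_along_minus wedge_minus_right)
  finally show ?case .
qed

section \<open>The linear algebra of SU(3)-structures\<close>

lemma covector_anticommute:
  assumes "of_degree 1 a" "of_degree 1 b"
  shows "a \<and>\<^sub>p b = - (b \<and>\<^sub>p a)" "a \<and>\<^sub>p (b \<and>\<^sub>p c) = - (b \<and>\<^sub>p (a \<and>\<^sub>p c))"
proof -
  show 1: "a \<and>\<^sub>p b = - (b \<and>\<^sub>p a)"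
    using wedge_commute[OF assms] by simp
  show "a \<and>\<^sub>p (b \<and>\<^sub>p c) = - (b \<and>\<^sub>p (a \<and>\<^sub>p c))"
    by (simp add: wedge_assoc[symmetric] 1 wedge_minus_left)
qed

lemma covector_square:
  assumes "of_degree 1 a"
  shows "a \<and>\<^sub>p a = 0" "a \<and>\<^sub>p (a \<and>\<^sub>p c) = 0"
proof -
  have "(a \<and>\<^sub>p a) vs = - (a \<and>\<^sub>p a) vs" for vs
    using fun_cong[OF covector_anticommute(1)[OF assms assms]] by simp
  then show 1: "a \<and>\<^sub>p a = 0" by (auto simp: fun_eq_iff)
  show "a \<and>\<^sub>p (a \<and>\<^sub>p c) = 0" by (simp add: wedge_assoc[symmetric] 1)
qed

lemma covector_wedge_eval:
  assumes "of_degree 1 e"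
  shows "(e \<and>\<^sub>p a) (v # vs) = e [v] * a vs - (e \<and>\<^sub>p contract v a) vs"
  using fun_cong[OF contract_covector_wedge[OF assms, of v a], of vs]
  by (simp add: contract_def[of v "e \<and>\<^sub>p a"] scale_def)

lemma covector_eval:
  assumes "of_degree 1 e"
  shows "e [] = 0" "e (u # w # vs) = 0" "grade e = - e"
  using assms grade_of_degree[OF assms] by (auto simp: of_degree_def scale_def fun_eq_iff)

lemma apply_scale: "(c *\<^sub>p a) vs = c * a vs"
  by (simp add: scale_def)

text \<open>A numeral is a constant function here, and collecting equal terms produces such
  pointwise products; they are turned back into scalings.\<close>

lemma numeral_times_alt: "numeral n * a = numeral n *\<^sub>p (a :: 'e alt)"
  by (simp add: scale_def fun_eq_iff)

lemma unit_alt_Cons [simp]: "unit_alt (v # vs) = 0" and unit_alt_Nil [simp]: "unit_alt [] = 1"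
  by (simp_all add: unit_alt_def)

text \<open>Separate names for the vectors and covectors allow identities between explicit forms to
  be proved by plain rewriting.\<close>

locale frame6 =
  fixes e1 e2 e3 e4 e5 e6 :: "'e::euclidean_space alt" and v1 v2 v3 v4 v5 v6 :: 'e
  assumes dual: "dual_pairs [(v1, e1), (v2, e2), (v3, e3), (v4, e4), (v5, e5), (v6, e6)]"
    and dim: "DIM('e) = 6"
begin

definition frame where
  "frame = [(v1, e1), (v2, e2), (v3, e3), (v4, e4), (v5, e5), (v6, e6)]"

definition om where
  "om = e1 \<and>\<^sub>p e2 + e3 \<and>\<^sub>p e4 + e5 \<and>\<^sub>p e6"

definition psp where
  "psp = e1 \<and>\<^sub>p e3 \<and>\<^sub>p e5 - e1 \<and>\<^sub>p e4 \<and>\<^sub>p e6 - e2 \<and>\<^sub>p e3 \<and>\<^sub>p e6 - e2 \<and>\<^sub>p e4 \<and>\<^sub>p e5"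

definition psm where
  "psm = - (e2 \<and>\<^sub>p e4 \<and>\<^sub>p e6) + e2 \<and>\<^sub>p e3 \<and>\<^sub>p e5 + e1 \<and>\<^sub>p e4 \<and>\<^sub>p e5 + e1 \<and>\<^sub>p e3 \<and>\<^sub>p e6"

lemma frame_dual: "dual_pairs frame" "length frame = DIM('e)"
  using dual dim by (simp_all add: frame_def)

lemma
  shows deg: "of_degree 1 e1" "of_degree 1 e2" "of_degree 1 e3" "of_degree 1 e4" "of_degree 1 e5" "of_degree 1 e6"
    and alt: "alternating e1" "alternating e2" "alternating e3" "alternating e4" "alternating e5" "alternating e6"
  using dual by (auto simp: dual_pairs_Cons alt_form_iff)

lemma pairing [simp]:
  "e1 [v1] = 1" "e1 [v2] = 0" "e1 [v3] = 0" "e1 [v4] = 0" "e1 [v5] = 0" "e1 [v6] = 0"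
  "e2 [v1] = 0" "e2 [v2] = 1" "e2 [v3] = 0" "e2 [v4] = 0" "e2 [v5] = 0" "e2 [v6] = 0"
  "e3 [v1] = 0" "e3 [v2] = 0" "e3 [v3] = 1" "e3 [v4] = 0" "e3 [v5] = 0" "e3 [v6] = 0"
  "e4 [v1] = 0" "e4 [v2] = 0" "e4 [v3] = 0" "e4 [v4] = 1" "e4 [v5] = 0" "e4 [v6] = 0"
  "e5 [v1] = 0" "e5 [v2] = 0" "e5 [v3] = 0" "e5 [v4] = 0" "e5 [v5] = 1" "e5 [v6] = 0"
  "e6 [v1] = 0" "e6 [v2] = 0" "e6 [v3] = 0" "e6 [v4] = 0" "e6 [v5] = 0" "e6 [v6] = 1"
  using dual by (auto simp: dual_pairs_Cons)

lemmas contract_e = deg[THEN contract_of_degree_1]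
lemmas contract_e_wedge = deg[THEN contract_covector_wedge]
lemmas grade_e = deg[THEN covector_eval(3)]

text \<open>Oriented rules that sort a product of covectors by increasing index and delete products
  with a repeated factor. Together with associativity and linearity they bring every form to a
  normal form.\<close>

lemmas anticommute =
  deg[THEN covector_square(1)] deg[THEN covector_square(2)]
  covector_anticommute[OF deg(2) deg(1)] covector_anticommute[OF deg(3) deg(1)]
  covector_anticommute[OF deg(4) deg(1)] covector_anticommute[OF deg(5) deg(1)]
  covector_anticommute[OF deg(6) deg(1)] covector_anticommute[OF deg(3) deg(2)]
  covector_anticommute[OF deg(4) deg(2)] covector_anticommute[OF deg(5) deg(2)]
  covector_anticommute[OF deg(6) deg(2)] covector_anticommute[OF deg(4) deg(3)]
  covector_anticommute[OF deg(5) deg(3)] covector_anticommute[OF deg(6) deg(3)]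
  covector_anticommute[OF deg(5) deg(4)] covector_anticommute[OF deg(6) deg(4)]
  covector_anticommute[OF deg(6) deg(5)]

lemmas normal = numeral_times_alt anticommute wedge_assoc wedge_linear
lemmas eval = deg[THEN covector_wedge_eval] deg[THEN covector_eval(1)] deg[THEN covector_eval(2)]
  contract_e contract_e_wedge wedge_assoc wedge_linear apply_scale
lemmas star_simps = frame_def contract_e contract_e_wedge grade_e star_along_linear deg[THEN covector_eval(1)]

lemma alt_forms: "alt_form 2 om" "alt_form 3 psp" "alt_form 3 psm"
proof -
  have [simp]: "of_degree (Suc (Suc 0)) (a \<and>\<^sub>p b)" if "of_degree 1 a" "of_degree 1 b" for a b :: "'e alt"
    using of_degree_wedge[OF that] by simp
  have [simp]: "of_degree 3 (a \<and>\<^sub>p b \<and>\<^sub>p c)" if "of_degree 1 a" "of_degree 1 b" "of_degree 1 c"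
    for a b c :: "'e alt"
    using of_degree_wedge[OF of_degree_wedge[OF that(1,2)] that(3)] by (simp add: eval_nat_numeral)
  show "alt_form 2 om" "alt_form 3 psp" "alt_form 3 psm"
    using deg alt unfolding om_def psp_def psm_def alt_form_iff numeral_2_eq_2
    by (simp_all add: alternating_wedge alternating_linear_space of_degree_linear)
qed

lemma om_cubed: "om \<and>\<^sub>p om \<and>\<^sub>p om = 6 *\<^sub>p (e1 \<and>\<^sub>p (e2 \<and>\<^sub>p (e3 \<and>\<^sub>p (e4 \<and>\<^sub>p (e5 \<and>\<^sub>p e6)))))"
  unfolding om_def by (simp add: normal) (simp add: scale_def fun_eq_iff)

lemma om_cubed_eval: "(om \<and>\<^sub>p om \<and>\<^sub>p om) (map fst frame) = 6"
  unfolding om_cubed by (simp add: frame_def eval)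

lemma om_psi: "om \<and>\<^sub>p psp = 0" "om \<and>\<^sub>p psm = 0"
  unfolding om_def psp_def psm_def by (simp_all add: normal)

lemma star_om: "star_along frame om = (1/2) *\<^sub>p (om \<and>\<^sub>p om)"
  unfolding om_def by (simp add: star_simps normal) (simp add: scale_def fun_eq_iff)

lemma star_om_om: "star_along frame (om \<and>\<^sub>p om) = 2 *\<^sub>p om"
  unfolding om_def by (simp add: normal star_simps) (simp add: scale_def fun_eq_iff)

lemma star_psi: "star_along frame psp = psm" "star_along frame psm = - psp"
  unfolding psp_def psm_def by (simp_all add: wedge_assoc star_simps wedge_linear)

text \<open>The left side is built from \<open>om\<close> and \<open>psp\<close> alone, so up to the
  volume form these two determine the metric. This is what makes the metric the same for all adapted
  coframes.\<close>

lemma metric_eval: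
  "(om \<and>\<^sub>p (contract u psp \<and>\<^sub>p contract w psp)) (map fst frame) =
    2 * coframe_metric frame u w"
  unfolding om_def psp_def coframe_metric_def
  by (simp add: eval frame_def)

lemma covector_expand:
  assumes "alt_form 1 a"
  shows "a = a [v1] *\<^sub>p e1 + a [v2] *\<^sub>p e2 + a [v3] *\<^sub>p e3 + a [v4] *\<^sub>p e4 + a [v5] *\<^sub>p e5 + a [v6] *\<^sub>p e6"
proof -
  have a: "alternating a" "of_degree 1 a" using assms by (auto simp: alt_form_iff)
  have "a [] = 0" using a(2) by (simp add: of_degree_def)
  moreover have "expand_along ps (c *\<^sub>p unit_alt) = c *\<^sub>p unit_alt" for ps :: "('e \<times> 'e alt) list" and c
  proof (induction ps)
    case (Cons p ps)
    have "expand_along ps 0 = 0" using expand_along_minus[of ps 0] by (auto simp: fun_eq_iff)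
    then show ?case using Cons by (cases p) simp
  qed (simp add: apply_scale)
  ultimately have "expand_along frame a = a [v1] *\<^sub>p e1 + a [v2] *\<^sub>p e2 + a [v3] *\<^sub>p e3 + a [v4] *\<^sub>p e4 + a [v5] *\<^sub>p e5 + a [v6] *\<^sub>p e6"
    using a(2) by (simp add: frame_def contract_of_degree_1 wedge_linear)
  then show ?thesis using expand_along_eq[OF frame_dual a(1)] by simp
qed

text \<open>On the five frame vectors other than \<open>v2\<close>, the partner of \<open>v1\<close>
  under \<open>om\<close>, the product is a nonzero multiple of \<open>a [v1]\<close>; likewise for
  the other components. This is the injectivity of the Lefschetz map on 1-forms.\<close>

lemma lefschetz_covector:
  assumes a: "alt_form 1 a" and 0: "om \<and>\<^sub>p (a \<and>\<^sub>p om) = 0"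
  shows "a = 0"
proof -
  have d: "of_degree 1 a" using a by (simp add: alt_form_iff)
  note ev = covector_wedge_eval[OF d] covector_eval[OF d] contract_of_degree_1[OF d] contract_covector_wedge[OF d]
  have "(om \<and>\<^sub>p (a \<and>\<^sub>p om)) vs = 0" for vs using 0 by simp
  from this[of "[v1,v3,v4,v5,v6]"] this[of "[v2,v3,v4,v5,v6]"] this[of "[v1,v2,v3,v5,v6]"]
    this[of "[v1,v2,v4,v5,v6]"] this[of "[v1,v2,v3,v4,v5]"] this[of "[v1,v2,v3,v4,v6]"]
  have "a [v1] = 0" "a [v2] = 0" "a [v3] = 0" "a [v4] = 0" "a [v5] = 0" "a [v6] = 0"
    by (simp_all add: om_def eval ev)
  then show ?thesis using covector_expand[OF a] by simp
qed

text \<open>Both sides are linear in \<open>a\<close>, so a covector of the coframe may be taken,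
  for which this is a computation.\<close>

lemma star_covector_psi:
  assumes "alt_form 1 a"
  shows "star_along frame (a \<and>\<^sub>p psp) \<and>\<^sub>p om = a \<and>\<^sub>p psp"
    and "star_along frame (a \<and>\<^sub>p psm) \<and>\<^sub>p om = a \<and>\<^sub>p psm"
proof -
  have 1: "star_along frame (e \<and>\<^sub>p psp) \<and>\<^sub>p om = e \<and>\<^sub>p psp \<and>
      star_along frame (e \<and>\<^sub>p psm) \<and>\<^sub>p om = e \<and>\<^sub>p psm"
    if "e \<in> {e1, e2, e3, e4, e5, e6}" for e
    using that unfolding psp_def psm_def om_def
    by (elim insertE emptyE; hypsubst) (simp_all add: star_simps normal)
  show "star_along frame (a \<and>\<^sub>p psp) \<and>\<^sub>p om = a \<and>\<^sub>p psp"
    "star_along frame (a \<and>\<^sub>p psm) \<and>\<^sub>p om = a \<and>\<^sub>p psm"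
    by (subst (1 2) covector_expand[OF assms], simp add: wedge_linear star_along_linear 1)+
qed

text \<open>Evaluated on four suitable frame vectors that contain a pair such as \<open>v1\<close>,
  \<open>v2\<close>, the equation involves only the two components of \<open>a\<close> on that pair.
  Two evaluations give a linear system whose determinant is \<open>x\<^sup>2 + y\<^sup>2\<close> up
  to sign.\<close>

lemma covector_psi_nonzero:
  assumes a: "alt_form 1 a" and xy: "x\<^sup>2 + y\<^sup>2 = 1"
    and 0: "a \<and>\<^sub>p (x *\<^sub>p psm + y *\<^sub>p psp) = 0"
  shows "a = 0"
proof -
  have d: "of_degree 1 a" using a by (simp add: alt_form_iff)
  note ev = covector_wedge_eval[OF d] covector_eval[OF d] contract_of_degree_1[OF d] contract_covector_wedge[OF d]
  have z: "(a \<and>\<^sub>p (x *\<^sub>p psm + y *\<^sub>p psp)) vs = 0" for vs using 0 by simp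
  have "p = 0 \<and> q = 0" if "x * p - y * q = 0" "y * p + x * q = 0" for p q
  proof -
    have "x * (x * p - y * q) + y * (y * p + x * q) = (x\<^sup>2 + y\<^sup>2) * p"
      "x * (y * p + x * q) - y * (x * p - y * q) = (x\<^sup>2 + y\<^sup>2) * q"
      by (simp_all add: power2_eq_square algebra_simps)
    then show ?thesis unfolding that xy by simp
  qed
  note * = this
  have "a [v1] = 0 \<and> a [v2] = 0"
    using z[of "[v1,v2,v3,v5]"] z[of "[v1,v2,v3,v6]"]
    by (intro *) (simp_all add: psp_def psm_def eval ev algebra_simps)
  moreover have "a [v3] = 0 \<and> a [v4] = 0"
    using z[of "[v1,v3,v4,v5]"] z[of "[v1,v3,v4,v6]"]
    by (intro *) (simp_all add: psp_def psm_def eval ev algebra_simps)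
  moreover have "a [v5] = 0 \<and> a [v6] = 0"
    using z[of "[v1,v3,v5,v6]"] z[of "[v1,v4,v5,v6]"]
    by (intro *) (simp_all add: psp_def psm_def eval ev algebra_simps)
  ultimately show ?thesis using covector_expand[OF a] by simp
qed

text \<open>The three summands lie in different irreducible components of the 4-forms, on which the
  operator \<open>a \<mapsto> star a \<and> om\<close> acts by the scalars \<open>2\<close>, \<open>1\<close> and \<open>-1\<close>.\<close>

lemma four_form_decomposition:
  assumes xy: "x\<^sup>2 + y\<^sup>2 = 1" and a: "alt_form 1 a" and t: "alt_form 2 t"
    and st: "star_along frame t = - (t \<and>\<^sub>p om)"
    and 0: "c *\<^sub>p (om \<and>\<^sub>p om) + a \<and>\<^sub>p (x *\<^sub>p psm + y *\<^sub>p psp) - t \<and>\<^sub>p om = 0"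
  shows "c = 0" "a = 0" "t = 0"
proof -
  let ?r = "a \<and>\<^sub>p (x *\<^sub>p psm + y *\<^sub>p psp)"
  have sr: "star_along frame ?r \<and>\<^sub>p om = ?r"
    by (simp add: wedge_linear star_along_linear star_covector_psi[OF a])
  have tw: "t \<and>\<^sub>p om = c *\<^sub>p (om \<and>\<^sub>p om) + ?r"
    using 0 by (simp add: algebra_simps)
  \<comment> \<open>The double star is the identity on 2-forms in dimension 6. Applying the star to
    \<open>st\<close> therefore yields a second expression for \<open>t\<close>, to be compared with
    \<open>tw\<close>.\<close>
  have "star_along frame (star_along frame t) = t"
    using star_along_star_along[OF frame_dual(1), of t] expand_along_eq[OF frame_dual, of t] t
      grade_of_degree[of 2 t] dim frame_dual(2) by (simp add: alt_form_iff)
  then have "t = - ((2 * c) *\<^sub>p om) - star_along frame ?r"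
    unfolding st tw by (simp add: star_along_linear star_om_om mult.commute)
  then have tw2: "t \<and>\<^sub>p om = - ((2 * c) *\<^sub>p (om \<and>\<^sub>p om)) - ?r"
    using sr by (metis wedge_diff_left wedge_minus_left wedge_scale_left)
  \<comment> \<open>Equating \<open>tw\<close> and \<open>tw2\<close> gives 2 r = - 3 c om^2. The
    product with \<open>om\<close> then vanishes on the left, whereas the cube of \<open>om\<close>
    is not zero.\<close>
  have r: "?r vs = - (3 / 2 * c) * (om \<and>\<^sub>p om) vs" for vs
    using fun_cong[OF tw, of vs] fun_cong[OF tw2, of vs] by (simp add: apply_scale)
  have "?r \<and>\<^sub>p om = 0"
  proof -
    have "psm \<and>\<^sub>p om = 0" "psp \<and>\<^sub>p om = 0"
      using wedge_commute[of 3 psm 2 om] wedge_commute[of 3 psp 2 om] alt_forms om_psi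
      by (simp_all add: alt_form_iff)
    then show ?thesis by (simp add: wedge_assoc wedge_linear)
  qed
  moreover have "?r = (- (3 / 2 * c)) *\<^sub>p (om \<and>\<^sub>p om)"
    using r by (simp add: fun_eq_iff apply_scale)
  ultimately have "(- (3 / 2 * c)) *\<^sub>p (om \<and>\<^sub>p om \<and>\<^sub>p om) = 0"
    by (simp only: wedge_scale_left)
  then have "- (3 / 2 * c) * 6 = 0"
    using om_cubed_eval by (metis apply_scale zero_fun_apply)
  then show c: "c = 0" by simp
  then have "?r = 0" using r by (simp add: fun_eq_iff)
  then show a0: "a = 0" by (rule covector_psi_nonzero[OF a xy])
  then show "t = 0"
    using \<open>t = - ((2 * c) *\<^sub>p om) - star_along frame ?r\<close> c by (simp add: star_along_linear)
qed

end

text \<open>The forms in \<open>metric_eval\<close> are common to both coframes, and the cube of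
  \<open>om\<close> is 6 on either frame. Top degree forms that agree on one frame agree on the
  other; the factor \<open>?g / 3\<close> is 2 g / 6.\<close>

lemma coframe_metric_unique:
  assumes "frame6 e1 e2 e3 e4 e5 e6 v1 v2 v3 v4 v5 v6"
    and "frame6 f1 f2 f3 f4 f5 f6 w1 w2 w3 w4 w5 w6"
    and om: "frame6.om e1 e2 e3 e4 e5 e6 = frame6.om f1 f2 f3 f4 f5 f6"
    and psp: "frame6.psp e1 e2 e3 e4 e5 e6 = frame6.psp f1 f2 f3 f4 f5 f6"
  shows "coframe_metric (frame6.frame e1 e2 e3 e4 e5 e6 v1 v2 v3 v4 v5 v6) u v =
    coframe_metric (frame6.frame f1 f2 f3 f4 f5 f6 w1 w2 w3 w4 w5 w6) u v"
proof -
  interpret E: frame6 e1 e2 e3 e4 e5 e6 v1 v2 v3 v4 v5 v6 by fact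
  interpret F: frame6 f1 f2 f3 f4 f5 f6 w1 w2 w3 w4 w5 w6 by fact
  let ?a = "E.om \<and>\<^sub>p (contract u E.psp \<and>\<^sub>p contract v E.psp)"
  let ?g = "coframe_metric E.frame u v"
  have "?a (map fst F.frame) = ((?g / 3) *\<^sub>p (E.om \<and>\<^sub>p E.om \<and>\<^sub>p E.om)) (map fst F.frame)"
  proof (rule top_degree_eqI[OF E.frame_dual])
    show "alternating ?a" "alternating ((?g / 3) *\<^sub>p (E.om \<and>\<^sub>p E.om \<and>\<^sub>p E.om))"
      using E.alt_forms by (simp_all add: alt_form_iff alternating_wedge alternating_contract alternating_linear_space)
    show "?a (map fst E.frame) = ((?g / 3) *\<^sub>p (E.om \<and>\<^sub>p E.om \<and>\<^sub>p E.om)) (map fst E.frame)"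
      using E.metric_eval[of u v] E.om_cubed_eval by (simp add: apply_scale)
  qed (use F.frame_dual in simp)
  then show ?thesis
    using F.metric_eval[of u v] F.om_cubed_eval om psp by (simp add: apply_scale)
qed

section \<open>Exterior derivative\<close>

text \<open>The derivative is taken for each list of arguments separately, so no norm on a space of
  forms is involved. \<open>F' h\<close> is the derivative in direction \<open>h\<close>.\<close>

definition alt_deriv :: "('e::real_normed_vector \<Rightarrow> 'e alt) \<Rightarrow> ('e \<Rightarrow> 'e alt) \<Rightarrow> 'e \<Rightarrow> bool" where
  "alt_deriv F F' x \<longleftrightarrow> (\<forall>vs. ((\<lambda>y. F y vs) has_derivative (\<lambda>h. F' h vs)) (at x))"

text \<open>The algebraic half of the exterior derivative: antisymmetrisation of a derivative that
  has already been taken. The Leibniz rule thereby splits into the product rule and pure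
  algebra.\<close>

definition alternate :: "('e \<Rightarrow> 'e alt) \<Rightarrow> 'e alt" where
  "alternate F' = (\<lambda>vs. \<Sum>m<length vs. (-1) ^ m * F' (vs ! m) (take m vs @ drop (Suc m) vs))"

text \<open>Cartan's formula for a constant vector field, with \<open>F' v\<close> in the role of
  the Lie derivative.\<close>

lemma contract_alternate: "contract v (alternate F') = F' v - alternate (\<lambda>h. contract v (F' h))"
  by (simp add: fun_eq_iff contract_def alternate_def sum.lessThan_Suc_shift sum_negf
      del: sum.lessThan_Suc)

lemma alternate_Nil [simp]: "alternate F' [] = 0"
  by (simp add: alternate_def)

lemma alternate_linear:
  "alternate (\<lambda>h. F h + G h) = alternate F + alternate G"
  "alternate (\<lambda>h. F h - G h) = alternate F - alternate G"
  "alternate (\<lambda>h. - F h) = - alternate F"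
  "alternate (\<lambda>h. c *\<^sub>p F h) = c *\<^sub>p alternate F"
  "alternate (\<lambda>h. 0) = 0"
  by (auto simp: alternate_def fun_eq_iff scale_def algebra_simps sum.distrib sum_subtractf
      sum_negf sum_distrib_left)

lemma alternate_grade: "alternate (\<lambda>h. grade (F h)) = - grade (alternate F)"
  for F :: "'e \<Rightarrow> 'e alt"
proof
  fix vs :: "'e list"
  have "(-1) ^ m * ((-1) ^ (length vs - Suc 0) * c) = - ((-1) ^ length vs * ((-1) ^ m * c))"
    if "m < length vs" for m and c :: real
    using that by (cases vs) auto
  then show "alternate (\<lambda>h. grade (F h)) vs = (- grade (alternate F)) vs"
    by (auto simp: alternate_def grade_def sum_distrib_left sum_negf[symmetric] intro!: sum.cong)
qed

text \<open>The algebraic Leibniz rule. Cartan's formula reduces a longer argument list to products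
  in which one of the forms is contracted with \<open>v\<close> and others are graded; these are
  again of the shape covered by the induction hypothesis.\<close>

lemma alternate_wedge:
  "alternate (\<lambda>h. F' h \<and>\<^sub>p G + F \<and>\<^sub>p G' h) = alternate F' \<and>\<^sub>p G + grade F \<and>\<^sub>p alternate G'"
proof
  fix vs
  show "alternate (\<lambda>h. F' h \<and>\<^sub>p G + F \<and>\<^sub>p G' h) vs =
      (alternate F' \<and>\<^sub>p G + grade F \<and>\<^sub>p alternate G') vs"
  proof (induction vs arbitrary: F F' G G')
    case (Cons v vs)
    have "alternate (\<lambda>h. F' h \<and>\<^sub>p G + F \<and>\<^sub>p G' h) (v # vs) =
        contract v (alternate (\<lambda>h. F' h \<and>\<^sub>p G + F \<and>\<^sub>p G' h)) vs"
      by (simp add: contract_def)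
    also have "\<dots> = (F' v \<and>\<^sub>p G + F \<and>\<^sub>p G' v) vs -
        alternate (\<lambda>h. (contract v (F' h) \<and>\<^sub>p G + contract v F \<and>\<^sub>p G' h) +
          (grade (F' h) \<and>\<^sub>p contract v G + grade F \<and>\<^sub>p contract v (G' h))) vs"
      by (simp add: contract_alternate contract_wedge algebra_simps)
    also have "\<dots> = (contract v (alternate F') \<and>\<^sub>p G + grade (alternate F') \<and>\<^sub>p contract v G
        + contract v (grade F) \<and>\<^sub>p alternate G' + F \<and>\<^sub>p contract v (alternate G')) vs"
      unfolding alternate_linear(1)[of "\<lambda>h. contract v (F' h) \<and>\<^sub>p G + contract v F \<and>\<^sub>p G' h"]
      unfolding minus_apply plus_fun_apply Cons alternate_grade contract_alternate contract_grade
        wedge_linear uminus_apply grade_grade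
      by simp
    also have "\<dots> = (alternate F' \<and>\<^sub>p G + grade F \<and>\<^sub>p alternate G') (v # vs)"
      by (simp add: wedge_Cons)
    finally show ?case .
  qed simp
qed

lemma alt_deriv_wedge:
  assumes "alt_deriv F F' x" "alt_deriv G G' x"
  shows "alt_deriv (\<lambda>y. F y \<and>\<^sub>p G y) (\<lambda>h. F' h \<and>\<^sub>p G x + F x \<and>\<^sub>p G' h) x"
  unfolding alt_deriv_def alt_wedge_def plus_fun_apply sum.distrib[symmetric]
proof
  fix vs
  show "((\<lambda>y. \<Sum>J\<in>Pow {..<length vs}. shuffle_sign (length vs) J * F y (nths vs J) * G y (nths vs (- J)))
      has_derivative (\<lambda>h. \<Sum>J\<in>Pow {..<length vs}.
        shuffle_sign (length vs) J * F' h (nths vs J) * G x (nths vs (- J)) +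
        shuffle_sign (length vs) J * F x (nths vs J) * G' h (nths vs (- J)))) (at x)"
  proof (rule has_derivative_sum)
    fix J
    have "((\<lambda>y. F y us) has_derivative (\<lambda>h. F' h us)) (at x)"
      "((\<lambda>y. G y us) has_derivative (\<lambda>h. G' h us)) (at x)" for us
      using assms by (auto simp: alt_deriv_def)
    then show "((\<lambda>y. shuffle_sign (length vs) J * F y (nths vs J) * G y (nths vs (- J)))
        has_derivative (\<lambda>h. shuffle_sign (length vs) J * F' h (nths vs J) * G x (nths vs (- J)) +
        shuffle_sign (length vs) J * F x (nths vs J) * G' h (nths vs (- J)))) (at x)"
      by (auto intro!: derivative_eq_intros simp: fun_eq_iff)
  qed
qed

definition form_diff :: "('i, 'e::real_normed_vector) form \<Rightarrow> 'i \<Rightarrow> 'e \<Rightarrow> bool" where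
  "form_diff \<eta> i x \<longleftrightarrow> (\<forall>vs. (\<lambda>y. \<eta> i y vs) differentiable (at x))"

lemma form_diffE:
  assumes "form_diff \<eta> i x"
  obtains F' where "alt_deriv (\<eta> i) F' x" "ext_d \<eta> i x = alternate F'"
proof -
  let ?F' = "\<lambda>h vs. frechet_derivative (\<lambda>y. \<eta> i y vs) (at x) h"
  have "alt_deriv (\<eta> i) ?F' x"
    using assms by (simp add: form_diff_def alt_deriv_def frechet_derivative_works[symmetric])
  moreover have "ext_d \<eta> i x = alternate ?F'" by (simp add: ext_d_def alternate_def)
  ultimately show ?thesis by (rule that)
qed

lemma ext_d_alt_deriv:
  assumes "alt_deriv (\<eta> i) F' x"
  shows "ext_d \<eta> i x = alternate F'" "form_diff \<eta> i x"
proof -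
  show "form_diff \<eta> i x"
    using assms by (auto simp: alt_deriv_def form_diff_def intro: differentiableI)
  have "frechet_derivative (\<lambda>y. \<eta> i y vs) (at x) = (\<lambda>h. F' h vs)" for vs
    using assms frechet_derivative_at[of "\<lambda>y. \<eta> i y vs" "\<lambda>h. F' h vs" x] by (simp add: alt_deriv_def)
  then show "ext_d \<eta> i x = alternate F'" by (simp add: ext_d_def alternate_def)
qed

lemma alt_deriv_linear:
  assumes "alt_deriv F F' x" "alt_deriv G G' x"
  shows "alt_deriv (\<lambda>y. F y + G y) (\<lambda>h. F' h + G' h) x"
    and "alt_deriv (\<lambda>y. F y - G y) (\<lambda>h. F' h - G' h) x"
    and "alt_deriv (\<lambda>y. - F y) (\<lambda>h. - F' h) x"
    and "alt_deriv (\<lambda>y. c *\<^sub>p F y) (\<lambda>h. c *\<^sub>p F' h) x"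
  using assms
  by (auto simp: alt_deriv_def apply_scale intro!: has_derivative_add has_derivative_diff
      has_derivative_minus has_derivative_mult_right)

lemma form_apply:
  "(\<eta> + \<theta>) i x = \<eta> i x + \<theta> i x" "(\<eta> - \<theta>) i x = \<eta> i x - \<theta> i x" "(- \<eta>) i x = - \<eta> i x"
  "(c *\<^sub>f \<eta>) i x = c *\<^sub>p \<eta> i x" "(\<eta> \<and>\<^sub>f \<theta>) i x = \<eta> i x \<and>\<^sub>p \<theta> i x" "(0 :: ('i, 'e) form) i x = 0"
  for \<eta> \<theta> :: "('i, 'e) form"
  by (simp_all add: form_scale_def scale_def wedge_def)

lemma ext_d_linear:
  assumes "form_diff \<eta> i x"
  shows "ext_d (- \<eta>) i x = - ext_d \<eta> i x" "form_diff (- \<eta>) i x"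
    and "ext_d (c *\<^sub>f \<eta>) i x = c *\<^sub>p ext_d \<eta> i x" "form_diff (c *\<^sub>f \<eta>) i x"
    and "form_diff \<theta> i x \<Longrightarrow> ext_d (\<eta> + \<theta>) i x = ext_d \<eta> i x + ext_d \<theta> i x"
    and "form_diff \<theta> i x \<Longrightarrow> form_diff (\<eta> + \<theta>) i x"
    and "form_diff \<theta> i x \<Longrightarrow> ext_d (\<eta> - \<theta>) i x = ext_d \<eta> i x - ext_d \<theta> i x"
    and "form_diff \<theta> i x \<Longrightarrow> form_diff (\<eta> - \<theta>) i x"
proof -
  obtain F' where F: "alt_deriv (\<eta> i) F' x" "ext_d \<eta> i x = alternate F'"
    using assms by (rule form_diffE)
  have e: "(- \<eta>) i = (\<lambda>y. - \<eta> i y)" "(c *\<^sub>f \<eta>) i = (\<lambda>y. c *\<^sub>p \<eta> i y)"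
    "(\<eta> + \<theta>) i = (\<lambda>y. \<eta> i y + \<theta> i y)" "(\<eta> - \<theta>) i = (\<lambda>y. \<eta> i y - \<theta> i y)"
    by (simp_all add: fun_eq_iff form_scale_def scale_def)
  show "ext_d (- \<eta>) i x = - ext_d \<eta> i x" "form_diff (- \<eta>) i x"
    "ext_d (c *\<^sub>f \<eta>) i x = c *\<^sub>p ext_d \<eta> i x" "form_diff (c *\<^sub>f \<eta>) i x"
    using ext_d_alt_deriv[of "- \<eta>" i "\<lambda>h. - F' h" x] ext_d_alt_deriv[of "c *\<^sub>f \<eta>" i "\<lambda>h. c *\<^sub>p F' h" x]
      alt_deriv_linear[OF F(1) F(1)]
    unfolding e F(2) by (simp_all only: alternate_linear)
  assume "form_diff \<theta> i x"
  then obtain G' where G: "alt_deriv (\<theta> i) G' x" "ext_d \<theta> i x = alternate G'"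
    by (rule form_diffE)
  show "ext_d (\<eta> + \<theta>) i x = ext_d \<eta> i x + ext_d \<theta> i x" "form_diff (\<eta> + \<theta>) i x"
    "ext_d (\<eta> - \<theta>) i x = ext_d \<eta> i x - ext_d \<theta> i x" "form_diff (\<eta> - \<theta>) i x"
    using ext_d_alt_deriv[of "\<eta> + \<theta>" i "\<lambda>h. F' h + G' h" x] ext_d_alt_deriv[of "\<eta> - \<theta>" i "\<lambda>h. F' h - G' h" x]
      alt_deriv_linear[OF F(1) G(1)]
    unfolding e F(2) G(2) by (simp_all only: alternate_linear)
qed

lemma ext_d_wedge:
  assumes "form_diff \<eta> i x" "form_diff \<theta> i x"
  shows "ext_d (\<eta> \<and>\<^sub>f \<theta>) i x = ext_d \<eta> i x \<and>\<^sub>p \<theta> i x + grade (\<eta> i x) \<and>\<^sub>p ext_d \<theta> i x"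
    and "form_diff (\<eta> \<and>\<^sub>f \<theta>) i x"
proof -
  obtain F' where F: "alt_deriv (\<eta> i) F' x" "ext_d \<eta> i x = alternate F'"
    using assms(1) by (rule form_diffE)
  obtain G' where G: "alt_deriv (\<theta> i) G' x" "ext_d \<theta> i x = alternate G'"
    using assms(2) by (rule form_diffE)
  have "(\<eta> \<and>\<^sub>f \<theta>) i = (\<lambda>y. \<eta> i y \<and>\<^sub>p \<theta> i y)" by (simp add: wedge_def)
  then have *: "alt_deriv ((\<eta> \<and>\<^sub>f \<theta>) i) (\<lambda>h. F' h \<and>\<^sub>p \<theta> i x + \<eta> i x \<and>\<^sub>p G' h) x"
    using alt_deriv_wedge[OF F(1) G(1)] by simp
  show "ext_d (\<eta> \<and>\<^sub>f \<theta>) i x = ext_d \<eta> i x \<and>\<^sub>p \<theta> i x + grade (\<eta> i x) \<and>\<^sub>p ext_d \<theta> i x"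
    unfolding ext_d_alt_deriv(1)[of "\<eta> \<and>\<^sub>f \<theta>", OF *] F(2) G(2) by (rule alternate_wedge)
  show "form_diff (\<eta> \<and>\<^sub>f \<theta>) i x" by (rule ext_d_alt_deriv(2)[of "\<eta> \<and>\<^sub>f \<theta>", OF *])
qed

text \<open>Locality. A star is known explicitly only on a coordinate domain or where an adapted
  coframe is defined, and its derivative is computed from the explicit form there.\<close>

lemma ext_d_cong:
  assumes "open S" "x \<in> S" "\<And>y. y \<in> S \<Longrightarrow> \<eta> i y = \<theta> i y"
  shows "ext_d \<eta> i x = ext_d \<theta> i x" "form_diff \<eta> i x \<longleftrightarrow> form_diff \<theta> i x"
proof -
  have *: "((\<lambda>y. \<eta> i y vs) has_derivative D) (at x) \<longleftrightarrow> ((\<lambda>y. \<theta> i y vs) has_derivative D) (at x)" for vs D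
    using has_derivative_transform_within_open[OF _ assms(1,2), of "\<lambda>y. \<eta> i y vs" D UNIV "\<lambda>y. \<theta> i y vs"]
      has_derivative_transform_within_open[OF _ assms(1,2), of "\<lambda>y. \<theta> i y vs" D UNIV "\<lambda>y. \<eta> i y vs"]
      assms(3) by fastforce
  show "ext_d \<eta> i x = ext_d \<theta> i x" "form_diff \<eta> i x \<longleftrightarrow> form_diff \<theta> i x"
    unfolding ext_d_def frechet_derivative_def form_diff_def differentiable_def * by simp_all
qed

section \<open>Pullback to the product and the covector ds\<close>

definition pull_fst :: "'e alt \<Rightarrow> ('e \<times> 'f) alt" where
  "pull_fst a = (\<lambda>vs. a (map fst vs))"

definition covector_snd :: "('e \<times> real) alt" where
  "covector_snd = (\<lambda>vs. case vs of [v] \<Rightarrow> snd v | _ \<Rightarrow> 0)"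

lemma pr_apply: "pr \<eta> (i, j) (x, t) = pull_fst (\<eta> i x)"
  by (simp add: pr_def pull_fst_def)

lemma ds_apply: "ds (i, j) (x, t) = covector_snd"
  by (simp add: ds_def covector_snd_def)

lemma pull_fst_linear:
  "pull_fst (a + b) = pull_fst a + pull_fst b" "pull_fst (a - b) = pull_fst a - pull_fst b"
  "pull_fst (- a) = - pull_fst a" "pull_fst (c *\<^sub>p a) = c *\<^sub>p pull_fst a" "pull_fst 0 = 0"
  "grade (pull_fst a) = pull_fst (grade a)" "contract v (pull_fst a) = pull_fst (contract (fst v) a)"
  by (auto simp: pull_fst_def scale_def grade_def contract_def)

lemma pull_fst_wedge: "pull_fst (a \<and>\<^sub>p b) = pull_fst a \<and>\<^sub>p pull_fst b"
  by (simp add: pull_fst_def alt_wedge_def nths_map fun_eq_iff)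

lemma ext_d_pr:
  fixes \<eta> :: "('i, 'e::real_normed_vector) form" and t :: real
  assumes "form_diff \<eta> i x"
  shows "ext_d (pr \<eta>) (i, j) (x, t) = pull_fst (ext_d \<eta> i x)" "form_diff (pr \<eta>) (i, j) (x, t)"
proof -
  obtain F' where F: "alt_deriv (\<eta> i) F' x" "ext_d \<eta> i x = alternate F'"
    using assms by (rule form_diffE)
  have "alt_deriv (pr \<eta> (i, j)) (\<lambda>h. pull_fst (F' (fst h))) (x, t)"
    unfolding alt_deriv_def
  proof
    fix vs :: "('e \<times> real) list"
    have "((\<lambda>y. \<eta> i y (map fst vs)) has_derivative (\<lambda>h. F' h (map fst vs))) (at (fst (x, t)))"
      using F(1) by (simp add: alt_deriv_def)
    from has_derivative_compose[OF has_derivative_fst[OF has_derivative_ident] this]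
    show "((\<lambda>y. pr \<eta> (i, j) y vs) has_derivative (\<lambda>h. pull_fst (F' (fst h)) vs)) (at (x, t))"
      by (simp add: pr_def pull_fst_def case_prod_unfold)
  qed
  from ext_d_alt_deriv[of "pr \<eta>", OF this]
  show "ext_d (pr \<eta>) (i, j) (x, t) = pull_fst (ext_d \<eta> i x)" "form_diff (pr \<eta>) (i, j) (x, t)"
    unfolding F(2) by (auto simp: alternate_def pull_fst_def fun_eq_iff take_map drop_map intro!: sum.cong)
qed

lemma ext_d_ds: "ext_d ds (i, j) (x, t) = 0" "form_diff ds (i, j) (x, t)"
proof -
  have "alt_deriv (ds (i, j)) (\<lambda>h. 0) (x, t)"
    by (simp add: alt_deriv_def ds_def case_prod_unfold)
  from ext_d_alt_deriv[of ds, OF this]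
  show "ext_d ds (i, j) (x, t) = 0" "form_diff ds (i, j) (x, t)"
    using alternate_linear(5) by (auto simp: zero_fun_def)
qed

lemma fn_apply: "fn M f i x = f (par M i x) *\<^sub>p unit_alt"
  by (simp add: fn_def scale_def unit_alt_def fun_eq_iff)

lemma fn_wedge: "fn M f i x \<and>\<^sub>p a = f (par M i x) *\<^sub>p a"
  by (simp add: fn_apply wedge_linear)

lemma ext_d_of_degree:
  assumes "open S" "x \<in> S" "\<And>y. y \<in> S \<Longrightarrow> of_degree k (\<eta> i y)"
  shows "of_degree (Suc k) (ext_d \<eta> i x)"
  unfolding of_degree_def
proof (intro allI impI)
  fix vs :: "'a list" assume vs: "length vs \<noteq> Suc k"
  have "frechet_derivative (\<lambda>y. \<eta> i y (take m vs @ drop (Suc m) vs)) (at x) = (\<lambda>_. 0)"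
    if "m < length vs" for m
  proof -
    have "((\<lambda>y. 0 :: real) has_derivative (\<lambda>_. 0)) (at x)" by simp
    then have "((\<lambda>y. \<eta> i y (take m vs @ drop (Suc m) vs)) has_derivative (\<lambda>_. 0)) (at x)"
      using assms(3) that vs
      by (elim has_derivative_transform_within_open[OF _ assms(1,2)]) (auto simp: of_degree_def)
    then show ?thesis using frechet_derivative_at by metis
  qed
  then show "ext_d \<eta> i x vs = 0" by (simp add: ext_d_def)
qed

lemma smooth_on_differentiable:
  "smooth_on S f \<Longrightarrow> open S \<Longrightarrow> x \<in> S \<Longrightarrow> f differentiable (at x)"
  unfolding smooth_on_def
  by (metis Ck_on.simps(2) differentiable_on_def at_within_open)

lemma diff_form_form_diff:
  "diff_form M k \<eta> \<Longrightarrow> i \<in> idx M \<Longrightarrow> open (cdom M i) \<Longrightarrow> x \<in> cdom M i \<Longrightarrow> form_diff \<eta> i x"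
  unfolding diff_form_def form_diff_def by (blast intro: smooth_on_differentiable)

lemma fn_form_diff:
  assumes "smooth_fun M f" "i \<in> idx M" "open (cdom M i)" "x \<in> cdom M i"
  shows "form_diff (fn M f) i x"
proof -
  have "(f \<circ> par M i) differentiable (at x)"
    using assms smooth_on_differentiable by (auto simp: smooth_fun_def)
  then show ?thesis unfolding form_diff_def fn_def
    by (intro allI, case_tac "vs = []") (simp_all add: comp_def)
qed

section \<open>The metric and Hodge star of an SU(3)-structure\<close>

definition alt_diff :: "('e::real_normed_vector \<Rightarrow> 'e alt) \<Rightarrow> 'e \<Rightarrow> bool" where
  "alt_diff F x \<longleftrightarrow> (\<forall>vs. (\<lambda>y. F y vs) differentiable (at x))"

lemma form_diff_iff: "form_diff \<eta> i x \<longleftrightarrow> alt_diff (\<eta> i) x"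
  by (simp add: form_diff_def alt_diff_def)

lemma alt_diff_wedge:
  assumes "alt_diff F x" "alt_diff G x"
  shows "alt_diff (\<lambda>y. F y \<and>\<^sub>p G y) x"
  using ext_d_wedge(2)[of "\<lambda>_. F" undefined x "\<lambda>_. G"] assms by (simp add: form_diff_iff wedge_def)

lemma alt_diff_add:
  "alt_diff F x \<Longrightarrow> alt_diff G x \<Longrightarrow> alt_diff (\<lambda>y. F y + G y) x"
  by (simp add: alt_diff_def)

lemma differentiable_prod':
  fixes f :: "'i \<Rightarrow> 'e::real_normed_vector \<Rightarrow> real"
  assumes "\<And>i. i \<in> S \<Longrightarrow> f i differentiable (at x)"
  shows "(\<lambda>y. \<Prod>i\<in>S. f i y) differentiable (at x)"
  using assms
  by (induction S rule: infinite_finite_induct) (auto intro!: differentiable_mult)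

lemma differentiable_det:
  fixes B :: "'e::real_normed_vector \<Rightarrow> real ^ 'n ^ 'n"
  assumes "\<And>i j. (\<lambda>y. B y $ i $ j) differentiable (at x)"
  shows "(\<lambda>y. det (B y)) differentiable (at x)"
  unfolding det_def using assms
  by (intro differentiable_sum ballI differentiable_mult differentiable_const differentiable_prod') auto

lemma vector_expand:
  fixes v :: "real ^ 'n"
  assumes "linear f"
  shows "f v = (\<Sum>r\<in>UNIV. v $ r * f (axis r 1))"
proof -
  have "f v = f (\<Sum>r\<in>UNIV. v $ r *\<^sub>R axis r 1)"
    using basis_expansion[of v] by (simp add: scalar_mult_eq_scaleR)
  also have "\<dots> = (\<Sum>r\<in>UNIV. v $ r * f (axis r 1))"
    using assms by (simp add: linear_sum linear_cmul)
  finally show ?thesis .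
qed

text \<open>By linearity in the first argument, the contraction is a finite sum of products of
  components of \<open>u\<close> with values of \<open>F\<close> on basis vectors. Linearity is used
  at nearby points too, hence the open set \<open>W\<close>.\<close>

lemma alt_diff_contract:
  fixes F :: "real ^ 'n \<Rightarrow> (real ^ 'n) alt"
  assumes W: "open W" "x \<in> W" and F: "\<And>y. y \<in> W \<Longrightarrow> alternating (F y)" "alt_diff F x"
    and u: "\<And>r. (\<lambda>y. u y $ r) differentiable (at x)"
  shows "alt_diff (\<lambda>y. contract (u y) (F y)) x"
  unfolding alt_diff_def
proof
  fix vs
  have "(\<lambda>y. \<Sum>r\<in>UNIV. u y $ r * F y (axis r 1 # vs)) differentiable (at x)"
    using F(2) u by (intro differentiable_sum ballI differentiable_mult) (auto simp: alt_diff_def)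
  then obtain D where "((\<lambda>y. \<Sum>r\<in>UNIV. u y $ r * F y (axis r 1 # vs)) has_derivative D) (at x)"
    by (auto simp: differentiable_def)
  then have "((\<lambda>y. contract (u y) (F y) vs) has_derivative D) (at x)"
  proof (rule has_derivative_transform_within_open[OF _ W])
    fix y assume "y \<in> W"
    then have "linear (\<lambda>v. F y ([] @ v # vs))" using F(1) unfolding alternating_def by blast
    from vector_expand[OF this, of "u y"]
    show "(\<Sum>r\<in>UNIV. u y $ r * F y (axis r 1 # vs)) = contract (u y) (F y) vs"
      by (simp add: contract_def)
  qed
  then show "(\<lambda>y. contract (u y) (F y) vs) differentiable (at x)"
    by (rule differentiableI)
qed

text \<open>The frame moves with the point: \<open>ps\<close> lists vector fields and covector
  fields. The recursion uses only contraction, \<open>grade\<close>, sums and wedge products, which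
  preserve differentiability.\<close>

lemma alt_diff_star_along:
  fixes F :: "real ^ 'n \<Rightarrow> (real ^ 'n) alt"
  assumes W: "open W" "x \<in> W"
    and ps: "\<And>u e r. (u, e) \<in> set ps \<Longrightarrow> (\<lambda>y. u y $ r) differentiable (at x) \<and> alt_diff e x"
    and F: "\<And>y. y \<in> W \<Longrightarrow> alternating (F y)" "alt_diff F x"
  shows "alt_diff (\<lambda>y. star_along (map (\<lambda>(u, e). (u y, e y)) ps) (F y)) x"
  using ps F
proof (induction ps arbitrary: F)
  case Nil
  then show ?case by (auto simp: alt_diff_def apply_scale intro!: differentiable_mult)
next
  case (Cons p ps)
  obtain u e where p: "p = (u, e)" by (cases p)
  have "alt_diff (\<lambda>y. contract (u y) (F y)) x"
    using Cons.prems by (intro alt_diff_contract[OF W]) (auto simp: p)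
  then have 1: "alt_diff (\<lambda>y. star_along (map (\<lambda>(u, e). (u y, e y)) ps) (contract (u y) (F y))) x"
    using Cons.prems by (intro Cons.IH) (auto simp: alternating_contract)
  have "alt_diff (\<lambda>y. grade (F y)) x"
    using Cons.prems by (auto simp: alt_diff_def grade_def intro!: differentiable_mult)
  then have 2: "alt_diff (\<lambda>y. star_along (map (\<lambda>(u, e). (u y, e y)) ps) (grade (F y))) x"
    using Cons.prems by (intro Cons.IH) (auto simp: alternating_linear_space)
  have "alt_diff e x" using Cons.prems by (auto simp: p)
  from alt_diff_add[OF 1 alt_diff_wedge[OF this 2]] show ?case by (simp only: p list.map case_prod_conv along_Cons)
qed

text \<open>Identifies the index type of \<open>real ^ 6\<close> with the labels 1 to 6 of a
  coframe, so that a coframe becomes a square matrix. Any bijection will do.\<close>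

definition index6 :: "6 \<Rightarrow> nat" where
  "index6 = (SOME f. bij_betw f UNIV {1..6})"

lemma index6: "bij_betw index6 UNIV {1..6}"
proof -
  have "\<exists>f::6 \<Rightarrow> nat. bij_betw f UNIV {1..6}"
    by (rule finite_same_card_bij) auto
  then show ?thesis unfolding index6_def by (rule someI_ex)
qed

definition coframe_matrix :: "(nat \<Rightarrow> (real ^ 6) alt) \<Rightarrow> real ^ 6 ^ 6" where
  "coframe_matrix e = (\<chi> i j. e (index6 i) [axis j 1])"

text \<open>The vectors of the dual frame by Cramer's rule, so that they depend differentiably on the coframe.\<close>

definition dual_vector :: "(nat \<Rightarrow> (real ^ 6) alt) \<Rightarrow> nat \<Rightarrow> real ^ 6" where
  "dual_vector e k = (\<chi> r. det (\<chi> i j. if j = r then (if index6 i = k then 1 else 0)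
      else coframe_matrix e $ i $ j) / det (coframe_matrix e))"

lemma coframe_matrix_mult:
  assumes "coframe6 e"
  shows "(coframe_matrix e *v v) $ i = e (index6 i) [v]"
proof -
  have "index6 i \<in> {1..6}" using index6 by (auto simp: bij_betw_def)
  then have "linear (\<lambda>v. e (index6 i) [v])" using assms covector_linear unfolding coframe6_def by blast
  from vector_expand[OF this, of v] show ?thesis
    by (simp add: coframe_matrix_def matrix_vector_mult_def mult.commute)
qed

text \<open>The independence clause of \<open>coframe6\<close> says that the rows of this matrix are
  linearly independent.\<close>

lemma coframe_matrix_det:
  assumes "coframe6 e"
  shows "det (coframe_matrix e) \<noteq> 0"
proof -
  let ?A = "coframe_matrix e"
  have "\<forall>i. c i = 0" if c: "(\<Sum>i\<in>UNIV. c i *s row i ?A) = 0" for c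
  proof -
    let ?c = "\<lambda>k. c (inv_into UNIV index6 k)"
    have inv: "inv_into UNIV index6 (index6 i) = i" for i
      using index6 by (simp add: bij_betw_def)
    have "(\<Sum>k=1..6. ?c k * e k [v]) = 0" for v
    proof -
      have "(\<Sum>k=1..6. ?c k * e k [v]) = (\<Sum>i\<in>UNIV. c i * e (index6 i) [v])"
        using sum.reindex_bij_betw[OF index6, of "\<lambda>k. ?c k * e k [v]"] by (simp add: inv)
      also have "\<dots> = (\<Sum>i\<in>UNIV. \<Sum>j\<in>UNIV. c i * ?A $ i $ j * v $ j)"
        using coframe_matrix_mult[OF assms, of v]
        by (simp add: matrix_vector_mult_def sum_distrib_left mult.assoc[symmetric] flip: coframe_matrix_mult[OF assms])
      also have "\<dots> = (\<Sum>j\<in>UNIV. (\<Sum>i\<in>UNIV. c i *s row i ?A) $ j * v $ j)"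
        by (subst sum.swap) (simp add: row_def sum_distrib_right)
      also have "\<dots> = 0" unfolding c by simp
      finally show ?thesis .
    qed
    then have "\<forall>k\<in>{1..6}. ?c k = 0"
      using assms[unfolded coframe6_def, THEN conjunct2, rule_format, of ?c] by blast
    then show ?thesis using index6 inv by (metis UNIV_I bij_betw_apply)
  qed
  then have "\<exists>B. ?A ** B = mat 1"
    unfolding matrix_right_invertible_independent_rows by blast
  then show ?thesis using invertible_det_nz invertible_right_inverse by blast
qed

lemma dual_vector:
  assumes "coframe6 e" "k \<in> {1..6}" "l \<in> {1..6}"
  shows "e k [dual_vector e l] = (if k = l then 1 else 0)"
proof -
  obtain i where i: "index6 i = k" using bij_betw_imp_surj_on[OF index6] assms(2) by (metis imageE)
  have "coframe_matrix e *v dual_vector e l = (\<chi> i. if index6 i = l then 1 else 0)"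
    unfolding cramer[OF coframe_matrix_det[OF assms(1)]] by (simp add: dual_vector_def cong: if_cong)
  then have "(coframe_matrix e *v dual_vector e l) $ i = (if k = l then 1 else 0)"
    by (simp add: i)
  then show ?thesis using coframe_matrix_mult[OF assms(1)] i by simp
qed

text \<open>The components are quotients of polynomials in the components of the coframe, with a
  denominator that does not vanish at \<open>x\<close>.\<close>

lemma dual_vector_differentiable:
  assumes "coframe6 (\<lambda>k. e k x)" "\<And>k. k \<in> {1..6} \<Longrightarrow> alt_diff (e k) x"
  shows "(\<lambda>y. dual_vector (\<lambda>k. e k y) k $ r) differentiable (at x)"
proof -
  have "index6 i \<in> {1..6}" for i using index6 by (auto simp: bij_betw_def)
  then have 1: "(\<lambda>y. coframe_matrix (\<lambda>k. e k y) $ i $ j) differentiable (at x)" for i j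
    using assms(2) by (simp add: coframe_matrix_def alt_diff_def)
  then show ?thesis
    unfolding dual_vector_def vec_lambda_beta
    using coframe_matrix_det[OF assms(1)]
    by (intro differentiable_divide differentiable_det)
       (case_tac "j = r"; simp)+
qed

lemma coframe6_frame6:
  assumes "coframe6 e"
  shows "frame6 (e 1) (e 2) (e 3) (e 4) (e 5) (e 6) (dual_vector e 1) (dual_vector e 2)
    (dual_vector e 3) (dual_vector e 4) (dual_vector e 5) (dual_vector e 6)"
proof
  have "\<forall>k\<in>{1..6}. alt_form 1 (e k)" using assms by (simp add: coframe6_def)
  then show "dual_pairs [(dual_vector e 1, e 1), (dual_vector e 2, e 2), (dual_vector e 3, e 3),
      (dual_vector e 4, e 4), (dual_vector e 5, e 5), (dual_vector e 6, e 6)]"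
    by (simp add: dual_pairs_Cons dual_vector[OF assms] del: One_nat_def)
qed simp

section \<open>Adapted coframes: evaluation of the metric, the volume form and the star\<close>

locale adapted_frame =
  fixes e :: "nat \<Rightarrow> (real ^ 6) alt" and w p m
  assumes adapted: "adapted e w p m"

sublocale adapted_frame \<subseteq> frame6 "e 1" "e 2" "e 3" "e 4" "e 5" "e 6" "dual_vector e 1" "dual_vector e 2"
    "dual_vector e 3" "dual_vector e 4" "dual_vector e 5" "dual_vector e 6"
  using adapted coframe6_frame6 by (simp add: adapted_def)

context adapted_frame begin

lemma adapted_eq: "w = om" "p = psp" "m = psm"
  using adapted unfolding adapted_def om_def psp_def psm_def by blast+

lemma metric_sum: "coframe_metric frame = (\<lambda>u v. \<Sum>k=1..6. e k [u] * e k [v])"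
proof -
  have "{1..6::nat} = {1, 2, 3, 4, 5, 6}" by auto
  then show ?thesis by (simp add: fun_eq_iff coframe_metric_def frame_def del: One_nat_def)
qed

end

text \<open>The definite description has a value because all coframes adapted at the point induce
  the same metric.\<close>

lemma su3_metric_eq:
  assumes "adapted_frame e (\<omega> i x) (\<psi>p i x) (\<psi>m i x)"
  shows "su3_metric \<omega> \<psi>p \<psi>m i x = coframe_metric (map (\<lambda>k. (dual_vector e k, e k)) [1,2,3,4,5,6])"
proof -
  interpret E: adapted_frame e "\<omega> i x" "\<psi>p i x" "\<psi>m i x" by fact
  have "(THE g. \<forall>e. adapted e (\<omega> i x) (\<psi>p i x) (\<psi>m i x) \<longrightarrow>
     g = (\<lambda>u v. \<Sum>k=1..6. e k [u] * e k [v])) = coframe_metric E.frame"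
  proof (rule the_equality)
    show "\<forall>e. adapted e (\<omega> i x) (\<psi>p i x) (\<psi>m i x) \<longrightarrow>
        coframe_metric E.frame = (\<lambda>u v. \<Sum>k=1..6. e k [u] * e k [v])"
    proof (intro allI impI)
      fix f assume "adapted f (\<omega> i x) (\<psi>p i x) (\<psi>m i x)"
      then interpret F: adapted_frame f "\<omega> i x" "\<psi>p i x" "\<psi>m i x" by unfold_locales
      show "coframe_metric E.frame = (\<lambda>u v. \<Sum>k=1..6. f k [u] * f k [v])"
        unfolding F.metric_sum[symmetric]
        by (intro ext coframe_metric_unique E.frame6_axioms F.frame6_axioms)
           (use E.adapted_eq F.adapted_eq in simp_all)
    qed
    show "g = coframe_metric E.frame" if "\<forall>e. adapted e (\<omega> i x) (\<psi>p i x) (\<psi>m i x) \<longrightarrow>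
        g = (\<lambda>u v. \<Sum>k=1..6. e k [u] * e k [v])" for g
      using that E.adapted E.metric_sum by simp
  qed
  then show ?thesis unfolding su3_metric_def E.frame_def by (simp only: list.map)
qed

context adapted_frame begin

lemma frame_map: "map (\<lambda>k. (dual_vector e k, e k)) [1,2,3,4,5,6] = frame"
  unfolding frame_def by (simp only: list.map)

lemma metric_eq:
  assumes "\<omega> i x = w" "\<psi>p i x = p" "\<psi>m i x = m"
  shows "su3_metric \<omega> \<psi>p \<psi>m i x = coframe_metric frame"
  using su3_metric_eq[of e \<omega> i x \<psi>p \<psi>m] adapted_frame_axioms assms by (simp only: frame_map)

lemma vol_eq:
  assumes "\<omega> i x = w"
  shows "alternating (su3_vol \<omega> i x)" "of_degree 6 (su3_vol \<omega> i x)" "su3_vol \<omega> i x (map fst frame) = 1"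
proof -
  have vol: "su3_vol \<omega> i x = (1 / 6) *\<^sub>p (om \<and>\<^sub>p om \<and>\<^sub>p om)"
    using assms adapted_eq(1) by (simp add: su3_vol_def form_apply fact_numeral)
  have "alt_form (2 + 2 + 2) (om \<and>\<^sub>p om \<and>\<^sub>p om)" by (intro alt_form_wedge alt_forms)
  then show "alternating (su3_vol \<omega> i x)" "of_degree 6 (su3_vol \<omega> i x)"
    unfolding vol by (simp_all add: alt_form_iff alternating_linear_space of_degree_linear)
  show "su3_vol \<omega> i x (map fst frame) = 1"
    unfolding vol apply_scale om_cubed_eval by simp
qed

lemma star_eq:
  assumes "\<omega> i x = w" "\<psi>p i x = p" "\<psi>m i x = m" "alternating (\<eta> i x)"
  shows "su3_star \<omega> \<psi>p \<psi>m \<eta> i x = star_along frame (\<eta> i x)"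
  unfolding su3_star_def hodge_def metric_eq[of \<omega> i x \<psi>p \<psi>m, OF assms(1-3)]
  using frame_dual vol_eq[of \<omega> i x] assms by (intro alt_star_eq) auto

end

text \<open>Near the point there is a smooth adapted coframe, and there the star is the recursion
  along it and its dual frame, both differentiable at \<open>x\<close>. Differentiability at each
  point is enough, since stars are differentiated only once.\<close>

lemma su3_star_form_diff:
  fixes \<omega> \<psi>p \<psi>m :: "('i, real ^ 6) form"
  assumes su3: "su3_structure M \<omega> \<psi>p \<psi>m" and x: "i \<in> idx M" "x \<in> cdom M i"
    and \<eta>: "\<And>y. y \<in> cdom M i \<Longrightarrow> alternating (\<eta> i y)" "form_diff \<eta> i x"
  shows "form_diff (su3_star \<omega> \<psi>p \<psi>m \<eta>) i x"
proof -
  obtain W e where W: "open W" "x \<in> W" "W \<subseteq> cdom M i"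
    and e: "\<forall>k\<in>{1..6}. \<forall>vs. smooth_on W (\<lambda>y. e k y vs)"
    and ad: "\<forall>y\<in>W. adapted (\<lambda>k. e k y) (\<omega> i y) (\<psi>p i y) (\<psi>m i y)"
    using su3 x unfolding su3_structure_def by blast
  have e': "alt_diff (e k) x" if "k \<in> {1..6}" for k
    using e that W unfolding alt_diff_def by (blast intro: smooth_on_differentiable)
  have cf: "coframe6 (\<lambda>k. e k x)" using ad W by (auto simp: adapted_def)
  let ?ps = "map (\<lambda>k. (\<lambda>y. dual_vector (\<lambda>k. e k y) k, e k)) [1,2,3,4,5,6]"
  have "alt_diff (\<lambda>y. star_along (map (\<lambda>(u, e). (u y, e y)) ?ps) (\<eta> i y)) x"
  proof (rule alt_diff_star_along[OF W(1,2)])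
    show "(\<lambda>y. u y $ r) differentiable at x \<and> alt_diff f x" if "(u, f) \<in> set ?ps" for u f r
      using that e' dual_vector_differentiable[of e x, OF cf e'] by auto
  qed (use \<eta> W in \<open>auto simp: form_diff_iff\<close>)
  moreover have "su3_star \<omega> \<psi>p \<psi>m \<eta> i y = star_along (map (\<lambda>(u, e). (u y, e y)) ?ps) (\<eta> i y)"
    if "y \<in> W" for y
  proof -
    interpret adapted_frame "\<lambda>k. e k y" "\<omega> i y" "\<psi>p i y" "\<psi>m i y"
      using ad that by unfold_locales blast
    have "map (\<lambda>(u, e). (u y, e y)) ?ps = frame"
      unfolding frame_def by (simp only: list.map case_prod_conv)
    moreover have "alternating (\<eta> i y)" using \<eta>(1) W(3) that by blast
    ultimately show ?thesis using star_eq[of \<omega> i y \<psi>p \<psi>m \<eta>] by (simp only:)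
  qed
  ultimately have "form_diff (\<lambda>_ y. star_along (map (\<lambda>(u, e). (u y, e y)) ?ps) (\<eta> i y)) i x"
    by (simp add: form_diff_iff)
  then show ?thesis
    by (subst ext_d_cong(2)[OF W(1,2)]) (use \<open>\<And>y. y \<in> W \<Longrightarrow> su3_star \<omega> \<psi>p \<psi>m \<eta> i y = _ y\<close> in auto)
qed

section \<open>The warped product with a line\<close>

lemma covector_wedge_commute:
  assumes "of_degree 1 e"
  shows "e \<and>\<^sub>p a = grade a \<and>\<^sub>p e"
proof
  fix vs show "(e \<and>\<^sub>p a) vs = (grade a \<and>\<^sub>p e) vs"
  proof (induction vs arbitrary: a)
    case Nil
    then show ?case using assms by (simp add: covector_eval)
  next
    case (Cons v vs)
    have "(grade a \<and>\<^sub>p e) (v # vs) = - (grade (contract v a) \<and>\<^sub>p e) vs + e [v] * a vs"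
      using assms by (simp add: wedge_Cons contract_of_degree_1 wedge_linear apply_scale)
    then show ?case using Cons by (simp add: covector_wedge_eval[OF assms])
  qed
qed

lemma star_along_annihilator':
  assumes "of_degree 1 e" "\<forall>w\<in>set (map fst ps). e [w] = 0"
  shows "star_along ps (a \<and>\<^sub>p e) = 0"
  unfolding covector_wedge_commute[OF assms(1), of "grade a", unfolded grade_grade, symmetric]
  by (rule star_along_annihilator[OF assms])

lemma alternating_pull_fst: "alternating a \<Longrightarrow> alternating (pull_fst a :: ('e::real_vector \<times> 'f::real_vector) alt)"
  unfolding alternating_def pull_fst_def
proof (intro conjI allI; elim conjE)
  fix us vs :: "('e \<times> 'f) list"
  assume "\<forall>us vs. linear (\<lambda>v. a (us @ v # vs))"
  then have "linear (\<lambda>v. a (map fst us @ v # map fst vs))" by blast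
  from linear_compose[OF linear_fst this]
  show "linear (\<lambda>v. a (map fst (us @ v # vs)))" by (simp add: comp_def)
qed simp

lemma of_degree_pull_fst: "of_degree k a \<Longrightarrow> of_degree k (pull_fst a)"
  by (simp add: of_degree_def pull_fst_def)

lemma alt_form_covector_snd: "alt_form 1 (covector_snd :: ('e::real_vector \<times> real) alt)"
proof -
  have c: "covector_snd (us @ v # vs) = (if us = [] \<and> vs = [] then snd v else 0)"
    for us vs and v :: "'e \<times> real"
    by (cases us; cases vs) (auto simp: covector_snd_def split: list.split)
  have "alternating (covector_snd :: ('e \<times> real) alt)"
    unfolding alternating_def
  proof (intro conjI allI)
    show "linear (\<lambda>v :: 'e \<times> real. covector_snd (us @ v # vs))" for us vs
      unfolding c by (auto simp: linear_iff)
  qed (simp add: c)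
  then show ?thesis by (auto simp: alt_form_def covector_snd_def split: list.split)
qed

lemma covector_snd_props:
  "of_degree 1 (covector_snd :: ('e::real_vector \<times> real) alt)"
  "alternating (covector_snd :: ('e::real_vector \<times> real) alt)"
  "covector_snd [v] = snd v"
  using alt_form_covector_snd[where 'e = 'e] by (auto simp: alt_form_iff) (simp add: covector_snd_def)

definition lift_frame :: "('e::real_vector \<times> 'e alt) list \<Rightarrow> (('e \<times> real) \<times> ('e \<times> real) alt) list" where
  "lift_frame ps = map (\<lambda>(v, e). ((v, 0), pull_fst e)) ps"

text \<open>The vertical pair stands at the head so that the recursions remove it first. Moving ds
  past an even number of covectors costs no sign, so the frame is positive for
  \<open>warped_vol\<close>, also when \<open>c\<close> is negative.\<close>

definition warped_frame :: "real \<Rightarrow> ('e::real_vector \<times> 'e alt) list \<Rightarrow> (('e \<times> real) \<times> ('e \<times> real) alt) list" where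
  "warped_frame c ps = ((0, 1 / c), c *\<^sub>p covector_snd) # lift_frame ps"

lemma dual_pairs_lift: "dual_pairs ps \<Longrightarrow> dual_pairs (lift_frame ps)"
  unfolding dual_pairs_def lift_frame_def
  by (auto simp: alt_form_iff alternating_pull_fst of_degree_pull_fst case_prod_unfold, auto simp: pull_fst_def)

lemma lift_frame_snd: "w \<in> set (map fst (lift_frame ps)) \<Longrightarrow> snd w = 0"
  by (auto simp: lift_frame_def)

lemma star_along_lift: "star_along (lift_frame ps) (pull_fst a) = pull_fst (star_along ps a)"
proof (induction ps arbitrary: a)
  case Nil
  then show ?case by (simp add: lift_frame_def pull_fst_linear) (simp add: pull_fst_def scale_def unit_alt_def)
next
  case (Cons p ps)
  obtain v e where p: "p = (v, e)" by (cases p)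
  have "lift_frame (p # ps) = ((v, 0), pull_fst e) # lift_frame ps" by (simp add: lift_frame_def p)
  then show ?case
    by (simp only: p along_Cons pull_fst_linear pull_fst_wedge Cons fst_conv)
qed

lemma dual_pairs_warped:
  fixes ps :: "('e::real_vector \<times> 'e alt) list"
  assumes "dual_pairs ps" "c \<noteq> 0"
  shows "dual_pairs (warped_frame c ps)"
proof -
  have "f [(0, 1 / c)] = 0" if f: "f \<in> set (map snd (lift_frame ps))" for f
  proof -
    obtain e where e: "f = pull_fst e" "e \<in> set (map snd ps)"
      using f unfolding lift_frame_def by force
    have "linear (\<lambda>v. e [v])" using dual_pairs_alt_form[OF assms(1) e(2)] covector_linear by blast
    from linear_0[OF this] show ?thesis by (simp add: e(1) pull_fst_def)
  qed
  moreover have "alt_form 1 (c *\<^sub>p covector_snd :: ('e \<times> real) alt)"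
    using covector_snd_props by (auto simp: alt_form_iff intro: alternating_linear_space of_degree_linear)
  moreover have "\<forall>w\<in>set (map fst (lift_frame ps)). (c *\<^sub>p covector_snd) [w] = 0"
    unfolding apply_scale covector_snd_props using lift_frame_snd[of _ ps] by simp
  ultimately show ?thesis
    unfolding warped_frame_def dual_pairs_Cons
    using dual_pairs_lift[OF assms(1)] assms(2)
    by (simp add: apply_scale covector_snd_props)
qed

lemma coframe_metric_warped:
  "coframe_metric (warped_frame c ps) (u, a) (v, b) = coframe_metric ps u v + c\<^sup>2 * a * b"
  by (simp add: coframe_metric_def warped_frame_def lift_frame_def comp_def case_prod_unfold
      apply_scale covector_snd_props) (simp add: pull_fst_def power2_eq_square)

lemma wedge_covector_snd_warped:
  assumes "alternating a" "c \<noteq> 0"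
  shows "contract (0, 1 / c) (pull_fst a) = 0"
    and "contract (0, 1 / c) (pull_fst a \<and>\<^sub>p covector_snd) = (1 / c) *\<^sub>p pull_fst (grade a)"
proof -
  show 1: "contract (0, 1 / c) (pull_fst a) = 0"
    by (simp add: pull_fst_linear contract_add_scale[OF assms(1)])
  show "contract (0, 1 / c) (pull_fst a \<and>\<^sub>p covector_snd) = (1 / c) *\<^sub>p pull_fst (grade a)"
    unfolding contract_wedge 1
    by (simp add: contract_of_degree_1[OF covector_snd_props(1)] covector_snd_props wedge_linear pull_fst_linear)
qed

text \<open>Removing the vertical pair gives two terms. Contraction with \<open>(0, 1 / c)\<close>
  strips \<open>covector_snd\<close> from the first summand, leaving the factor 1 / c and the sign
  in \<open>grade a\<close>. In the second, c ds is multiplied to the star on the base; the signs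
  from passing it to the right cancel since the base has even dimension.\<close>

lemma star_along_warped:
  fixes ps :: "('e::real_vector \<times> 'e alt) list"
  assumes "alternating a" "alternating b" "c \<noteq> 0" "\<forall>e\<in>set (map snd ps). of_degree 1 e"
    and "even (length ps)"
  shows "star_along (warped_frame c ps) (pull_fst a \<and>\<^sub>p covector_snd + pull_fst b) =
    (1 / c) *\<^sub>p pull_fst (star_along ps (grade a)) + pull_fst (c *\<^sub>p star_along ps b) \<and>\<^sub>p covector_snd"
proof -
  note d = covector_snd_props(1)[where 'e = 'e]
  have 0: "star_along (lift_frame ps) (x \<and>\<^sub>p covector_snd) = 0" for x
    using lift_frame_snd[of _ ps] by (intro star_along_annihilator'[OF d]) (simp add: covector_snd_props)
  have g: "grade covector_snd = - (covector_snd :: ('e \<times> real) alt)"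
    by (rule covector_eval(3)[OF d])
  have a: "star_along (warped_frame c ps) (pull_fst a \<and>\<^sub>p covector_snd) =
      (1 / c) *\<^sub>p pull_fst (star_along ps (grade a))"
    unfolding warped_frame_def along_Cons wedge_covector_snd_warped[OF assms(1,3)] grade_wedge g
      wedge_minus_right star_along_linear 0 star_along_lift by simp
  have "covector_snd \<and>\<^sub>p pull_fst (star_along ps (grade b)) = pull_fst (star_along ps b) \<and>\<^sub>p covector_snd"
    unfolding covector_wedge_commute[OF d] pull_fst_linear star_along_grade[OF assms(4)]
    using assms(5) by (simp add: pull_fst_linear)
  then have b: "star_along (warped_frame c ps) (pull_fst b) = pull_fst (c *\<^sub>p star_along ps b) \<and>\<^sub>p covector_snd"
    unfolding warped_frame_def along_Cons wedge_covector_snd_warped[OF assms(2,3)]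
      star_along_linear pull_fst_linear(4-6) star_along_lift wedge_scale_left by simp
  show ?thesis unfolding star_along_linear a b ..
qed

lemma warped_vol_frame:
  assumes vol: "alternating vol" "vol (map fst ps) = 1" and c: "c \<noteq> 0" and k: "even (length ps)"
  shows "(pull_fst (c *\<^sub>p vol) \<and>\<^sub>p covector_snd) (map fst (warped_frame c ps)) = 1"
proof -
  have "(pull_fst (c *\<^sub>p vol) \<and>\<^sub>p covector_snd) (map fst (warped_frame c ps)) =
      contract (0, 1 / c) (pull_fst (c *\<^sub>p vol) \<and>\<^sub>p covector_snd) (map fst (lift_frame ps))"
    by (simp add: warped_frame_def contract_def)
  also have "\<dots> = 1"
    using vol(2) k c
    by (subst wedge_covector_snd_warped)
       (simp_all add: c vol alternating_linear_space apply_scale pull_fst_linear lift_frame_def,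
        simp add: pull_fst_def comp_def case_prod_unfold grade_def vol)
  finally show ?thesis .
qed

text \<open>On horizontal vectors the part with ds vanishes, which leaves \<open>a\<close>.
  Contraction with the vertical vector kills the part without ds and leaves \<open>b\<close> up to
  sign.\<close>

lemma pull_fst_eq_0:
  fixes a b :: "'e::real_vector alt"
  assumes "pull_fst a + pull_fst b \<and>\<^sub>p covector_snd = 0" and "alternating a" "alternating b"
  shows "a = 0" "b = 0"
proof -
  note d = covector_snd_props(1)[where 'e = 'e]
  have z: "(pull_fst a + pull_fst b \<and>\<^sub>p covector_snd) ws = 0" for ws :: "('e \<times> real) list"
    using assms(1) by simp
  have "(pull_fst b \<and>\<^sub>p covector_snd) (map (\<lambda>v. (v, 0)) vs :: ('e \<times> real) list) = 0" for vs
    using wedge_annihilator[OF d, of "map (\<lambda>v. (v, 0)) vs" "pull_fst b" unit_alt]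
    by (simp add: covector_snd_props)
  then have "a vs = 0" for vs
    using z[of "map (\<lambda>v. (v, 0)) vs"] by (simp add: pull_fst_def comp_def)
  then show a: "a = 0" by (simp add: fun_eq_iff)
  have "grade b vs = 0" for vs
  proof -
    have "contract (0, 1 / 1) (pull_fst a + pull_fst b \<and>\<^sub>p covector_snd) (map (\<lambda>v. (v, 0)) vs) = 0"
      using z by (simp add: contract_def)
    then show ?thesis
      unfolding contract_linear wedge_covector_snd_warped[OF assms(2) one_neq_zero]
        wedge_covector_snd_warped[OF assms(3) one_neq_zero]
      by (simp add: pull_fst_def comp_def)
  qed
  then show "b = 0" by (auto simp: fun_eq_iff grade_def)
qed

text \<open>Its facts about the star at one point no longer mention an adapted coframe; each proof
  chooses one and computes in it.\<close>

locale su3_point =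
  fixes \<omega> \<psi>p \<psi>m :: "('i, real ^ 6) form" and i :: 'i and x :: "real ^ 6"
  assumes ex_adapted: "\<exists>e. adapted e (\<omega> i x) (\<psi>p i x) (\<psi>m i x)"
begin

abbreviation "star \<equiv> alt_star (su3_metric \<omega> \<psi>p \<psi>m i x) (su3_vol \<omega> i x)"

lemma ex_frame:
  obtains e where "adapted_frame e (\<omega> i x) (\<psi>p i x) (\<psi>m i x)"
    "\<And>a. alternating a \<Longrightarrow> star a = star_along (frame6.frame (e 1) (e 2) (e 3) (e 4) (e 5) (e 6)
      (dual_vector e 1) (dual_vector e 2) (dual_vector e 3) (dual_vector e 4) (dual_vector e 5) (dual_vector e 6)) a"
proof -
  obtain e where e: "adapted e (\<omega> i x) (\<psi>p i x) (\<psi>m i x)" using ex_adapted by blast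
  then interpret adapted_frame e "\<omega> i x" "\<psi>p i x" "\<psi>m i x" by unfold_locales
  show ?thesis
    using star_eq[of \<omega> i x \<psi>p \<psi>m "\<lambda>_ _. _"] e
    by (intro that adapted_frame.intro) (auto simp only: su3_star_def hodge_def)
qed

lemma star_alternating: "alternating a \<Longrightarrow> alternating (star a)"
proof (rule ex_frame)
  fix e assume a: "alternating a" and e: "adapted_frame e (\<omega> i x) (\<psi>p i x) (\<psi>m i x)"
    and s: "\<And>a. alternating a \<Longrightarrow> star a = star_along (frame6.frame (e 1) (e 2) (e 3) (e 4) (e 5) (e 6)
      (dual_vector e 1) (dual_vector e 2) (dual_vector e 3) (dual_vector e 4) (dual_vector e 5) (dual_vector e 6)) a"
  interpret adapted_frame e "\<omega> i x" "\<psi>p i x" "\<psi>m i x" by fact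
  show ?thesis unfolding s[OF a]
    using dual_pairs_alt_form[OF frame_dual(1)] by (intro alternating_star_along) (simp only: alt_form_iff, blast)
qed

lemma star_linear:
  assumes "alternating a"
  shows "alternating b \<Longrightarrow> star (a + b) = star a + star b"
    "alternating b \<Longrightarrow> star (a - b) = star a - star b"
    "star (- a) = - star a" "star (c *\<^sub>p a) = c *\<^sub>p star a"
    "star (grade a) = grade (star a)"
proof -
  obtain e where e: "adapted_frame e (\<omega> i x) (\<psi>p i x) (\<psi>m i x)"
    and s: "\<And>a. alternating a \<Longrightarrow> star a = star_along (frame6.frame (e 1) (e 2) (e 3) (e 4) (e 5) (e 6)
      (dual_vector e 1) (dual_vector e 2) (dual_vector e 3) (dual_vector e 4) (dual_vector e 5) (dual_vector e 6)) a"
    using ex_frame by blast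
  interpret adapted_frame e "\<omega> i x" "\<psi>p i x" "\<psi>m i x" by fact
  have "star_along frame (grade a) = (-1) ^ length frame *\<^sub>p grade (star_along frame a)"
    using dual_pairs_alt_form[OF frame_dual(1)] by (intro star_along_grade) (simp only: alt_form_iff, blast)
  moreover have "even (length frame)" unfolding frame_def by simp
  ultimately show "star (grade a) = grade (star a)"
    using assms s alternating_linear_space(5)[OF assms] by simp
  show "alternating b \<Longrightarrow> star (a + b) = star a + star b"
    "alternating b \<Longrightarrow> star (a - b) = star a - star b"
    "star (- a) = - star a" "star (c *\<^sub>p a) = c *\<^sub>p star a"
    using s[OF assms] s[OF alternating_linear_space(1)[OF assms]] s[OF alternating_linear_space(2)[OF assms]]
      s[OF alternating_linear_space(3)[OF assms]] s[OF alternating_linear_space(4)[OF assms]] s[of b]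
    by (simp_all only: star_along_linear)
qed

lemma forms: "alt_form 2 (\<omega> i x)" "alt_form 3 (\<psi>p i x)" "alt_form 3 (\<psi>m i x)"
  and omega_psi: "\<omega> i x \<and>\<^sub>p \<psi>p i x = 0" "\<omega> i x \<and>\<^sub>p \<psi>m i x = 0"
proof -
  obtain e where e: "adapted e (\<omega> i x) (\<psi>p i x) (\<psi>m i x)" using ex_adapted by blast
  then interpret adapted_frame e "\<omega> i x" "\<psi>p i x" "\<psi>m i x" by unfold_locales
  show "alt_form 2 (\<omega> i x)" "alt_form 3 (\<psi>p i x)" "alt_form 3 (\<psi>m i x)"
    "\<omega> i x \<and>\<^sub>p \<psi>p i x = 0" "\<omega> i x \<and>\<^sub>p \<psi>m i x = 0"
    unfolding adapted_eq by (fact alt_forms om_psi)+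
qed

lemma star_special:
  shows "star (\<omega> i x) = (1 / 2) *\<^sub>p (\<omega> i x \<and>\<^sub>p \<omega> i x)"
    "star (\<omega> i x \<and>\<^sub>p \<omega> i x) = 2 *\<^sub>p \<omega> i x"
    "star (\<psi>p i x) = \<psi>m i x" "star (\<psi>m i x) = - \<psi>p i x"
    "alt_form 2 t \<Longrightarrow> star (star t) = t"
proof -
  obtain e where e: "adapted_frame e (\<omega> i x) (\<psi>p i x) (\<psi>m i x)"
    and s: "\<And>a. alternating a \<Longrightarrow> star a = star_along (frame6.frame (e 1) (e 2) (e 3) (e 4) (e 5) (e 6)
      (dual_vector e 1) (dual_vector e 2) (dual_vector e 3) (dual_vector e 4) (dual_vector e 5) (dual_vector e 6)) a"
    using ex_frame by blast
  interpret adapted_frame e "\<omega> i x" "\<psi>p i x" "\<psi>m i x" by fact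
  have alt: "alternating (\<omega> i x)" "alternating (\<psi>p i x)" "alternating (\<psi>m i x)"
    using forms by (auto simp: alt_form_iff)
  show "star (\<omega> i x) = (1 / 2) *\<^sub>p (\<omega> i x \<and>\<^sub>p \<omega> i x)"
    unfolding s[OF alt(1)] unfolding adapted_eq(1) by (fact star_om)
  show "star (\<omega> i x \<and>\<^sub>p \<omega> i x) = 2 *\<^sub>p \<omega> i x"
    unfolding s[OF alternating_wedge[OF alt(1) alt(1)]] unfolding adapted_eq(1) by (fact star_om_om)
  show "star (\<psi>p i x) = \<psi>m i x" "star (\<psi>m i x) = - \<psi>p i x"
    unfolding s[OF alt(2)] s[OF alt(3)] unfolding adapted_eq by (fact star_psi)+
  assume t: "alt_form 2 t"
  then have "alternating t" by (simp add: alt_form_iff)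
  with s star_alternating have "star (star t) = star_along frame (star_along frame t)" by metis
  also have "\<dots> = t"
    using star_along_star_along[OF frame_dual(1), of t] expand_along_eq[OF frame_dual, of t] t
      grade_of_degree[of 2 t] dim frame_dual(2) by (simp add: alt_form_iff)
  finally show "star (star t) = t" .
qed

lemma lefschetz:
  assumes "alt_form 1 a" "\<omega> i x \<and>\<^sub>p (a \<and>\<^sub>p \<omega> i x) = 0"
  shows "a = 0"
proof -
  obtain e where e: "adapted e (\<omega> i x) (\<psi>p i x) (\<psi>m i x)" using ex_adapted by blast
  then interpret adapted_frame e "\<omega> i x" "\<psi>p i x" "\<psi>m i x" by unfold_locales
  show ?thesis using lefschetz_covector[OF assms(1)] assms(2) adapted_eq(1) by metis
qed

lemma decomposition:
  assumes "c\<^sup>2 + d\<^sup>2 = 1" "alt_form 1 a" "alt_form 2 t" "star t = - (t \<and>\<^sub>p \<omega> i x)"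
    and 0: "k *\<^sub>p (\<omega> i x \<and>\<^sub>p \<omega> i x) + a \<and>\<^sub>p (c *\<^sub>p \<psi>m i x + d *\<^sub>p \<psi>p i x) - t \<and>\<^sub>p \<omega> i x = 0"
  shows "k = 0" "a = 0" "t = 0"
proof -
  obtain e where e: "adapted_frame e (\<omega> i x) (\<psi>p i x) (\<psi>m i x)"
    and s: "\<And>a. alternating a \<Longrightarrow> star a = star_along (frame6.frame (e 1) (e 2) (e 3) (e 4) (e 5) (e 6)
      (dual_vector e 1) (dual_vector e 2) (dual_vector e 3) (dual_vector e 4) (dual_vector e 5) (dual_vector e 6)) a"
    using ex_frame by blast
  interpret adapted_frame e "\<omega> i x" "\<psi>p i x" "\<psi>m i x" by fact
  have "alternating t" using assms(3) by (simp add: alt_form_iff)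
  then have "star_along frame t = - (t \<and>\<^sub>p om)" using s assms(4) adapted_eq(1) by metis
  moreover have "k *\<^sub>p (om \<and>\<^sub>p om) + a \<and>\<^sub>p (c *\<^sub>p psm + d *\<^sub>p psp) - t \<and>\<^sub>p om = 0"
    using 0 unfolding adapted_eq .
  ultimately show "k = 0" "a = 0" "t = 0"
    using four_form_decomposition[OF assms(1-3)] by blast+
qed

text \<open>At the point, the warped metric is that of \<open>warped_frame\<close>, on which the
  warped volume form takes the value 1, so the star is the recursion along this frame.\<close>

lemma warped_star:
  fixes M :: "('a, 'i, real ^ 6) mfd"
  assumes \<eta>: "\<eta> (i, j) (x, t) = pull_fst a \<and>\<^sub>p covector_snd + pull_fst b"
    and ab: "alternating a" "alternating b" and f: "f (par M i x) \<noteq> 0"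
  shows "hodge (warped_metric M f (su3_metric \<omega> \<psi>p \<psi>m)) (warped_vol M f (su3_vol \<omega>)) \<eta> (i, j) (x, t) =
    (1 / f (par M i x)) *\<^sub>p pull_fst (star (grade a)) + pull_fst (f (par M i x) *\<^sub>p star b) \<and>\<^sub>p covector_snd"
proof -
  obtain e where e: "adapted_frame e (\<omega> i x) (\<psi>p i x) (\<psi>m i x)"
    and s: "\<And>a. alternating a \<Longrightarrow> star a = star_along (frame6.frame (e 1) (e 2) (e 3) (e 4) (e 5) (e 6)
      (dual_vector e 1) (dual_vector e 2) (dual_vector e 3) (dual_vector e 4) (dual_vector e 5) (dual_vector e 6)) a"
    using ex_frame by blast
  interpret adapted_frame e "\<omega> i x" "\<psi>p i x" "\<psi>m i x" by fact
  let ?c = "f (par M i x)" and ?vol = "su3_vol \<omega> i x"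
  have g: "warped_metric M f (su3_metric \<omega> \<psi>p \<psi>m) (i, j) (x, t) = coframe_metric (warped_frame ?c frame)"
    using metric_eq[of \<omega> i x \<psi>p \<psi>m]
    by (auto simp: fun_eq_iff warped_metric_def coframe_metric_warped)
  have v: "warped_vol M f (su3_vol \<omega>) (i, j) (x, t) = pull_fst (?c *\<^sub>p ?vol) \<and>\<^sub>p covector_snd"
    by (simp add: warped_vol_def form_apply(5) pr_apply ds_apply fn_wedge)
  have vol: "alternating ?vol" "?vol (map fst frame) = 1"
    using vol_eq[of \<omega> i x] by blast+
  have len: "even (length frame)" unfolding frame_def by simp
  have deg1: "\<forall>e\<in>set (map snd frame). of_degree 1 e"
    using dual_pairs_alt_form[OF frame_dual(1)] by (simp only: alt_form_iff) blast
  have "hodge (warped_metric M f (su3_metric \<omega> \<psi>p \<psi>m)) (warped_vol M f (su3_vol \<omega>)) \<eta> (i, j) (x, t) =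
      star_along (warped_frame ?c frame) (pull_fst a \<and>\<^sub>p covector_snd + pull_fst b)"
    unfolding hodge_def g v \<eta>
  proof (rule alt_star_eq)
    show "dual_pairs (warped_frame ?c frame)" by (rule dual_pairs_warped[OF frame_dual(1) f])
    show "length (warped_frame ?c frame) = DIM((real ^ 6) \<times> real)"
      using frame_dual(2) by (simp add: warped_frame_def lift_frame_def)
    show "(pull_fst (?c *\<^sub>p ?vol) \<and>\<^sub>p covector_snd) (map fst (warped_frame ?c frame)) = 1"
      by (rule warped_vol_frame[OF vol f len])
  qed (use ab vol in \<open>simp_all add: alternating_wedge alternating_pull_fst alternating_linear_space covector_snd_props\<close>)
  then show ?thesis
    unfolding star_along_warped[OF ab f deg1 len] s[OF ab(2)] s[OF alternating_linear_space(5)[OF ab(1)]] .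
qed

end

section \<open>Warped products with a coclosed structure\<close>

text \<open>A derivative is linear in its single argument. The lemma lets df + f pi1 enter the
  decomposition of 4-forms as a 1-form.\<close>

lemma alt_form_ext_d_fn:
  fixes M :: "('a, 'i, 'e::euclidean_space) mfd"
  assumes "form_diff (fn M f) i x"
  shows "alt_form 1 (ext_d (fn M f) i x)"
proof -
  obtain F' where F: "alt_deriv (fn M f i) F' x" "ext_d (fn M f) i x = alternate F'"
    using assms by (rule form_diffE)
  have lin: "linear (\<lambda>h. F' h [])"
    using F(1) unfolding alt_deriv_def by (blast intro: has_derivative_linear)
  have deg: "of_degree (Suc 0) (ext_d (fn M f) i x)"
    by (rule ext_d_of_degree[of UNIV]) (auto simp: of_degree_def fn_def)
  have app: "ext_d (fn M f) i x (us @ v # vs) = (if us = [] \<and> vs = [] then F' v [] else 0)" for us v vs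
  proof (cases "us = [] \<and> vs = []")
    case True
    then show ?thesis by (simp add: F(2) alternate_def)
  next
    case False
    then have "length (us @ v # vs) \<noteq> Suc 0" by auto
    then show ?thesis using False deg unfolding of_degree_def by auto
  qed
  have "alternating (ext_d (fn M f) i x)"
    unfolding alternating_def app using lin by (auto simp: linear_iff)
  then show ?thesis using deg by (simp add: alt_form_iff)
qed

lemma ext_d_zero: "ext_d 0 i x = 0"
  by (auto simp: ext_d_def fun_eq_iff frechet_derivative_const)

locale warped_su3 =
  fixes M :: "('a, 'i, real ^ 6) mfd"
    and \<omega> \<psi>p \<psi>m \<pi>1 \<nu>1 \<pi>2 \<sigma>2 \<nu>3 :: "('i, real ^ 6) form"
    and \<sigma>0 \<pi>0 f :: "'a \<Rightarrow> real"
    and \<alpha> \<beta> :: real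
  assumes M: "smooth_manifold M"
    and su3: "su3_structure M \<omega> \<psi>p \<psi>m"
    and torsion: "su3_torsion M \<omega> \<psi>p \<psi>m \<sigma>0 \<pi>0 \<pi>1 \<nu>1 \<pi>2 \<sigma>2 \<nu>3"
    and f: "smooth_fun M f" "\<forall>p\<in>topspace (mtop M). f p \<noteq> 0"
    and ab: "\<alpha>\<^sup>2 + \<beta>\<^sup>2 = 1"
    and coclosed: "form_eq (M \<times>\<^sub>m circle)
      (ext_d (hodge (warped_metric M f (su3_metric \<omega> \<psi>p \<psi>m)) (warped_vol M f (su3_vol \<omega>))
         (warped_phi M f \<alpha> \<beta> \<omega> \<psi>p \<psi>m))) 0"
begin

abbreviation "star6 \<equiv> su3_star \<omega> \<psi>p \<psi>m"
abbreviation "star7 \<equiv> hodge (warped_metric M f (su3_metric \<omega> \<psi>p \<psi>m)) (warped_vol M f (su3_vol \<omega>))"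
abbreviation "\<phi> \<equiv> warped_phi M f \<alpha> \<beta> \<omega> \<psi>p \<psi>m"
abbreviation "\<tau>0 \<equiv> fn M (\<lambda>p. \<alpha> * \<pi>0 p - \<beta> * \<sigma>0 p)"
abbreviation "\<tau>2 \<equiv> \<alpha> *\<^sub>f \<pi>2 - \<beta> *\<^sub>f \<sigma>2"
abbreviation "\<rho> \<equiv> \<alpha> *\<^sub>f \<psi>p - \<beta> *\<^sub>f \<psi>m"
text \<open>The star of \<open>\<rho>\<close> on the base; its own star is
  \<open>- \<rho>\<close>.\<close>

abbreviation "\<rho>' \<equiv> \<alpha> *\<^sub>f \<psi>m + \<beta> *\<^sub>f \<psi>p"

section \<open>Pointwise data in a coordinate domain\<close>

lemma chart:
  assumes "i \<in> idx M"
  shows "open (cdom M i)" "x \<in> cdom M i \<Longrightarrow> par M i x \<in> topspace (mtop M)"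
  using M assms unfolding smooth_manifold_def by auto

lemma chart7_iff:
  "(i, j) \<in> idx (M \<times>\<^sub>m circle) \<longleftrightarrow> i \<in> idx M"
  "(x, t) \<in> cdom (M \<times>\<^sub>m circle) (i, j) \<longleftrightarrow> x \<in> cdom M i \<and> t \<in> {j<..<j + 2 * pi}"
  by (auto simp: prod_mfd_def circle_def)

lemma point: "i \<in> idx M \<Longrightarrow> x \<in> cdom M i \<Longrightarrow> su3_point \<omega> \<psi>p \<psi>m i x"
  using su3 unfolding su3_structure_def su3_point_def by blast

lemma f_nonzero: "i \<in> idx M \<Longrightarrow> x \<in> cdom M i \<Longrightarrow> f (par M i x) \<noteq> 0"
  using f chart by blast

lemma diff_forms:
  "diff_form M 2 \<omega>" "diff_form M 3 \<psi>p" "diff_form M 3 \<psi>m" "diff_form M 1 \<pi>1" "diff_form M 1 \<nu>1"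
  "diff_form M 2 \<pi>2" "diff_form M 2 \<sigma>2" "diff_form M 3 \<nu>3"
  using su3 torsion unfolding su3_structure_def su3_torsion_def Omega2_8_def Omega3_12_def by auto

lemma
  assumes "i \<in> idx M" "x \<in> cdom M i"
  shows alt_forms: "alt_form 2 (\<omega> i x)" "alt_form 3 (\<psi>p i x)" "alt_form 3 (\<psi>m i x)" "alt_form 1 (\<pi>1 i x)"
    "alt_form 1 (\<nu>1 i x)" "alt_form 2 (\<pi>2 i x)" "alt_form 2 (\<sigma>2 i x)" "alt_form 3 (\<nu>3 i x)"
    and form_diffs: "form_diff \<omega> i x" "form_diff \<psi>p i x" "form_diff \<psi>m i x" "form_diff \<pi>1 i x"
    "form_diff \<nu>1 i x" "form_diff \<pi>2 i x" "form_diff \<sigma>2 i x" "form_diff \<nu>3 i x"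
  using diff_forms diff_form_form_diff[OF _ assms(1) chart(1)[OF assms(1)] assms(2)] assms
  by (auto simp: diff_form_def)

lemma fn_diffs:
  assumes "i \<in> idx M" "x \<in> cdom M i"
  shows "form_diff (fn M f) i x" "form_diff \<tau>0 i x"
proof -
  have "form_diff (fn M \<sigma>0) i x" "form_diff (fn M \<pi>0) i x"
    using torsion fn_form_diff[OF _ assms(1) chart(1)[OF assms(1)] assms(2)]
    unfolding su3_torsion_def by blast+
  then have "form_diff (\<alpha> *\<^sub>f fn M \<pi>0 - \<beta> *\<^sub>f fn M \<sigma>0) i x"
    by (simp add: ext_d_linear)
  moreover have "\<alpha> *\<^sub>f fn M \<pi>0 - \<beta> *\<^sub>f fn M \<sigma>0 = \<tau>0"
    by (auto simp: fun_eq_iff fn_def form_scale_def)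
  ultimately show "form_diff \<tau>0 i x" by simp
  show "form_diff (fn M f) i x" by (rule fn_form_diff[OF f(1) assms(1) chart(1)[OF assms(1)] assms(2)])
qed

lemma star6_apply: "star6 \<eta> i x = alt_star (su3_metric \<omega> \<psi>p \<psi>m i x) (su3_vol \<omega> i x) (\<eta> i x)"
  by (simp add: su3_star_def hodge_def)

lemma torsion_at:
  assumes "i \<in> idx M" "x \<in> cdom M i"
  shows "ext_d \<omega> i x = - ((3/2 * \<sigma>0 (par M i x)) *\<^sub>p \<psi>p i x) + (3/2 * \<pi>0 (par M i x)) *\<^sub>p \<psi>m i x
      + \<nu>1 i x \<and>\<^sub>p \<omega> i x + \<nu>3 i x"
    and "ext_d \<psi>p i x = \<pi>0 (par M i x) *\<^sub>p (\<omega> i x \<and>\<^sub>p \<omega> i x) + \<pi>1 i x \<and>\<^sub>p \<psi>p i x - \<pi>2 i x \<and>\<^sub>p \<omega> i x"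
    and "ext_d \<psi>m i x = \<sigma>0 (par M i x) *\<^sub>p (\<omega> i x \<and>\<^sub>p \<omega> i x) + \<pi>1 i x \<and>\<^sub>p \<psi>m i x - \<sigma>2 i x \<and>\<^sub>p \<omega> i x"
    and "star6 \<pi>2 i x = - (\<pi>2 i x \<and>\<^sub>p \<omega> i x)" "star6 \<sigma>2 i x = - (\<sigma>2 i x \<and>\<^sub>p \<omega> i x)"
    and "\<nu>3 i x \<and>\<^sub>p \<omega> i x = 0"
  using torsion assms unfolding su3_torsion_def Omega2_8_def Omega3_12_def form_eq_def
  by (simp_all add: form_apply fn_wedge)

lemma alternatings:
  assumes "i \<in> idx M" "x \<in> cdom M i"
  shows "alternating (\<omega> i x)" "alternating (\<psi>p i x)" "alternating (\<psi>m i x)" "alternating (\<pi>1 i x)"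
    "alternating (\<nu>1 i x)" "alternating (\<pi>2 i x)" "alternating (\<sigma>2 i x)" "alternating (\<nu>3 i x)"
    "alternating (ext_d (fn M f) i x)"
    "alternating (ext_d \<omega> i x)" "alternating (ext_d \<psi>p i x)" "alternating (ext_d \<psi>m i x)"
proof -
  show *: "alternating (\<omega> i x)" "alternating (\<psi>p i x)" "alternating (\<psi>m i x)" "alternating (\<pi>1 i x)"
    "alternating (\<nu>1 i x)" "alternating (\<pi>2 i x)" "alternating (\<sigma>2 i x)" "alternating (\<nu>3 i x)"
    using alt_forms[OF assms] by (simp_all add: alt_form_iff)
  show "alternating (ext_d (fn M f) i x)"
    using alt_form_ext_d_fn[OF fn_diffs(1)[OF assms]] by (simp add: alt_form_iff)
  \<comment> \<open>Alternation is read off the right-hand sides of the torsion equations.\<close>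
  show "alternating (ext_d \<omega> i x)" "alternating (ext_d \<psi>p i x)" "alternating (ext_d \<psi>m i x)"
    unfolding torsion_at[OF assms]
    by (simp_all add: * alternating_wedge alternating_linear_space)
qed

lemma star_phi:
  assumes "i \<in> idx M" "x \<in> cdom M i"
  shows "star7 \<phi> (i, j) (x, t) = (pr ((1/2) *\<^sub>f (\<omega> \<and>\<^sub>f \<omega>)) + pr (fn M f \<and>\<^sub>f \<rho>') \<and>\<^sub>f ds) (i, j) (x, t)"
    and "star7 (star7 \<phi>) (i, j) (x, t) = \<phi> (i, j) (x, t)"
proof -
  interpret P: su3_point \<omega> \<psi>p \<psi>m i x by (rule point[OF assms])
  let ?c = "f (par M i x)"
  note alt = alternatings[OF assms] alternating_wedge alternating_linear_space
  have nz: "?c \<noteq> 0" by (rule f_nonzero[OF assms])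
  have phi: "\<phi> (i, j) (x, t) = pull_fst (?c *\<^sub>p \<omega> i x) \<and>\<^sub>p covector_snd + pull_fst (\<alpha> *\<^sub>p \<psi>p i x - \<beta> *\<^sub>p \<psi>m i x)"
    by (simp add: warped_phi_def form_apply pr_apply ds_apply fn_wedge)
  have g2: "grade (\<omega> i x) = \<omega> i x"
    using grade_of_degree[of 2 "\<omega> i x"] alt_forms[OF assms] by (simp add: alt_form_iff)
  \<comment> \<open>The sign from the odd degree cancels the one in the star of
    \<open>\<rho>'\<close>, so that the double star gives back \<open>\<rho>\<close>.\<close>
  have g3: "grade (\<psi>p i x) = - \<psi>p i x" "grade (\<psi>m i x) = - \<psi>m i x"
    using grade_of_degree[of 3 "\<psi>p i x"] grade_of_degree[of 3 "\<psi>m i x"] alt_forms[OF assms]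
    by (simp_all add: alt_form_iff)
  have "star7 \<phi> (i, j) (x, t) = (1 / ?c) *\<^sub>p pull_fst (P.star (grade (?c *\<^sub>p \<omega> i x))) +
      pull_fst (?c *\<^sub>p P.star (\<alpha> *\<^sub>p \<psi>p i x - \<beta> *\<^sub>p \<psi>m i x)) \<and>\<^sub>p covector_snd"
    by (rule P.warped_star[where \<eta> = \<phi> and f = f and M = M, OF phi _ _ nz]) (simp_all add: alt)
  then have s: "star7 \<phi> (i, j) (x, t) = pull_fst (?c *\<^sub>p (\<alpha> *\<^sub>p \<psi>m i x + \<beta> *\<^sub>p \<psi>p i x)) \<and>\<^sub>p covector_snd +
      pull_fst ((1/2) *\<^sub>p (\<omega> i x \<and>\<^sub>p \<omega> i x))"
    using nz by (simp add: alt P.star_linear P.star_special g2 pull_fst_linear(4) add.commute)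
  then show "star7 \<phi> (i, j) (x, t) = (pr ((1/2) *\<^sub>f (\<omega> \<and>\<^sub>f \<omega>)) + pr (fn M f \<and>\<^sub>f \<rho>') \<and>\<^sub>f ds) (i, j) (x, t)"
    by (simp add: form_apply pr_apply ds_apply fn_wedge add.commute)
  have "star7 (star7 \<phi>) (i, j) (x, t) = (1 / ?c) *\<^sub>p pull_fst (P.star (grade (?c *\<^sub>p (\<alpha> *\<^sub>p \<psi>m i x + \<beta> *\<^sub>p \<psi>p i x)))) +
      pull_fst (?c *\<^sub>p P.star ((1/2) *\<^sub>p (\<omega> i x \<and>\<^sub>p \<omega> i x))) \<and>\<^sub>p covector_snd"
    by (rule P.warped_star[where \<eta> = "star7 \<phi>" and f = f and M = M, OF s _ _ nz]) (simp_all add: alt)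
  then show "star7 (star7 \<phi>) (i, j) (x, t) = \<phi> (i, j) (x, t)"
    unfolding phi using nz
    by (simp add: alt P.star_linear P.star_special g3 pull_fst_linear scale_distrib add.commute)
qed

lemma ext_d_cong7:
  assumes "i \<in> idx M" "x \<in> cdom M i" "t \<in> {j<..<j + 2 * pi}"
    and "\<And>y s. y \<in> cdom M i \<Longrightarrow> s \<in> {j<..<j + 2 * pi} \<Longrightarrow> \<eta> (i, j) (y, s) = \<theta> (i, j) (y, s)"
  shows "ext_d \<eta> (i, j) (x, t) = ext_d \<theta> (i, j) (x, t)"
  using assms chart(1)[OF assms(1)]
  by (intro ext_d_cong(1)[of "cdom M i \<times> {j<..<j + 2 * pi}"]) (auto intro: open_Times)

lemma ext_d_star_phi:
  assumes "i \<in> idx M" "x \<in> cdom M i" "t \<in> {j<..<j + 2 * pi}"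
  shows "ext_d (star7 \<phi>) (i, j) (x, t) = 0"
    and "\<omega> i x \<and>\<^sub>p ext_d \<omega> i x = 0"
    and "ext_d (fn M f) i x \<and>\<^sub>p \<rho>' i x + f (par M i x) *\<^sub>p ext_d \<rho>' i x = 0"
proof -
  note fd = form_diffs[OF assms(1,2)] fn_diffs[OF assms(1,2)] and alt = alternatings[OF assms(1,2)]
  show 0: "ext_d (star7 \<phi>) (i, j) (x, t) = 0"
    using coclosed assms unfolding form_eq_def by (simp add: chart7_iff)
  have "ext_d (star7 \<phi>) (i, j) (x, t) = ext_d (pr ((1/2) *\<^sub>f (\<omega> \<and>\<^sub>f \<omega>)) + pr (fn M f \<and>\<^sub>f \<rho>') \<and>\<^sub>f ds) (i, j) (x, t)"
    using assms star_phi(1) by (intro ext_d_cong7) auto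
  also have "\<dots> = pull_fst (ext_d ((1/2) *\<^sub>f (\<omega> \<and>\<^sub>f \<omega>)) i x) + pull_fst (ext_d (fn M f \<and>\<^sub>f \<rho>') i x) \<and>\<^sub>p covector_snd"
    by (simp add: ext_d_linear ext_d_wedge ext_d_pr ext_d_ds fd ds_apply)
  finally have eq: "pull_fst (ext_d ((1/2) *\<^sub>f (\<omega> \<and>\<^sub>f \<omega>)) i x) + pull_fst (ext_d (fn M f \<and>\<^sub>f \<rho>') i x) \<and>\<^sub>p covector_snd = 0"
    using 0 by simp
  \<comment> \<open>The factor 1/2 cancels, since omega has even degree and so commutes with its
    derivative.\<close>
  have e1: "ext_d ((1/2) *\<^sub>f (\<omega> \<and>\<^sub>f \<omega>)) i x = \<omega> i x \<and>\<^sub>p ext_d \<omega> i x"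
  proof -
    have deg: "of_degree 2 (\<omega> i x)" "of_degree 3 (ext_d \<omega> i x)"
      using alt_forms[OF assms(1,2)] ext_d_of_degree[of "cdom M i" x 2 \<omega> i] chart(1)[OF assms(1)] assms(2)
        alt_forms(1)[OF assms(1)] by (auto simp: alt_form_iff eval_nat_numeral)
    have "grade (\<omega> i x) = \<omega> i x" using grade_of_degree[OF deg(1)] by simp
    moreover have "ext_d \<omega> i x \<and>\<^sub>p \<omega> i x = \<omega> i x \<and>\<^sub>p ext_d \<omega> i x"
      using wedge_commute[OF deg(2,1)] by simp
    ultimately show ?thesis by (simp add: ext_d_linear ext_d_wedge fd) (simp add: scale_def fun_eq_iff)
  qed
  have e2: "ext_d (fn M f \<and>\<^sub>f \<rho>') i x = ext_d (fn M f) i x \<and>\<^sub>p \<rho>' i x + f (par M i x) *\<^sub>p ext_d \<rho>' i x"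
    by (simp add: ext_d_linear ext_d_wedge fd) (simp add: fn_apply wedge_linear scale_distrib mult.commute)
  have "ext_d \<rho>' i x = \<alpha> *\<^sub>p ext_d \<psi>m i x + \<beta> *\<^sub>p ext_d \<psi>p i x" by (simp add: ext_d_linear fd)
  moreover have "\<rho>' i x = \<alpha> *\<^sub>p \<psi>m i x + \<beta> *\<^sub>p \<psi>p i x" by (simp only: form_apply)
  ultimately have "alternating (ext_d (fn M f) i x \<and>\<^sub>p \<rho>' i x + f (par M i x) *\<^sub>p ext_d \<rho>' i x)"
    "alternating (\<omega> i x \<and>\<^sub>p ext_d \<omega> i x)"
    by (simp_all add: alt alternating_wedge alternating_linear_space)
  from pull_fst_eq_0[OF eq[unfolded e1 e2] this(2,1)]
  show "\<omega> i x \<and>\<^sub>p ext_d \<omega> i x = 0"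
    "ext_d (fn M f) i x \<and>\<^sub>p \<rho>' i x + f (par M i x) *\<^sub>p ext_d \<rho>' i x = 0" .
qed

lemma torsion_relations:
  assumes "i \<in> idx M" "x \<in> cdom M i"
  shows "\<nu>1 i x = 0" "\<alpha> * \<sigma>0 (par M i x) + \<beta> * \<pi>0 (par M i x) = 0"
    and "(\<alpha> *\<^sub>f \<sigma>2 + \<beta> *\<^sub>f \<pi>2) i x = 0"
    and "ext_d (fn M f) i x = - (f (par M i x) *\<^sub>p \<pi>1 i x)"
proof -
  interpret P: su3_point \<omega> \<psi>p \<psi>m i x by (rule point[OF assms])
  note tor = torsion_at[OF assms] and aft = alt_forms[OF assms] and fd = form_diffs[OF assms]
    and alt = alternatings[OF assms]
  let ?c = "f (par M i x)" and ?df = "ext_d (fn M f) i x"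
  \<comment> \<open>The relations live on \<open>M\<close>, so any point of the circle serves; here
    it is the angle \<open>pi\<close> in the parametrisation with index 0.\<close>
  have t: "pi \<in> {0<..<0 + 2 * pi}" by (auto simp: pi_gt_zero)
  note dw = ext_d_star_phi(2,3)[OF assms t]
  have deg: "of_degree 2 (\<omega> i x)" "of_degree 3 (\<nu>3 i x)" using aft by (auto simp: alt_form_iff)
  have "\<omega> i x \<and>\<^sub>p \<nu>3 i x = 0" using wedge_commute[OF deg] tor(6) by simp
  then have "\<omega> i x \<and>\<^sub>p (\<nu>1 i x \<and>\<^sub>p \<omega> i x) = 0"
    using dw(1) by (simp add: tor(1) wedge_linear P.omega_psi)
  then show "\<nu>1 i x = 0" by (rule P.lefschetz[OF aft(5)])
  let ?t = "?c *\<^sub>p (\<alpha> *\<^sub>p \<sigma>2 i x + \<beta> *\<^sub>p \<pi>2 i x)" and ?a = "?df + ?c *\<^sub>p \<pi>1 i x"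
    and ?k = "?c * (\<alpha> * \<sigma>0 (par M i x) + \<beta> * \<pi>0 (par M i x))"
  have a: "alt_form 1 ?a"
    using alt_form_ext_d_fn[OF fn_diffs(1)[OF assms]] aft(4)
    by (auto simp: alt_form_iff alternating_linear_space of_degree_linear)
  have t2: "alt_form 2 ?t"
    using aft by (auto simp: alt_form_iff alternating_linear_space of_degree_linear)
  have st: "P.star ?t = - (?t \<and>\<^sub>p \<omega> i x)"
    using tor(4,5) alt
    by (simp add: P.star_linear alternating_linear_space star6_apply wedge_linear scale_distrib)
  have "ext_d \<rho>' i x = \<alpha> *\<^sub>p ext_d \<psi>m i x + \<beta> *\<^sub>p ext_d \<psi>p i x" by (simp add: ext_d_linear fd)
  then have "?k *\<^sub>p (\<omega> i x \<and>\<^sub>p \<omega> i x) + ?a \<and>\<^sub>p (\<alpha> *\<^sub>p \<psi>m i x + \<beta> *\<^sub>p \<psi>p i x) - ?t \<and>\<^sub>p \<omega> i x =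
      ?df \<and>\<^sub>p \<rho>' i x + ?c *\<^sub>p ext_d \<rho>' i x"
    unfolding form_apply tor
    by (simp only: wedge_linear fun_eq_iff apply_scale plus_fun_apply minus_apply) (simp add: algebra_simps)
  then have 0: "?k *\<^sub>p (\<omega> i x \<and>\<^sub>p \<omega> i x) + ?a \<and>\<^sub>p (\<alpha> *\<^sub>p \<psi>m i x + \<beta> *\<^sub>p \<psi>p i x) - ?t \<and>\<^sub>p \<omega> i x = 0"
    using dw(2) by simp
  note res = P.decomposition[OF ab a t2 st 0]
  show "\<alpha> * \<sigma>0 (par M i x) + \<beta> * \<pi>0 (par M i x) = 0"
    using res(1) f_nonzero[OF assms] by simp
  show "ext_d (fn M f) i x = - (?c *\<^sub>p \<pi>1 i x)"
    using res(2) by (simp add: eq_neg_iff_add_eq_0)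
  show "(\<alpha> *\<^sub>f \<sigma>2 + \<beta> *\<^sub>f \<pi>2) i x = 0"
    using res(3) f_nonzero[OF assms] unfolding form_apply by (simp add: fun_eq_iff apply_scale)
qed

section \<open>The codifferential of the dual 4-form and its exterior derivative\<close>

abbreviation "A \<equiv> star6 (\<pi>1 \<and>\<^sub>f \<omega>) + (3/2) *\<^sub>f (\<tau>0 \<and>\<^sub>f \<rho>) - star6 \<nu>3"
abbreviation "B \<equiv> 2 *\<^sub>f (\<tau>0 \<and>\<^sub>f \<omega>) + star6 (\<pi>1 \<and>\<^sub>f \<rho>) + \<tau>2"

lemma torsion_reduced:
  assumes "i \<in> idx M" "x \<in> cdom M i"
  shows "ext_d \<omega> i x = (3/2 * (\<alpha> * \<pi>0 (par M i x) - \<beta> * \<sigma>0 (par M i x))) *\<^sub>p \<rho>' i x + \<nu>3 i x"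
    and "ext_d \<rho> i x = (\<alpha> * \<pi>0 (par M i x) - \<beta> * \<sigma>0 (par M i x)) *\<^sub>p (\<omega> i x \<and>\<^sub>p \<omega> i x)
      + \<pi>1 i x \<and>\<^sub>p \<rho> i x - \<tau>2 i x \<and>\<^sub>p \<omega> i x"
proof -
  note tor = torsion_at[OF assms] and fd = form_diffs[OF assms]
  let ?s = "\<sigma>0 (par M i x)" and ?p = "\<pi>0 (par M i x)"
  have 0: "\<alpha> * ?s + \<beta> * ?p = 0" by (rule torsion_relations(2)[OF assms])
  \<comment> \<open>The pair (pi0, sigma0) is orthogonal to (beta, alpha), so it is a multiple of
    the unit vector (alpha, - beta); the factor is tau0.\<close>
  have "(\<alpha> * ?p - \<beta> * ?s) * \<alpha> = (\<alpha>\<^sup>2 + \<beta>\<^sup>2) * ?p - \<beta> * (\<alpha> * ?s + \<beta> * ?p)"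
    "(\<alpha> * ?p - \<beta> * ?s) * \<beta> = \<alpha> * (\<alpha> * ?s + \<beta> * ?p) - (\<alpha>\<^sup>2 + \<beta>\<^sup>2) * ?s"
    by (simp_all add: power2_eq_square algebra_simps)
  then have "(\<alpha> * ?p - \<beta> * ?s) * \<alpha> = ?p" "(\<alpha> * ?p - \<beta> * ?s) * \<beta> = - ?s"
    unfolding 0 ab by simp_all
  then have "(3/2 * (\<alpha> * ?p - \<beta> * ?s)) *\<^sub>p \<rho>' i x = - ((3/2 * ?s) *\<^sub>p \<psi>p i x) + (3/2 * ?p) *\<^sub>p \<psi>m i x"
    unfolding form_apply scale_distrib scale_simps mult.assoc by simp
  then show "ext_d \<omega> i x = (3/2 * (\<alpha> * ?p - \<beta> * ?s)) *\<^sub>p \<rho>' i x + \<nu>3 i x"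
    unfolding tor(1) torsion_relations(1)[OF assms] by simp
  have "ext_d \<rho> i x = \<alpha> *\<^sub>p ext_d \<psi>p i x - \<beta> *\<^sub>p ext_d \<psi>m i x" by (simp add: ext_d_linear fd)
  then show "ext_d \<rho> i x = (\<alpha> * ?p - \<beta> * ?s) *\<^sub>p (\<omega> i x \<and>\<^sub>p \<omega> i x) + \<pi>1 i x \<and>\<^sub>p \<rho> i x - \<tau>2 i x \<and>\<^sub>p \<omega> i x"
    unfolding form_apply tor
    by (simp only: wedge_linear fun_eq_iff apply_scale plus_fun_apply minus_apply) (simp add: algebra_simps)
qed

lemma star_ext_d_phi:
  assumes "i \<in> idx M" "x \<in> cdom M i"
  shows "star7 (ext_d \<phi>) (i, j) (x, t) = (pr A + pr (fn M f \<and>\<^sub>f B) \<and>\<^sub>f ds) (i, j) (x, t)"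
proof -
  interpret P: su3_point \<omega> \<psi>p \<psi>m i x by (rule point[OF assms])
  note fd = form_diffs[OF assms] fn_diffs[OF assms] and aft = alt_forms[OF assms]
    and rel = torsion_relations[OF assms] and tor = torsion_at[OF assms]
  note alt = alternatings[OF assms] alternating_wedge alternating_linear_space
  let ?c = "f (par M i x)" and ?T = "\<alpha> * \<pi>0 (par M i x) - \<beta> * \<sigma>0 (par M i x)"
  let ?r = "\<alpha> *\<^sub>p \<psi>p i x - \<beta> *\<^sub>p \<psi>m i x" and ?r' = "\<alpha> *\<^sub>p \<psi>m i x + \<beta> *\<^sub>p \<psi>p i x"
  let ?t = "\<alpha> *\<^sub>p \<pi>2 i x - \<beta> *\<^sub>p \<sigma>2 i x"
  let ?Z = "- (\<pi>1 i x \<and>\<^sub>p \<omega> i x) + (3/2 * ?T) *\<^sub>p ?r' + \<nu>3 i x"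
  let ?Y = "?T *\<^sub>p (\<omega> i x \<and>\<^sub>p \<omega> i x) + \<pi>1 i x \<and>\<^sub>p ?r - ?t \<and>\<^sub>p \<omega> i x"
  have nz: "?c \<noteq> 0" by (rule f_nonzero[OF assms])
  have dw: "ext_d (fn M f \<and>\<^sub>f \<omega>) i x = ?c *\<^sub>p ?Z"
  proof -
    have "ext_d (fn M f \<and>\<^sub>f \<omega>) i x = ext_d (fn M f) i x \<and>\<^sub>p \<omega> i x + ?c *\<^sub>p ext_d \<omega> i x"
      by (simp add: ext_d_wedge fd) (simp add: fn_apply wedge_linear)
    then show ?thesis
      unfolding rel torsion_reduced(1)[OF assms]
      by (simp add: wedge_linear scale_distrib form_apply mult_ac)
  qed
  have dphi: "ext_d \<phi> (i, j) (x, t) = pull_fst (?c *\<^sub>p ?Z) \<and>\<^sub>p covector_snd + pull_fst ?Y"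
  proof -
    have "ext_d \<phi> (i, j) (x, t) = pull_fst (ext_d (fn M f \<and>\<^sub>f \<omega>) i x) \<and>\<^sub>p covector_snd + pull_fst (ext_d \<rho> i x)"
      unfolding warped_phi_def
      by (subst ext_d_linear(5)) (simp_all only: ext_d_linear ext_d_wedge ext_d_pr ext_d_ds fd ds_apply wedge_zero add_0_right)
    then show ?thesis unfolding dw torsion_reduced(2)[OF assms] by (simp only: form_apply)
  qed
  have star: "star7 (ext_d \<phi>) (i, j) (x, t) = (1 / ?c) *\<^sub>p pull_fst (P.star (grade (?c *\<^sub>p ?Z))) +
      pull_fst (?c *\<^sub>p P.star ?Y) \<and>\<^sub>p covector_snd"
    by (rule P.warped_star[where \<eta> = "ext_d \<phi>" and f = f and M = M, OF dphi _ _ nz]) (simp_all add: alt)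
  have "of_degree 3 ?Z"
    using aft of_degree_wedge[of 1 "\<pi>1 i x" 2 "\<omega> i x"]
    by (intro of_degree_linear) (simp_all add: alt_form_iff eval_nat_numeral)
  then have "grade ?Z = - ?Z" using grade_of_degree[of 3 ?Z] by simp
  then have "P.star (grade (?c *\<^sub>p ?Z)) = - (?c *\<^sub>p P.star ?Z)"
    unfolding grade_linear(4) by (simp only: P.star_linear alt scale_simps)
  moreover have "P.star ?Z = - P.star (\<pi>1 i x \<and>\<^sub>p \<omega> i x) - (3/2 * ?T) *\<^sub>p ?r + P.star (\<nu>3 i x)"
    by (simp add: P.star_linear P.star_special alt scale_distrib)
  ultimately have 1: "(1 / ?c) *\<^sub>p P.star (grade (?c *\<^sub>p ?Z)) =
      P.star (\<pi>1 i x \<and>\<^sub>p \<omega> i x) + (3/2 * ?T) *\<^sub>p ?r - P.star (\<nu>3 i x)"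
    using nz by (simp add: scale_distrib)
  have t: "alt_form 2 ?t"
    using aft by (auto simp: alt_form_iff alternating_linear_space of_degree_linear)
  have "P.star ?t = - (?t \<and>\<^sub>p \<omega> i x)"
    using tor(4,5) by (simp add: P.star_linear alt star6_apply wedge_linear)
  then have "P.star (- (?t \<and>\<^sub>p \<omega> i x)) = ?t" using P.star_special(5)[OF t] by simp
  then have "P.star (?t \<and>\<^sub>p \<omega> i x) = - ?t"
    by (simp only: P.star_linear alt) (metis minus_minus)
  then have 2: "P.star ?Y = (2 * ?T) *\<^sub>p \<omega> i x + P.star (\<pi>1 i x \<and>\<^sub>p ?r) + ?t"
    by (simp only: P.star_linear P.star_special alt) (simp add: mult.commute)
  show ?thesis
    unfolding star 2 pull_fst_linear(4)[symmetric] 1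
    by (simp add: form_apply pr_apply ds_apply fn_wedge star6_apply)
qed

lemma star6_diffs:
  assumes "i \<in> idx M" "x \<in> cdom M i"
  shows "form_diff (star6 (\<pi>1 \<and>\<^sub>f \<omega>)) i x" "form_diff (star6 \<nu>3) i x" "form_diff (star6 (\<pi>1 \<and>\<^sub>f \<rho>)) i x"
  using form_diffs[OF assms] alternatings[OF assms(1)]
  by (intro su3_star_form_diff[OF su3 assms];
      simp add: form_apply alternating_wedge alternating_linear_space ext_d_linear ext_d_wedge)+

lemma laplacian_phi:
  assumes "i \<in> idx M" "x \<in> cdom M i" "t \<in> {j<..<j + 2 * pi}"
  shows "laplacian (warped_metric M f (su3_metric \<omega> \<psi>p \<psi>m)) (warped_vol M f (su3_vol \<omega>)) 4 (star7 \<phi>) (i, j) (x, t) =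
    pull_fst (ext_d A i x) + pull_fst (ext_d (fn M f \<and>\<^sub>f B) i x) \<and>\<^sub>p covector_snd"
proof -
  note fd = form_diffs[OF assms(1,2)] fn_diffs[OF assms(1,2)] star6_diffs[OF assms(1,2)]
  let ?cod = "codiff (warped_metric M f (su3_metric \<omega> \<psi>p \<psi>m)) (warped_vol M f (su3_vol \<omega>))"
  \<comment> \<open>The sign of the codifferential on 4-forms in dimension 7 is (-1)^(7 * 5 + 1) =
    1, and the double star of phi is phi.\<close>
  have 1: "?cod 4 (star7 \<phi>) (i, j) (y, s) = (pr A + pr (fn M f \<and>\<^sub>f B) \<and>\<^sub>f ds) (i, j) (y, s)"
    if y: "y \<in> cdom M i" and s: "s \<in> {j<..<j + 2 * pi}" for y s
  proof -
    have "ext_d (star7 (star7 \<phi>)) (i, j) (y, s) = ext_d \<phi> (i, j) (y, s)"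
      using star_phi(2)[OF assms(1)] by (intro ext_d_cong7[OF assms(1) y s]) auto
    then have "star7 (ext_d (star7 (star7 \<phi>))) (i, j) (y, s) = star7 (ext_d \<phi>) (i, j) (y, s)"
      by (simp add: hodge_def)
    then show ?thesis
      unfolding codiff_def form_apply(4) star_ext_d_phi[OF assms(1) y] by simp
  qed
  \<comment> \<open>The inner star is differentiated, so it must vanish near the point and not only
    at it; closedness holds on the whole coordinate domain.\<close>
  have 2: "?cod 5 (ext_d (star7 \<phi>)) (i, j) (x, t) = 0"
  proof -
    have s0: "star7 \<eta> (i, j) (y, s) = 0" if "y \<in> cdom M i" "\<eta> (i, j) (y, s) = 0" for \<eta> y s
    proof -
      interpret P: su3_point \<omega> \<psi>p \<psi>m i y by (rule point[OF assms(1) that(1)])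
      have "P.star 0 = 0" using P.star_linear(4)[of 0 0] by simp
      then show ?thesis
        using P.warped_star[of \<eta> j s 0 0 f M] that(2) f_nonzero[OF assms(1) that(1)]
        by (simp add: pull_fst_linear)
    qed
    have "ext_d (star7 (ext_d (star7 \<phi>))) (i, j) (x, t) = ext_d 0 (i, j) (x, t)"
      using ext_d_star_phi(1)[OF assms(1)] s0 by (intro ext_d_cong7[OF assms]) (simp add: form_apply)
    then have "star7 (ext_d (star7 (ext_d (star7 \<phi>)))) (i, j) (x, t) = 0"
      using s0[OF assms(2)] by (simp add: ext_d_zero)
    then show ?thesis by (simp only: codiff_def form_apply scale_simps)
  qed
  have "ext_d (?cod 4 (star7 \<phi>)) (i, j) (x, t) = ext_d (pr A + pr (fn M f \<and>\<^sub>f B) \<and>\<^sub>f ds) (i, j) (x, t)"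
    using 1 by (intro ext_d_cong7[OF assms])
  also have "\<dots> = pull_fst (ext_d A i x) + pull_fst (ext_d (fn M f \<and>\<^sub>f B) i x) \<and>\<^sub>p covector_snd"
    by (subst ext_d_linear(5))
       (simp_all only: ext_d_linear ext_d_wedge ext_d_pr ext_d_ds fd ds_apply wedge_zero add_0_right)
  finally show ?thesis
    using 2 by (simp add: laplacian_def form_apply(1) eval_nat_numeral)
qed

lemma ext_d_A:
  assumes "i \<in> idx M" "x \<in> cdom M i"
  shows "ext_d A i x = ((3/2) *\<^sub>f (\<tau>0 \<and>\<^sub>f (\<tau>0 \<and>\<^sub>f (\<omega> \<and>\<^sub>f \<omega>) + \<pi>1 \<and>\<^sub>f \<rho> - \<tau>2 \<and>\<^sub>f \<omega>))
                   + ext_d (star6 (\<pi>1 \<and>\<^sub>f \<omega>))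
                   - ext_d (star6 \<nu>3)
                   + (3/2) *\<^sub>f (ext_d \<tau>0 \<and>\<^sub>f \<rho>)) i x"
proof -
  note fd = form_diffs[OF assms] fn_diffs[OF assms] star6_diffs[OF assms]
  let ?T = "\<alpha> * \<pi>0 (par M i x) - \<beta> * \<sigma>0 (par M i x)"
  have fdr: "form_diff \<rho> i x" by (simp add: ext_d_linear fd)
  have "ext_d (\<tau>0 \<and>\<^sub>f \<rho>) i x = ext_d \<tau>0 i x \<and>\<^sub>p \<rho> i x + ?T *\<^sub>p ext_d \<rho> i x"
    unfolding ext_d_wedge(1)[OF fd(10) fdr] by (simp add: fn_apply wedge_linear)
  moreover have "ext_d A i x = ext_d (star6 (\<pi>1 \<and>\<^sub>f \<omega>)) i x + (3/2) *\<^sub>p ext_d (\<tau>0 \<and>\<^sub>f \<rho>) i x - ext_d (star6 \<nu>3) i x"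
    by (simp only: ext_d_linear ext_d_wedge fd fdr)
  ultimately show ?thesis
    unfolding torsion_reduced(2)[OF assms] form_apply fn_wedge
    by (simp add: scale_distrib)
qed

lemma ext_d_B:
  assumes "i \<in> idx M" "x \<in> cdom M i"
  shows "ext_d (fn M f \<and>\<^sub>f B) i x = (fn M f \<and>\<^sub>f
                   (2 *\<^sub>f (ext_d \<tau>0 \<and>\<^sub>f \<omega>)
                    + \<tau>0 \<and>\<^sub>f (- (2 *\<^sub>f (\<pi>1 \<and>\<^sub>f \<omega>)) - 3 *\<^sub>f (fn M \<sigma>0 \<and>\<^sub>f \<psi>p)
                            + 3 *\<^sub>f (fn M \<pi>0 \<and>\<^sub>f \<psi>m) + 2 *\<^sub>f \<nu>3)
                    + ext_d \<tau>2
                    - \<pi>1 \<and>\<^sub>f star6 (\<pi>1 \<and>\<^sub>f \<rho>)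
                    + ext_d (star6 (\<pi>1 \<and>\<^sub>f \<rho>))
                    - \<pi>1 \<and>\<^sub>f \<tau>2)) i x"
proof -
  note fd = form_diffs[OF assms] fn_diffs[OF assms] star6_diffs[OF assms] and tor = torsion_at[OF assms]
  let ?T = "\<alpha> * \<pi>0 (par M i x) - \<beta> * \<sigma>0 (par M i x)" and ?c = "f (par M i x)"
  have fdt: "form_diff \<tau>2 i x" by (simp add: ext_d_linear fd)
  have w: "ext_d (\<tau>0 \<and>\<^sub>f \<omega>) i x = ext_d \<tau>0 i x \<and>\<^sub>p \<omega> i x + ?T *\<^sub>p ext_d \<omega> i x"
    unfolding ext_d_wedge(1)[OF fd(10) fd(1)] by (simp add: fn_apply wedge_linear)
  have fdB: "form_diff B i x"
    by (simp only: ext_d_linear ext_d_wedge fd fdt)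
  have dB: "ext_d B i x = 2 *\<^sub>p ext_d (\<tau>0 \<and>\<^sub>f \<omega>) i x + ext_d (star6 (\<pi>1 \<and>\<^sub>f \<rho>)) i x + ext_d \<tau>2 i x"
    by (simp only: ext_d_linear ext_d_wedge fd fdt)
  have "ext_d (fn M f \<and>\<^sub>f B) i x = ext_d (fn M f) i x \<and>\<^sub>p B i x + ?c *\<^sub>p ext_d B i x"
    unfolding ext_d_wedge(1)[OF fd(9) fdB] by (simp add: fn_apply wedge_linear)
  also have "\<dots> = ?c *\<^sub>p (ext_d B i x - \<pi>1 i x \<and>\<^sub>p B i x)"
    unfolding torsion_relations(4)[OF assms] by (simp add: wedge_linear scale_distrib)
  finally have eq: "ext_d (fn M f \<and>\<^sub>f B) i x = ?c *\<^sub>p (ext_d B i x - \<pi>1 i x \<and>\<^sub>p B i x)" .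
  \<comment> \<open>These forms are atoms in the algebra that follows. For d omega the unreduced
    torsion equation is inserted, because the target keeps sigma0 and pi0 apart.\<close>
  define S D0 D2 where "S = star6 (\<pi>1 \<and>\<^sub>f \<rho>)" and "D0 = ext_d \<tau>0" and "D2 = ext_d \<tau>2"
  note defs = this
  show ?thesis
    unfolding eq dB w tor(1) torsion_relations(1)[OF assms]
    unfolding defs[symmetric] form_apply fn_wedge
    by (simp only: wedge_linear wedge_zero fun_eq_iff apply_scale plus_fun_apply minus_apply uminus_apply)
       (simp add: field_simps)
qed

text \<open>The differential of a constant is 0, and it equals - f pi1 with \<open>f\<close>
  nonzero.\<close>

lemma constant_pi1:
  assumes "i \<in> idx M" "x \<in> cdom M i" and c: "\<And>p. p \<in> topspace (mtop M) \<Longrightarrow> f p = c"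
  shows "\<pi>1 i x = 0"
proof -
  have "ext_d (fn M f) i x = ext_d (\<lambda>i x vs. if vs = [] then c else 0) i x"
    using c chart[OF assms(1)] assms(2) by (intro ext_d_cong(1)[of "cdom M i"]) (auto simp: fn_def)
  also have "\<dots> = 0" by (auto simp: ext_d_def fun_eq_iff frechet_derivative_const)
  finally show ?thesis
    using torsion_relations(4)[OF assms(1,2)] f_nonzero[OF assms(1,2)]
    by (simp add: fun_eq_iff apply_scale)
qed

text \<open>The product with pi1 vanishes on the whole coordinate domain, so the derivative of its
  star vanishes as well.\<close>

lemma constant_star_pi1:
  assumes "i \<in> idx M" "x \<in> cdom M i" and c: "\<And>p. p \<in> topspace (mtop M) \<Longrightarrow> f p = c"
  shows "star6 (\<pi>1 \<and>\<^sub>f \<theta>) i x = 0" "ext_d (star6 (\<pi>1 \<and>\<^sub>f \<theta>)) i x = 0"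
proof -
  have *: "star6 (\<pi>1 \<and>\<^sub>f \<theta>) i y = 0" if "y \<in> cdom M i" for y
  proof -
    interpret P: su3_point \<omega> \<psi>p \<psi>m i y by (rule point[OF assms(1) that])
    have "P.star 0 = 0" using P.star_linear(4)[of 0 0] by simp
    then show ?thesis
      using constant_pi1[OF assms(1) that c] by (simp add: star6_apply form_apply)
  qed
  then show "star6 (\<pi>1 \<and>\<^sub>f \<theta>) i x = 0" using assms(2) .
  have "ext_d (star6 (\<pi>1 \<and>\<^sub>f \<theta>)) i x = ext_d 0 i x"
    using * chart[OF assms(1)] assms(2) by (intro ext_d_cong(1)[of "cdom M i"]) (auto simp: form_apply)
  then show "ext_d (star6 (\<pi>1 \<and>\<^sub>f \<theta>)) i x = 0" by (simp add: ext_d_zero)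
qed

abbreviation "lap \<equiv> laplacian (warped_metric M f (su3_metric \<omega> \<psi>p \<psi>m)) (warped_vol M f (su3_vol \<omega>)) 4 (star7 \<phi>)"

lemma laplacian_formula:
  "form_eq (M \<times>\<^sub>m circle) lap
     (pr ((3/2) *\<^sub>f (\<tau>0 \<and>\<^sub>f (\<tau>0 \<and>\<^sub>f (\<omega> \<and>\<^sub>f \<omega>) + \<pi>1 \<and>\<^sub>f \<rho> - \<tau>2 \<and>\<^sub>f \<omega>))
         + ext_d (star6 (\<pi>1 \<and>\<^sub>f \<omega>)) - ext_d (star6 \<nu>3) + (3/2) *\<^sub>f (ext_d \<tau>0 \<and>\<^sub>f \<rho>))
      + pr (fn M f \<and>\<^sub>f
          (2 *\<^sub>f (ext_d \<tau>0 \<and>\<^sub>f \<omega>)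
           + \<tau>0 \<and>\<^sub>f (- (2 *\<^sub>f (\<pi>1 \<and>\<^sub>f \<omega>)) - 3 *\<^sub>f (fn M \<sigma>0 \<and>\<^sub>f \<psi>p) + 3 *\<^sub>f (fn M \<pi>0 \<and>\<^sub>f \<psi>m) + 2 *\<^sub>f \<nu>3)
           + ext_d \<tau>2 - \<pi>1 \<and>\<^sub>f star6 (\<pi>1 \<and>\<^sub>f \<rho>) + ext_d (star6 (\<pi>1 \<and>\<^sub>f \<rho>)) - \<pi>1 \<and>\<^sub>f \<tau>2)) \<and>\<^sub>f ds)"
  (is "form_eq _ _ (pr ?a + pr ?b \<and>\<^sub>f ds)")
  unfolding form_eq_def
proof (intro ballI)
  fix ij z assume "ij \<in> idx (M \<times>\<^sub>m circle)" "z \<in> cdom (M \<times>\<^sub>m circle) ij"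
  moreover obtain i j x t where ijz: "ij = (i, j)" "z = (x, t)" by (metis surj_pair)
  ultimately have h: "i \<in> idx M" "x \<in> cdom M i" "t \<in> {j<..<j + 2 * pi}"
    by (simp_all add: chart7_iff)
  show "lap ij z = (pr ?a + pr ?b \<and>\<^sub>f ds) ij z"
    unfolding ijz laplacian_phi[OF h] ext_d_A[OF h(1,2)] ext_d_B[OF h(1,2)]
    by (simp only: form_apply(1)[of "pr _"] form_apply(5)[of "pr _"] pr_apply ds_apply)
qed

lemma laplacian_formula_constant:
  assumes c: "\<forall>p\<in>topspace (mtop M). f p = c"
  shows "form_eq (M \<times>\<^sub>m circle) lap
     (pr ((3/2) *\<^sub>f (\<tau>0 \<and>\<^sub>f (\<tau>0 \<and>\<^sub>f (\<omega> \<and>\<^sub>f \<omega>) - \<tau>2 \<and>\<^sub>f \<omega>))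
         - ext_d (star6 \<nu>3) + (3/2) *\<^sub>f (ext_d \<tau>0 \<and>\<^sub>f \<rho>))
      + pr (fn M f \<and>\<^sub>f
          (2 *\<^sub>f (ext_d \<tau>0 \<and>\<^sub>f \<omega>)
           + \<tau>0 \<and>\<^sub>f (- (3 *\<^sub>f (fn M \<sigma>0 \<and>\<^sub>f \<psi>p)) + 3 *\<^sub>f (fn M \<pi>0 \<and>\<^sub>f \<psi>m) + 2 *\<^sub>f \<nu>3)
           + ext_d \<tau>2)) \<and>\<^sub>f ds)"
  (is "form_eq _ _ (pr ?a + pr ?b \<and>\<^sub>f ds)")
  unfolding form_eq_def
proof (intro ballI)
  fix ij z assume ijz0: "ij \<in> idx (M \<times>\<^sub>m circle)" "z \<in> cdom (M \<times>\<^sub>m circle) ij"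
  obtain i j x t where ijz: "ij = (i, j)" "z = (x, t)" by (metis surj_pair)
  with ijz0 have h: "i \<in> idx M" "x \<in> cdom M i"
    by (simp_all add: chart7_iff)
  have c': "\<And>p. p \<in> topspace (mtop M) \<Longrightarrow> f p = c" using c by blast
  note z = constant_pi1[OF h c'] constant_star_pi1[OF h c']
  define S S' D D' D0 D2 N where "S = star6 (\<pi>1 \<and>\<^sub>f \<rho>)" and "S' = star6 (\<pi>1 \<and>\<^sub>f \<omega>)"
    and "D = ext_d (star6 (\<pi>1 \<and>\<^sub>f \<rho>))" and "D' = ext_d (star6 (\<pi>1 \<and>\<^sub>f \<omega>))"
    and "D0 = ext_d \<tau>0" and "D2 = ext_d \<tau>2" and "N = ext_d (star6 \<nu>3)"
  note defs = this
  have z': "S i x = 0" "D i x = 0" "S' i x = 0" "D' i x = 0"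
    unfolding defs using z by blast+
  have a: "ext_d A i x = ?a i x"
    unfolding ext_d_A[OF h] unfolding defs(3,4)[symmetric]
    unfolding defs(1,2,5-)[symmetric] form_apply fn_wedge by (simp add: z(1) z')
  have b: "ext_d (fn M f \<and>\<^sub>f B) i x = ?b i x"
    unfolding ext_d_B[OF h] unfolding defs(3,4)[symmetric]
    unfolding defs(1,2,5-)[symmetric] form_apply fn_wedge by (simp add: z(1) z')
  have t: "t \<in> {j<..<j + 2 * pi}" using ijz ijz0 by (simp add: chart7_iff)
  show "lap ij z = (pr ?a + pr ?b \<and>\<^sub>f ds) ij z"
    unfolding ijz laplacian_phi[OF h t] a b
    by (simp only: form_apply(1)[of "pr _"] form_apply(5)[of "pr _"] pr_apply ds_apply)
qed

end

theorem proposition3p2: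
  fixes M :: "('a, 'i, real ^ 6) mfd"
    and \<omega> \<psi>p \<psi>m \<pi>1 \<nu>1 \<pi>2 \<sigma>2 \<nu>3 :: "('i, real ^ 6) form"
    and \<sigma>0 \<pi>0 f :: "'a \<Rightarrow> real"
    and \<alpha> \<beta> :: real
  assumes M: "smooth_manifold M"
    and su3: "su3_structure M \<omega> \<psi>p \<psi>m"
    and torsion: "su3_torsion M \<omega> \<psi>p \<psi>m \<sigma>0 \<pi>0 \<pi>1 \<nu>1 \<pi>2 \<sigma>2 \<nu>3"
    and f: "smooth_fun M f" "\<forall>p\<in>topspace (mtop M). f p \<noteq> 0"
    and ab: "\<alpha>\<^sup>2 + \<beta>\<^sup>2 = 1"
    and coclosed: "form_eq (M \<times>\<^sub>m circle)
      (ext_d (hodge (warped_metric M f (su3_metric \<omega> \<psi>p \<psi>m)) (warped_vol M f (su3_vol \<omega>))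
         (warped_phi M f \<alpha> \<beta> \<omega> \<psi>p \<psi>m))) 0"
  shows "let star6 = su3_star \<omega> \<psi>p \<psi>m;
             g7 = warped_metric M f (su3_metric \<omega> \<psi>p \<psi>m);
             vol7 = warped_vol M f (su3_vol \<omega>);
             \<phi> = warped_phi M f \<alpha> \<beta> \<omega> \<psi>p \<psi>m;
             \<tau>0 = fn M (\<lambda>p. \<alpha> * \<pi>0 p - \<beta> * \<sigma>0 p);
             \<tau>2 = \<alpha> *\<^sub>f \<pi>2 - \<beta> *\<^sub>f \<sigma>2;
             \<rho> = \<alpha> *\<^sub>f \<psi>p - \<beta> *\<^sub>f \<psi>m
         in (\<forall>p\<in>topspace (mtop M). \<alpha> * \<sigma>0 p + \<beta> * \<pi>0 p = 0) \<and>
            form_eq M (\<alpha> *\<^sub>f \<sigma>2 + \<beta> *\<^sub>f \<pi>2) 0 \<and>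
            form_eq (M \<times>\<^sub>m circle) (laplacian g7 vol7 4 (hodge g7 vol7 \<phi>))
              (pr ((3/2) *\<^sub>f (\<tau>0 \<and>\<^sub>f (\<tau>0 \<and>\<^sub>f (\<omega> \<and>\<^sub>f \<omega>) + \<pi>1 \<and>\<^sub>f \<rho> - \<tau>2 \<and>\<^sub>f \<omega>))
                   + ext_d (star6 (\<pi>1 \<and>\<^sub>f \<omega>))
                   - ext_d (star6 \<nu>3)
                   + (3/2) *\<^sub>f (ext_d \<tau>0 \<and>\<^sub>f \<rho>))
               + pr (fn M f \<and>\<^sub>f
                   (2 *\<^sub>f (ext_d \<tau>0 \<and>\<^sub>f \<omega>)
                    + \<tau>0 \<and>\<^sub>f (- (2 *\<^sub>f (\<pi>1 \<and>\<^sub>f \<omega>)) - 3 *\<^sub>f (fn M \<sigma>0 \<and>\<^sub>f \<psi>p)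
                            + 3 *\<^sub>f (fn M \<pi>0 \<and>\<^sub>f \<psi>m) + 2 *\<^sub>f \<nu>3)
                    + ext_d \<tau>2
                    - \<pi>1 \<and>\<^sub>f star6 (\<pi>1 \<and>\<^sub>f \<rho>)
                    + ext_d (star6 (\<pi>1 \<and>\<^sub>f \<rho>))
                    - \<pi>1 \<and>\<^sub>f \<tau>2)) \<and>\<^sub>f ds) \<and>
            ((\<exists>c. \<forall>p\<in>topspace (mtop M). f p = c) \<longrightarrow>
             form_eq (M \<times>\<^sub>m circle) (laplacian g7 vol7 4 (hodge g7 vol7 \<phi>))
              (pr ((3/2) *\<^sub>f (\<tau>0 \<and>\<^sub>f (\<tau>0 \<and>\<^sub>f (\<omega> \<and>\<^sub>f \<omega>) - \<tau>2 \<and>\<^sub>f \<omega>))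
                   - ext_d (star6 \<nu>3)
                   + (3/2) *\<^sub>f (ext_d \<tau>0 \<and>\<^sub>f \<rho>))
               + pr (fn M f \<and>\<^sub>f
                   (2 *\<^sub>f (ext_d \<tau>0 \<and>\<^sub>f \<omega>)
                    + \<tau>0 \<and>\<^sub>f (- (3 *\<^sub>f (fn M \<sigma>0 \<and>\<^sub>f \<psi>p))
                            + 3 *\<^sub>f (fn M \<pi>0 \<and>\<^sub>f \<psi>m) + 2 *\<^sub>f \<nu>3)
                    + ext_d \<tau>2)) \<and>\<^sub>f ds))"
proof -
  interpret W: warped_su3 M \<omega> \<psi>p \<psi>m \<pi>1 \<nu>1 \<pi>2 \<sigma>2 \<nu>3 \<sigma>0 \<pi>0 f \<alpha> \<beta>
    by unfold_locales fact+
  have "\<alpha> * \<sigma>0 p + \<beta> * \<pi>0 p = 0" if "p \<in> topspace (mtop M)" for p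
  proof -
    \<comment> \<open>The parametrisations cover \<open>M\<close>, so a relation that holds in all
      coordinate domains holds at every point.\<close>
    have "p \<in> (\<Union>i\<in>idx M. par M i ` cdom M i)"
      using M that unfolding smooth_manifold_def by simp
    then show ?thesis using W.torsion_relations(2) by auto
  qed
  moreover have "form_eq M (\<alpha> *\<^sub>f \<sigma>2 + \<beta> *\<^sub>f \<pi>2) 0"
    unfolding form_eq_def using W.torsion_relations(3) by (simp add: form_apply(6))
  ultimately show ?thesis
    unfolding Let_def using W.laplacian_formula W.laplacian_formula_constant by blast
qed

end
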